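(* Let $\Omega\subset\mathbb{R}^2$ be a bounded open set with Lipschitz boundary, and let $\gamma$ be a minimal curve for $\Omega$. There exists a parametrization of $\gamma$ such that \[ \operatorname{ind}_\gamma\big(\mathbb{R}^2\smallsetminus(\gamma)\big)\subset\{0,1\}. \] Moreover, if $\Omega$ is simply connected, then (for this parametrization) \[ \{z\in\mathbb{R}^2\smallsetminus(\gamma) : \operatorname{ind}_\gamma(z)=1\}\subset\Omega. \]
   Context: $\mathbb{S}^1$ is the circle. A regular curve is a closed curve $\gamma:\mathbb{S}^1\to\mathbb{R}^2$ with $\gamma,\gamma',\gamma''\in L^2(\mathbb{S}^1,\mathbb{R}^2)$ (so $\gamma\in C^1$) and $|\gamma'(t)|>0$ for all $t$; $(\gamma)$ denotes its image. Writing $\gamma:[0,L]\to\mathbb{R}^2$ for its arc-length parametrization, the bending energy is $\mathcal{W}(\gamma)=\int_0^L|\gamma''(s)|^2\,ds$. The set $\mathcal{A}$ of admissible curves is the set of regular closed curves with $(\gamma)\subset\overline\Omega$ all of whose self-intersections (if any) are tangential: if $\gamma(t)=\gamma(s)$ with $t\ne s$, then $\gamma'(t)$ and $\gamma'(s)$ are parallel (same or opposite directions). A minimal curve is a $\gamma\in\mathcal{A}$ with $\mathcal{W}(\gamma)=\min_{\tilde\gamma\in\mathcal{A}}\mathcal{W}(\tilde\gamma)$. Identifying $\mathbb{R}^2=\mathbb{C}$, the index of a closed, oriented, piecewise $C^1$ curve $\gamma$ around $z\in\mathbb{R}^2\smallsetminus(\gamma)$ is $\operatorname{ind}_\gamma(z)=\frac{1}{2i\pi}\int_{\mathbb{S}^1}\frac{\gamma'(s)}{\gamma(s)-z}\,ds$.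 "A parametrization of $\gamma$" means a (constant speed) admissible curve $\tilde\gamma:\mathbb{S}^1\to\mathbb{R}^2$ tracing the same set with the same multiplicities, i.e. $\#\tilde\gamma^{-1}(x)=\#\gamma^{-1}(x)$ for every $x\in\mathbb{R}^2$ (hence with the same energy); at tangential self-contact points the branches may be run through in a different way than by $\gamma$, and the orientation may be reversed. The curve so obtained is again denoted $\gamma$. *)

theory Defs
  imports "HOL-Complex_Analysis.Complex_Analysis"
begin

text \<open>The plane is identified with \<open>complex\<close>, and functions on a circle of length \<open>p > 0\<close> with
  \<open>p\<close>-periodic functions on \<open>real\<close>; \<open>\<S>\<^sup>1\<close> is the case \<open>p = 1\<close>.\<close>

definition L2_circle :: "real \<Rightarrow> (real \<Rightarrow> complex) set" where
  "L2_circle p = {f. f \<in> borel_measurable borel \<and> (\<forall>t. f (t + p) = f t)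
                     \<and> set_integrable lborel {0..p} (\<lambda>t. (norm (f t))\<^sup>2)}"

definition test_functions :: "real \<Rightarrow> (real \<Rightarrow> real) set" where
  "test_functions p = {\<phi>. (\<forall>t. \<phi> (t + p) = \<phi> t) \<and> (\<forall>n t. (deriv ^^ n) \<phi> differentiable (at t))}"

definition weak_deriv :: "real \<Rightarrow> (real \<Rightarrow> complex) \<Rightarrow> (real \<Rightarrow> complex) \<Rightarrow> bool" where
  "weak_deriv p f g \<longleftrightarrow> (\<forall>\<phi>\<in>test_functions p.
     (LBINT t:{0..p}. deriv \<phi> t *\<^sub>R f t) = - (LBINT t:{0..p}. \<phi> t *\<^sub>R g t))"

text \<open>\<open>f\<close>, \<open>f'\<close> and \<open>f'' = h\<close> are in \<open>L\<^sup>2\<close>; the function \<open>h\<close> is unique almost everywhere.\<close>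

definition weak_deriv2_L2 :: "real \<Rightarrow> (real \<Rightarrow> complex) \<Rightarrow> (real \<Rightarrow> complex) \<Rightarrow> bool" where
  "weak_deriv2_L2 p f h \<longleftrightarrow> f \<in> L2_circle p \<and> h \<in> L2_circle p
     \<and> (\<exists>g\<in>L2_circle p. weak_deriv p f g \<and> weak_deriv p g h)"

text \<open>Continuity only selects the continuous representative, which is then \<open>C\<^sup>1\<close> by the
  Sobolev embedding, so that the classical derivative in the last clause exists everywhere.\<close>

definition regular_curve :: "(real \<Rightarrow> complex) \<Rightarrow> bool" where
  "regular_curve \<gamma> \<longleftrightarrow> continuous_on UNIV \<gamma> \<and> (\<exists>h. weak_deriv2_L2 1 \<gamma> h)
     \<and> (\<forall>t. norm (vector_derivative \<gamma> (at t)) > 0)"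

text \<open>The arc length is signed, hence for regular \<open>\<gamma>\<close> an increasing bijection of the real line.\<close>

definition arc_length :: "(real \<Rightarrow> complex) \<Rightarrow> real \<Rightarrow> real" where
  "arc_length \<gamma> t = (LBINT u=0..t. norm (vector_derivative \<gamma> (at u)))"

definition arc_length_param :: "(real \<Rightarrow> complex) \<Rightarrow> real \<Rightarrow> complex" where
  "arc_length_param \<gamma> = \<gamma> \<circ> inv (arc_length \<gamma>)"

text \<open>The choice of the representative \<open>h\<close> of the second derivative is irrelevant.\<close>

definition bending_energy :: "(real \<Rightarrow> complex) \<Rightarrow> real" where
  "bending_energy \<gamma> = (let L = arc_length \<gamma> 1; h = (SOME h. weak_deriv2_L2 L (arc_length_param \<gamma>) h)
     in (LBINT s:{0..L}. (norm (h s))\<^sup>2))"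

definition admissible :: "complex set \<Rightarrow> (real \<Rightarrow> complex) set" where
  "admissible \<Omega> = {\<gamma>. regular_curve \<gamma> \<and> range \<gamma> \<subseteq> closure \<Omega>
     \<and> (\<forall>t\<in>{0..<1}. \<forall>s\<in>{0..<1}. t \<noteq> s \<and> \<gamma> t = \<gamma> s \<longrightarrow>
          (\<exists>c::real. vector_derivative \<gamma> (at t) = c *\<^sub>R vector_derivative \<gamma> (at s)))}"

definition minimal_curve :: "complex set \<Rightarrow> (real \<Rightarrow> complex) \<Rightarrow> bool" where
  "minimal_curve \<Omega> \<gamma> \<longleftrightarrow> \<gamma> \<in> admissible \<Omega> \<and> (\<forall>\<eta>\<in>admissible \<Omega>. bending_energy \<gamma> \<le> bending_energy \<eta>)"

text \<open>Fibres of a regular curve are finite, so \<open>card\<close> is the genuine number of preimages.\<close>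

definition parametrization_of :: "complex set \<Rightarrow> (real \<Rightarrow> complex) \<Rightarrow> (real \<Rightarrow> complex) \<Rightarrow> bool" where
  "parametrization_of \<Omega> \<gamma> \<eta> \<longleftrightarrow> \<eta> \<in> admissible \<Omega>
     \<and> (\<exists>c. \<forall>t. norm (vector_derivative \<eta> (at t)) = c)
     \<and> (\<forall>x. card {t\<in>{0..<1}. \<eta> t = x} = card {t\<in>{0..<1}. \<gamma> t = x})"

definition curve_index :: "(real \<Rightarrow> complex) \<Rightarrow> complex \<Rightarrow> complex" where
  "curve_index \<gamma> z = 1 / (2 * \<i> * complex_of_real pi) * contour_integral \<gamma> (\<lambda>w. 1 / (w - z))"

text \<open>Near every boundary point \<open>x\<close>, in Cartesian coordinates centred at \<open>x\<close> and rotated by a unit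
  number \<open>u\<close>, the set is the strict subgraph of a Lipschitz function.\<close>

definition lipschitz_boundary :: "complex set \<Rightarrow> bool" where
  "lipschitz_boundary \<Omega> \<longleftrightarrow> (\<forall>x\<in>frontier \<Omega>. \<exists>r>0. \<exists>u. norm u = 1 \<and>
     (\<exists>C. \<exists>f::real \<Rightarrow> real. C-lipschitz_on UNIV f \<and>
       (\<forall>z\<in>ball x r. z \<in> \<Omega> \<longleftrightarrow> Im ((z - x) / u) < f (Re ((z - x) / u)))))"

end

theory Submission imports Defs begin

text \<open>At a double point a minimal curve runs in opposite directions, since otherwise it could be cut there
  into two closed admissible curves, one of them with less energy. Hence there are no triple points, no
  two chords (pairs of parameters of a double point) are linked on the circle, and reversing the arc
  between the ends of a chord yields another minimal curve with the same fibres; call this a flip.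

  Fix \<open>\<delta> > 0\<close> and look only at points \<open>z\<close> far from the image compared with \<open>\<delta>\<close>. Cutting along
  chords of length at least \<open>\<delta>\<close> produces finitely many loops with only short chords. Collapsing the short
  chords of such a loop turns it into a Jordan curve without changing its winding numbers around these \<open>z\<close>,
  so these are all in \<open>{0, 1}\<close> or all in \<open>{0, -1}\<close>. As the loops touch in at most one point, flips
  orient them such that the winding numbers of the whole curve are in \<open>{0, 1}\<close>.

  For \<open>\<delta> \<rightarrow> 0\<close> the flipped curves subconverge in \<open>C\<^sup>1\<close> to a closed curve in the same image with no more
  energy. It has the same fibres: opposite tangents keep the two passages of a double point apart in the
  limit, and no passage is lost because a curve in the image that comes close to \<open>x\<close> and follows the
  tangent there must hit \<open>x\<close>.

  If \<open>\<Omega>\<close> is simply connected, every component of the complement of \<open>closure \<Omega>\<close> is unbounded, so the index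
  vanishes there, and by the Lipschitz property also at boundary points off the curve.\<close>

section \<open>Winding numbers and flips\<close>

text \<open>Nothing bounds the number of double points, and they may accumulate, so the loops cannot
  be oriented one by one: the induction that cuts along chords ends only at a positive scale, and
  compactness has to replace the passage to scale zero. Flips stay among the competitors because the
  tangents at the ends of a chord are opposite: the reversed arc then joins in C^1 and keeps its
  energy. The same fact rules out linked chords, since flipping one of them would make the two
  passages at the other double point run in the same direction.

  The energy is defined through weak derivatives, whereas cutting, reversing and taking limits are
  easy for a unit speed curve \<open>c\<close> with a tangent \<open>T\<close> whose increments are
  the integrals of some \<open>h\<close>. Two facts mediate between these views: the integrals over
  intervals determine \<open>h\<close> almost everywhere, and bounded dyadic difference quotients of
  \<open>T\<close> produce such an \<open>h\<close>. The second one gives both the existence of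
  \<open>h\<close> after reparametrization by arc length and the lower semicontinuity of the energy,
  where only finite sums have to pass to the limit.\<close>

definition wn :: "(real \<Rightarrow> complex) \<Rightarrow> real \<Rightarrow> real \<Rightarrow> complex \<Rightarrow> complex" where
  "wn q a b z = winding_number (\<lambda>x. q (a + (b - a) * x)) z"

lemma affine_image_Icc: "a \<le> b \<Longrightarrow> (\<lambda>x. a + (b - a) * x) ` {0..1} = {a..b}" for a b :: real
proof -
  assume "a \<le> b"
  have "(\<lambda>x. (b - a) * x + a) ` {0..1} = {a..b}"
    using image_affinity_atLeastAtMost[of "b - a" a 0 1] \<open>a \<le> b\<close> by auto
  then show ?thesis by (simp add: add.commute)
qed

lemma path_affine:
  assumes "continuous_on {a..b} q" "a \<le> b"
  shows "path (\<lambda>x. q (a + (b - a) * x))" "path_image (\<lambda>x. q (a + (b - a) * x)) = q ` {a..b}"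
    "pathstart (\<lambda>x. q (a + (b - a) * x)) = q a" "pathfinish (\<lambda>x. q (a + (b - a) * x)) = q b"
proof -
  show "path (\<lambda>x. q (a + (b - a) * x))"
    unfolding path_def
    by (rule continuous_on_compose2[OF assms(1)])
       (use affine_image_Icc[OF assms(2)] in \<open>auto intro!: continuous_intros\<close>)
  show "path_image (\<lambda>x. q (a + (b - a) * x)) = q ` {a..b}"
    unfolding path_image_def affine_image_Icc[OF assms(2), symmetric] image_image ..
qed (auto simp: pathstart_def pathfinish_def)

lemma wn_same: "q a \<noteq> z \<Longrightarrow> wn q a a z = 0"
  unfolding wn_def by (rule winding_number_constI) auto

text \<open>Affine rescaling turns both pieces into subpaths of one path, for which additivity is
  known.\<close>

lemma wn_combine:
  assumes "continuous_on {a..c} q" "a \<le> b" "b \<le> c" "z \<notin> q ` {a..c}"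
  shows "wn q a b z + wn q b c z = wn q a c z"
proof (cases "a = c")
  case True
  then show ?thesis using assms wn_same[of q a z] by auto
next
  case False
  define g where "g = (\<lambda>x. q (a + (c - a) * x))"
  define u where "u = (b - a) / (c - a)"
  have "c - a > 0" using False assms by auto
  have u: "u \<in> {0..1}" using assms \<open>c - a > 0\<close> by (auto simp: u_def field_simps)
  have g: "path g" "z \<notin> path_image g"
    unfolding g_def using path_affine[OF assms(1)] assms by auto
  have u': "(c - a) * u = b - a" using \<open>c - a > 0\<close> by (simp add: u_def)
  have 1: "a + (c - a) * ((u - 0) * x + 0) = a + (b - a) * x" for x
    using u' by (metis add.right_neutral diff_zero mult.assoc)
  have 2: "a + (c - a) * ((1 - u) * x + u) = b + (c - b) * x" for x
  proof -
    have "a + (c - a) * ((1 - u) * x + u) = a + ((c - a) - (c - a) * u) * x + (c - a) * u"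
      by (simp add: algebra_simps)
    then show ?thesis unfolding u' by (simp add: algebra_simps)
  qed
  have "winding_number (subpath 0 u g) z + winding_number (subpath u 1 g) z = winding_number (subpath 0 1 g) z"
    using winding_number_subpath_combine[OF g] u by auto
  then show ?thesis
    unfolding subpath_def g_def wn_def 1 2 by simp
qed

lemma wn_cong: "(\<And>t. a \<le> t \<Longrightarrow> t \<le> b \<Longrightarrow> p t = q t) \<Longrightarrow> a \<le> b \<Longrightarrow> wn p a b z = wn q a b z"
  unfolding wn_def using affine_image_Icc[of a b]
  by (intro winding_number_cong) (metis atLeastAtMost_iff image_eqI)

lemma wn_shift: "wn (\<lambda>s. q (s + k)) a b z = wn q (a + k) (b + k) z"
  unfolding wn_def by (simp add: algebra_simps)

lemma wn_rev:
  assumes "continuous_on {a..b} q" "a \<le> b" "z \<notin> q ` {a..b}"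
  shows "wn (\<lambda>s. q (a + b - s)) a b z = - wn q a b z"
proof -
  have "(\<lambda>x. q (a + b - (a + (b - a) * x))) = reversepath (\<lambda>x. q (a + (b - a) * x))"
    by (auto simp: reversepath_def fun_eq_iff algebra_simps)
  then show ?thesis unfolding wn_def
    using winding_number_reversepath path_affine[OF assms(1,2)] assms(3) by auto
qed

lemma wn_constant:
  assumes "continuous_on {a..b} q" "a \<le> b" "q a = q b" "connected S" "S \<inter> q ` {a..b} = {}" "x \<in> S" "y \<in> S"
  shows "wn q a b x = wn q a b y"
proof -
  have "winding_number (\<lambda>x. q (a + (b - a) * x)) constant_on S"
    by (rule winding_number_constant) (use path_affine[OF assms(1,2)] assms in auto)
  then show ?thesis using assms unfolding wn_def constant_on_def by metis
qed

lemma wn_at_infinity: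
  assumes "continuous_on {a..b} q" "a \<le> b" "q a = q b"
  shows "\<exists>B. \<forall>z. B \<le> norm z \<longrightarrow> wn q a b z = 0"
  unfolding wn_def using winding_number_zero_at_infinity path_affine[OF assms(1,2)] assms by auto

lemma wn_convex:
  assumes "continuous_on {a..b} q" "a \<le> b" "q a = q b" "convex S" "q ` {a..b} \<subseteq> S" "z \<notin> S"
  shows "wn q a b z = 0"
  unfolding wn_def
  by (rule winding_number_zero_outside[of _ S]) (use path_affine[OF assms(1,2)] assms in auto)

lemma wn_nearby:
  assumes "continuous_on {a..b} p" "continuous_on {a..b} q" "a \<le> b" "p a = p b" "q a = q b"
    "\<And>t. a \<le> t \<Longrightarrow> t \<le> b \<Longrightarrow> norm (p t - q t) < norm (q t - z)"
  shows "wn p a b z = wn q a b z"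
  unfolding wn_def
proof (rule winding_number_nearby_loops_eq)
  fix t :: real assume "t \<in> {0..1}"
  then have "a + (b - a) * t \<in> {a..b}" using affine_image_Icc[OF assms(3)] by blast
  then show "cmod (p (a + (b - a) * t) - q (a + (b - a) * t)) < cmod (q (a + (b - a) * t) - z)"
    using assms(6) by auto
qed (use path_affine[OF assms(1,3)] path_affine[OF assms(2,3)] assms in auto)

section \<open>Flips of loops\<close>

definition flip1 :: "real \<Rightarrow> real \<Rightarrow> (real \<Rightarrow> complex) \<Rightarrow> real \<Rightarrow> complex" where
  "flip1 a b q = (\<lambda>s. if a \<le> s \<and> s \<le> b then q (a + b - s) else q s)"

text \<open>A flip refers to the current curve \<open>q'\<close>, because earlier flips move the
  parameters of a chord. The trivial chord \<open>a = 0\<close>, \<open>b = L\<close> of a loop is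
  allowed and reverses all of it.\<close>

inductive flips :: "real \<Rightarrow> (real \<Rightarrow> complex) \<Rightarrow> (real \<Rightarrow> complex) \<Rightarrow> bool" for L where
  refl: "flips L q q"
| step: "flips L q q' \<Longrightarrow> 0 \<le> a \<Longrightarrow> a \<le> b \<Longrightarrow> b \<le> L \<Longrightarrow> q' a = q' b \<Longrightarrow> flips L q (flip1 a b q')"

lemma flips_trans: "flips L q r \<Longrightarrow> flips L p q \<Longrightarrow> flips L p r"
  by (induction rule: flips.induct) (auto intro: flips.intros)

lemma flips_one: "0 \<le> a \<Longrightarrow> a \<le> b \<Longrightarrow> b \<le> L \<Longrightarrow> q a = q b \<Longrightarrow> flips L q (flip1 a b q)"
  by (rule flips.step[OF flips.refl])

definition is_loop :: "real \<Rightarrow> (real \<Rightarrow> complex) \<Rightarrow> bool" where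
  "is_loop L q \<longleftrightarrow> 0 \<le> L \<and> continuous_on {0..L} q \<and> q 0 = q L"

lemma flip1_outside: "q a = q b \<Longrightarrow> a \<le> b \<Longrightarrow> s \<le> a \<or> b \<le> s \<Longrightarrow> flip1 a b q s = q s"
  by (cases "s = a"; cases "s = b") (auto simp: flip1_def)

lemma flip1_inside: "a \<le> s \<Longrightarrow> s \<le> b \<Longrightarrow> flip1 a b q s = q (a + b - s)"
  by (auto simp: flip1_def)

lemma flip1_invol: "flip1 a b (flip1 a b q) = q"
  by (auto simp: flip1_def fun_eq_iff)

lemma flip1_image:
  assumes "0 \<le> a" "a \<le> b" "b \<le> L"
  shows "flip1 a b q ` {0..L} = q ` {0..L}"
proof -
  have *: "flip1 a b q ` {0..L} \<subseteq> q ` {0..L}" for q :: "real \<Rightarrow> complex"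
  proof safe
    fix s assume s: "s \<in> {0..L}"
    show "flip1 a b q s \<in> q ` {0..L}"
      using s assms by (cases "a \<le> s \<and> s \<le> b") (auto simp: flip1_def intro!: imageI)
  qed
  from *[of q] *[of "flip1 a b q"] flip1_invol[of a b q] show ?thesis by auto
qed

lemma flip1_continuous:
  assumes "0 \<le> a" "a \<le> b" "b \<le> L" "q a = q b" "continuous_on {0..L} q"
  shows "continuous_on {0..L} (flip1 a b q)"
proof -
  have eq: "{0..L} = {0..a} \<union> ({a..b} \<union> {b..L})" using assms by auto
  have 1: "continuous_on {0..a} (flip1 a b q)"
    by (rule continuous_on_eq[OF continuous_on_subset[OF assms(5)]])
       (use assms in \<open>auto simp: flip1_def\<close>)
  have 3: "continuous_on {b..L} (flip1 a b q)"
    by (rule continuous_on_eq[OF continuous_on_subset[OF assms(5)]])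
       (use assms in \<open>auto simp: flip1_def\<close>)
  have "continuous_on {a..b} (\<lambda>s. q (a + b - s))"
    by (rule continuous_on_compose2[OF assms(5)]) (use assms in \<open>auto intro!: continuous_intros\<close>)
  then have 2: "continuous_on {a..b} (flip1 a b q)"
    by (rule continuous_on_eq) (auto simp: flip1_def)
  show ?thesis unfolding eq
    by (intro continuous_on_closed_Un 1 2 3) auto
qed

lemma flip1_loop:
  assumes "0 \<le> a" "a \<le> b" "b \<le> L" "q a = q b" "is_loop L q"
  shows "is_loop L (flip1 a b q)"
  using assms flip1_continuous[OF assms(1-4)] unfolding is_loop_def
  by (auto simp: flip1_def)

lemma flips_loop: "flips L q q' \<Longrightarrow> is_loop L q \<Longrightarrow> is_loop L q' \<and> q' ` {0..L} = q ` {0..L}"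
  by (induction rule: flips.induct) (auto intro: flip1_loop simp: flip1_image)

section \<open>Inserting one loop into another, and how flips act on the result\<close>

definition insert_loop :: "(real \<Rightarrow> complex) \<Rightarrow> (real \<Rightarrow> complex) \<Rightarrow> real \<Rightarrow> real \<Rightarrow> real \<Rightarrow> complex" where
  "insert_loop q2 q1 L1 x = (\<lambda>s. if s \<le> x then q2 s else if s \<le> x + L1 then q1 (s - x) else q2 (s - L1))"

text \<open>Shifting by \<open>x\<close> turns a chord of the inserted loop into a chord of the
  composite. The value \<open>q1' 0\<close> is carried along: a flip does not change the value at
  the base point, so the insertion still fits.\<close>

lemma insert_flip_inner:
  assumes "flips L1 q1 q1'" "is_loop L1 q1" "0 \<le> x" "x \<le> L2" "q2 x = q1 0"
  shows "flips (L2 + L1) (insert_loop q2 q1 L1 x) (insert_loop q2 q1' L1 x) \<and> q1' 0 = q2 x"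
  using assms
proof (induction rule: flips.induct)
  case (step q1 q1' a b)
  let ?p = "insert_loop q2 q1' L1 x"
  have IH: "flips (L2 + L1) (insert_loop q2 q1 L1 x) ?p" "q1' 0 = q2 x"
    using step.IH step.prems by auto
  have q1'L: "q1' L1 = q2 x"
    using flips_loop[OF step.hyps(1) step.prems(1)] IH(2) by (simp add: is_loop_def)
  have ar: "0 \<le> a" "a \<le> b" "b \<le> L1" "x \<le> L2" "0 \<le> x" and eq: "q1' a = q1' b" using step.hyps step.prems by auto
  have p': "?p (x + t) = q1' t" if "0 \<le> t" "t \<le> L1" for t
    using that IH(2) by (cases "t = 0") (simp_all add: insert_loop_def)
  have p: "?p (x + a) = ?p (x + b)"
    using p' ar eq by simp
  have *: "insert_loop q2 (flip1 a b q1') L1 x = flip1 (x + a) (x + b) ?p"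
  proof
    fix s
    consider "s \<le> x + a \<or> x + b \<le> s" | "x + a < s" "s < x + b" by linarith
    then show "insert_loop q2 (flip1 a b q1') L1 x s = flip1 (x + a) (x + b) ?p s"
    proof cases
      case 1
      then have "flip1 (x + a) (x + b) ?p s = ?p s" using p ar by (intro flip1_outside) auto
      moreover have "flip1 a b q1' (s - x) = q1' (s - x)" using 1 by (intro flip1_outside eq ar(2)) auto
      ultimately show ?thesis by (simp add: insert_loop_def)
    next
      case 2
      then have "flip1 (x + a) (x + b) ?p s = ?p (x + a + (x + b) - s)" by (intro flip1_inside) auto
      also have "x + a + (x + b) - s = x + (a + b - (s - x))" by simp
      also have "?p (x + (a + b - (s - x))) = q1' (a + b - (s - x))" using 2 ar by (intro p') auto
      also have "\<dots> = flip1 a b q1' (s - x)" using 2 by (subst flip1_inside) auto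
      finally show ?thesis using 2 ar by (simp add: insert_loop_def)
    qed
  qed
  have "flips (L2 + L1) (insert_loop q2 q1 L1 x) (flip1 (x + a) (x + b) ?p)"
    by (rule flips.step[OF IH(1)]) (use p ar in simp_all)
  moreover have "flip1 a b q1' 0 = q1' 0" using ar eq by (intro flip1_outside) auto
  ultimately show ?case unfolding * using IH(2) by simp
qed (auto intro: flips.refl)

text \<open>A chord of the outer loop that lies before or after the insertion point stays a chord of
  the composite. One that spans it becomes longer by \<open>L1\<close>; its flip also reverses the
  inserted loop and moves the insertion point to its mirror image. So the inserted loop always
  arrives as \<open>q1\<close> or as its full reversal.\<close>

lemma insert_flip_outer:
  assumes "flips L2 q2 q2'" "is_loop L1 q1" "0 \<le> x" "x \<le> L2" "q2 x = q1 0"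
  shows "\<exists>x' q1'. 0 \<le> x' \<and> x' \<le> L2 \<and> q1' \<in> {q1, flip1 0 L1 q1} \<and> q2' x' = q1 0
     \<and> flips (L2 + L1) (insert_loop q2 q1 L1 x) (insert_loop q2' q1' L1 x')"
  using assms
proof (induction rule: flips.induct)
  case (refl q)
  then show ?case by (intro exI[of _ x] exI[of _ q1]) (auto intro: flips.refl)
next
  case (step q q' a b)
  have L1: "0 \<le> L1" "q1 0 = q1 L1" using step by (auto simp: is_loop_def)
  from step obtain x' q1' where IH: "0 \<le> x'" "x' \<le> L2" "q1' \<in> {q1, flip1 0 L1 q1}" "q' x' = q1 0"
    "flips (L2 + L1) (insert_loop q q1 L1 x) (insert_loop q' q1' L1 x')" by blast
  have q1': "q1' 0 = q1 0" "q1' L1 = q1 0" using IH(3) L1 by (auto simp: flip1_def)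
  let ?p = "insert_loop q' q1' L1 x'"
  consider "b \<le> x'" | "x' \<le> a" | "a < x'" "x' < b" by linarith
  then show ?case
  proof cases
    case 1
    have ar: "0 \<le> a" "a \<le> b" "b \<le> L2" "b \<le> x'" "0 \<le> L1" and eq: "q' a = q' b" using 1 step.hyps L1 by auto
    have *: "insert_loop (flip1 a b q') q1' L1 x' = flip1 a b ?p"
    proof
      fix s
      consider "s < a" | "a \<le> s" "s \<le> b" | "b < s" by linarith
      then show "insert_loop (flip1 a b q') q1' L1 x' s = flip1 a b ?p s"
        by cases (use ar in \<open>simp_all add: insert_loop_def flip1_def\<close>)
    qed
    have p: "?p a = q' a" "?p b = q' b" using ar by (simp_all add: insert_loop_def)
    have f: "flips (L2 + L1) (insert_loop q q1 L1 x) (insert_loop (flip1 a b q') q1' L1 x')"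
      unfolding * by (rule flips.step[OF IH(5)]) (use ar p eq in simp_all)
    have e: "flip1 a b q' x' = q1 0" using ar eq IH(4) by (auto simp: flip1_def)
    show ?thesis by (intro exI[of _ x'] exI[of _ q1'] conjI IH(1-3) e f)
  next
    case 2
    have ar: "0 \<le> a" "a \<le> b" "x' \<le> a" "0 \<le> L1" and eq: "q' a = q' b" using 2 step.hyps L1 by auto
    have p: "?p (a + L1) = q' a"
      using ar eq IH(4) q1' by (cases "a = x'"; cases "L1 = 0") (simp_all add: insert_loop_def)
    moreover have "?p (b + L1) = q' b"
      using ar eq IH(4) q1' by (cases "b = x'"; cases "L1 = 0") (simp_all add: insert_loop_def)
    ultimately have p: "?p (a + L1) = q' a" "?p (b + L1) = q' b" by auto
    have *: "insert_loop (flip1 a b q') q1' L1 x' = flip1 (a + L1) (b + L1) ?p"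
    proof
      fix s
      consider "s \<le> a + L1" | "b + L1 \<le> s" | "a + L1 < s" "s < b + L1" by linarith
      then show "insert_loop (flip1 a b q') q1' L1 x' s = flip1 (a + L1) (b + L1) ?p s"
      proof cases
        case 1
        then have "flip1 (a + L1) (b + L1) ?p s = ?p s" using p eq ar by (intro flip1_outside) auto
        moreover have "insert_loop (flip1 a b q') q1' L1 x' s = ?p s"
          using 1 ar flip1_outside[OF eq ar(2), of s] flip1_outside[OF eq ar(2), of "s - L1"] by (simp add: insert_loop_def)
        ultimately show ?thesis by simp
      next
        case 2
        then have "flip1 (a + L1) (b + L1) ?p s = ?p s" using p eq ar by (intro flip1_outside) auto
        moreover have "insert_loop (flip1 a b q') q1' L1 x' s = ?p s"
          using 2 ar flip1_outside[OF eq ar(2), of s] flip1_outside[OF eq ar(2), of "s - L1"] by (simp add: insert_loop_def)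
        ultimately show ?thesis by simp
      next
        case 3
        then have "flip1 (a + L1) (b + L1) ?p s = ?p (a + L1 + (b + L1) - s)" by (intro flip1_inside) auto
        moreover have "?p (a + L1 + (b + L1) - s) = q' (a + b - (s - L1))" using 3 ar by (simp add: insert_loop_def algebra_simps)
        moreover have "flip1 a b q' (s - L1) = q' (a + b - (s - L1))" using 3 by (intro flip1_inside) auto
        ultimately show ?thesis using 3 ar by (simp add: insert_loop_def)
      qed
    qed
    have f: "flips (L2 + L1) (insert_loop q q1 L1 x) (insert_loop (flip1 a b q') q1' L1 x')"
      unfolding * by (rule flips.step[OF IH(5)]) (use ar p eq step.hyps(4) in simp_all)
    have e: "flip1 a b q' x' = q1 0" using ar eq IH(4) by (auto simp: flip1_def)
    show ?thesis by (intro exI[of _ x'] exI[of _ q1'] conjI IH(1-3) e f)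
  next
    case 3
    \<comment> \<open>The chord spans the insertion point: in the composite it runs from
      \<open>a\<close> to \<open>b + L1\<close>.\<close>
    let ?x = "a + b - x'"
    define q1'' where "q1'' = flip1 0 L1 q1'"
    have q1'': "q1'' \<in> {q1, flip1 0 L1 q1}" using IH(3) by (auto simp: q1''_def flip1_invol)
    have ar: "0 \<le> a" "a < x'" "x' < b" "0 \<le> L1" and eq: "q' a = q' b" using 3 step.hyps L1 by auto
    have p: "?p a = q' a" "?p (b + L1) = q' b"
      using ar eq IH(4) q1' by (auto simp: insert_loop_def)
    have *: "insert_loop (flip1 a b q') q1'' L1 ?x = flip1 a (b + L1) ?p"
    proof
      fix s
      let ?f = "flip1 a b q'"
      have ab: "a \<le> b" "a \<le> b + L1" using ar by auto
      consider "s \<le> a" | "b + L1 \<le> s" | "a \<le> s" "s < ?x" | "s = ?x" | "?x < s" "s \<le> ?x + L1" 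
        | "?x < s" "?x + L1 < s" "s < b + L1" by linarith
      then show "insert_loop ?f q1'' L1 ?x s = flip1 a (b + L1) ?p s"
      proof cases
        case 1
        then have "flip1 a (b + L1) ?p s = ?p s" using p eq ab by (intro flip1_outside) auto
        with 1 ar flip1_outside[OF eq ab(1), of s] show ?thesis by (simp add: insert_loop_def)
      next
        case 2
        then have "flip1 a (b + L1) ?p s = ?p s" using p eq ab by (intro flip1_outside) auto
        moreover have "?f (s - L1) = q' (s - L1)" using 2 flip1_outside[OF eq ab(1)] by simp
        ultimately show ?thesis using 2 ar by (simp add: insert_loop_def)
      next
        case 3
        then have "flip1 a (b + L1) ?p s = ?p (a + (b + L1) - s)" using ar by (intro flip1_inside) auto
        moreover have "?p (a + (b + L1) - s) = q' (a + b - s)" using 3 ar by (simp add: insert_loop_def algebra_simps)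
        ultimately show ?thesis using 3 ar by (simp add: insert_loop_def flip1_inside)
      next
        case 4
        then have "flip1 a (b + L1) ?p s = ?p (a + (b + L1) - s)" using ar by (intro flip1_inside) auto
        also have "a + (b + L1) - s = x' + L1" using 4 by simp
        also have "?p (x' + L1) = q' x'" using ar q1' IH(4) by (cases "L1 = 0") (simp_all add: insert_loop_def)
        finally show ?thesis using 4 ar by (simp add: insert_loop_def flip1_inside)
      next
        case 5
        then have "flip1 a (b + L1) ?p s = ?p (a + (b + L1) - s)" using ar by (intro flip1_inside) auto
        also have "\<dots> = q1' (L1 - (s - ?x))"
        proof (cases "s = ?x + L1")
          case True
          then have "a + (b + L1) - s = x'" by simp
          then show ?thesis using True q1' IH(4) by (simp add: insert_loop_def)
        next
          case False
          then have 1: "\<not> a + (b + L1) - s \<le> x'" "a + (b + L1) - s \<le> x' + L1" "a + (b + L1) - s - x' = L1 - (s - ?x)" using 5 by auto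
          show ?thesis unfolding insert_loop_def 1(3) if_not_P[OF 1(1)] if_P[OF 1(2)] ..
        qed
        also have "\<dots> = q1'' (s - ?x)" using 5 unfolding q1''_def by (subst flip1_inside) auto
        also have "\<dots> = insert_loop ?f q1'' L1 ?x s"
          unfolding insert_loop_def if_P[OF 5(2)] using 5(1) by (subst if_not_P) auto
        finally show ?thesis ..
      next
        case 6
        then have "flip1 a (b + L1) ?p s = ?p (a + (b + L1) - s)" using ar by (intro flip1_inside) auto
        moreover have "?p (a + (b + L1) - s) = q' (a + b - (s - L1))" using 6 ar by (simp add: insert_loop_def algebra_simps)
        moreover have "?f (s - L1) = q' (a + b - (s - L1))" using 6 ar by (intro flip1_inside) auto
        ultimately show ?thesis using 6 ar by (simp add: insert_loop_def)
      qed
    qed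
    have f: "flips (L2 + L1) (insert_loop q q1 L1 x) (insert_loop (flip1 a b q') q1'' L1 ?x)"
      unfolding * by (rule flips.step[OF IH(5)]) (use ar p eq step.hyps(4) in simp_all)
    have e: "flip1 a b q' ?x = q1 0" using ar eq IH(4) by (auto simp: flip1_def)
    have x: "0 \<le> ?x" "?x \<le> L2" using 3 step.hyps by auto
    show ?thesis by (intro exI[of _ ?x] exI[of _ q1''] conjI x q1'' e f)
  qed
qed

lemma insert_loop_continuous:
  assumes "is_loop L1 q1" "is_loop L2 q2" "0 \<le> x" "x \<le> L2" "q2 x = q1 0"
  shows "continuous_on {0..L2 + L1} (insert_loop q2 q1 L1 x)"
proof -
  let ?p = "insert_loop q2 q1 L1 x"
  have c: "continuous_on {0..L1} q1" "continuous_on {0..L2} q2" "0 \<le> L1" "q1 L1 = q1 0"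
    using assms by (auto simp: is_loop_def)
  have eq: "{0..L2 + L1} = {0..x} \<union> ({x..x + L1} \<union> {x + L1..L2 + L1})" using assms c by auto
  have 1: "continuous_on {0..x} ?p"
    by (rule continuous_on_eq[OF continuous_on_subset[OF c(2)]])
       (use assms in \<open>auto simp: insert_loop_def\<close>)
  have "continuous_on {x..x + L1} (\<lambda>s. q1 (s - x))"
    by (rule continuous_on_compose2[OF c(1)]) (use assms in \<open>auto intro!: continuous_intros\<close>)
  then have 2: "continuous_on {x..x + L1} ?p"
    by (rule continuous_on_eq) (use assms c in \<open>auto simp: insert_loop_def\<close>)
  have "continuous_on {x + L1..L2 + L1} (\<lambda>s. q2 (s - L1))"
    by (rule continuous_on_compose2[OF c(2)]) (use assms in \<open>auto intro!: continuous_intros\<close>)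
  then have 3: "continuous_on {x + L1..L2 + L1} ?p"
    by (rule continuous_on_eq) (use assms c in \<open>auto simp: insert_loop_def\<close>)
  show ?thesis unfolding eq
    by (intro continuous_on_closed_Un 1 2 3) auto
qed

lemma insert_loop_image:
  assumes "is_loop L1 q1" "is_loop L2 q2" "0 \<le> x" "x \<le> L2" "q2 x = q1 0"
  shows "insert_loop q2 q1 L1 x ` {0..L2 + L1} \<subseteq> q2 ` {0..L2} \<union> q1 ` {0..L1}"
  using assms by (auto simp: insert_loop_def is_loop_def)

lemma wn_insert_loop:
  assumes "is_loop L1 q1" "is_loop L2 q2" "0 \<le> x" "x \<le> L2" "q2 x = q1 0"
    and z: "z \<notin> q2 ` {0..L2}" "z \<notin> q1 ` {0..L1}"
  shows "wn (insert_loop q2 q1 L1 x) 0 (L2 + L1) z = wn q2 0 L2 z + wn q1 0 L1 z"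
proof -
  let ?p = "insert_loop q2 q1 L1 x"
  have c: "continuous_on {0..L1} q1" "continuous_on {0..L2} q2" "0 \<le> L1" "q1 L1 = q1 0"
    using assms by (auto simp: is_loop_def)
  have z': "z \<notin> ?p ` {0..L2 + L1}" using insert_loop_image[OF assms(1-5)] z by auto
  note cont = insert_loop_continuous[OF assms(1-5)]
  have "wn ?p 0 (L2 + L1) z = wn ?p 0 x z + wn ?p x (L2 + L1) z"
    by (rule wn_combine[symmetric]) (use cont z' assms c in auto)
  also have "wn ?p x (L2 + L1) z = wn ?p x (x + L1) z + wn ?p (x + L1) (L2 + L1) z"
    by (rule wn_combine[symmetric])
       (use continuous_on_subset[OF cont, of "{x..L2 + L1}"] z' assms c in auto)
  also have "wn ?p 0 x z = wn q2 0 x z"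
    by (rule wn_cong) (use assms in \<open>auto simp: insert_loop_def\<close>)
  also have "wn ?p x (x + L1) z = wn (\<lambda>s. q1 (s + (- x))) x (x + L1) z"
    by (rule wn_cong) (use assms c in \<open>auto simp: insert_loop_def\<close>)
  also have "\<dots> = wn q1 0 L1 z" by (subst wn_shift) simp
  also have "wn ?p (x + L1) (L2 + L1) z = wn (\<lambda>s. q2 (s + (- L1))) (x + L1) (L2 + L1) z"
    by (rule wn_cong) (use assms c in \<open>auto simp: insert_loop_def\<close>)
  also have "\<dots> = wn q2 x L2 z" by (subst wn_shift) simp
  also have "wn q2 0 x z + (wn q1 0 L1 z + wn q2 x L2 z) = (wn q2 0 x z + wn q2 x L2 z) + wn q1 0 L1 z" by simp
  also have "wn q2 0 x z + wn q2 x L2 z = wn q2 0 L2 z"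
    by (rule wn_combine) (use assms c in auto)
  finally show ?thesis .
qed

text \<open>The weak inequality \<open>c \<le> b\<close> also excludes triple points, as the case
  \<open>b = c\<close>; the bound \<open>d < L\<close> keeps the trivial chord from \<open>0\<close>
  to \<open>L\<close> out.\<close>

definition unlinked :: "real \<Rightarrow> (real \<Rightarrow> complex) \<Rightarrow> bool" where
  "unlinked L q \<longleftrightarrow> (\<forall>a b c d. 0 \<le> a \<and> a < c \<and> c \<le> b \<and> b < d \<and> d < L \<longrightarrow> \<not> (q a = q b \<and> q c = q d))"

lemma unlinkedD: "unlinked L q \<Longrightarrow> 0 \<le> a \<Longrightarrow> a < c \<Longrightarrow> c \<le> b \<Longrightarrow> b < d \<Longrightarrow> d < L \<Longrightarrow> q a = q b \<Longrightarrow> q c = q d \<Longrightarrow> False"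
  unfolding unlinked_def by blast

lemma unlinked_triple: "unlinked L q \<Longrightarrow> 0 \<le> a \<Longrightarrow> a < b \<Longrightarrow> b < c \<Longrightarrow> c < L \<Longrightarrow> q a = q b \<Longrightarrow> q b = q c \<Longrightarrow> False"
  using unlinkedD[of L q a b b c] by simp

text \<open>An order preserving change of parameters carries linked chords to linked chords. For the
  inner loop of a cut it is a shift, for the outer loop a map that jumps over the removed
  arc.\<close>

lemma unlinked_mono:
  assumes "unlinked L q" "\<And>s t. 0 \<le> s \<Longrightarrow> s < t \<Longrightarrow> t < M \<Longrightarrow> f s < f t"
    "\<And>s. 0 \<le> s \<Longrightarrow> s < M \<Longrightarrow> 0 \<le> f s \<and> f s < L \<and> q' s = q (f s)"
  shows "unlinked M q'"
  unfolding unlinked_def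
proof (intro allI impI notI)
  fix a b c d assume H: "0 \<le> a \<and> a < c \<and> c \<le> b \<and> b < d \<and> d < M" "q' a = q' b \<and> q' c = q' d"
  then have "f c \<le> f b" using assms(2)[of c b] by (cases "c = b") auto
  then show False
    using H assms(2)[of a c] assms(2)[of b d] assms(3)[of a] assms(3)[of b] assms(3)[of c] assms(3)[of d]
    by (intro unlinkedD[OF assms(1), of "f a" "f c" "f b" "f d"]) auto
qed

text \<open>Let \<open>V\<close> be the component of \<open>z\<close> in the complement of
  \<open>C1\<close>. If \<open>V\<close> does not meet \<open>C2\<close> away from \<open>p\<close>,
  then it accumulates at a point of \<open>C1 - {p}\<close>: otherwise it would be open and closed
  in the punctured plane, which is connected, and hence fill it. Adding that point to
  \<open>V\<close> gives a connected set that avoids \<open>C2\<close>.\<close>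

lemma touching_continua_dichotomy:
  fixes C1 C2 :: "complex set"
  assumes "compact C1" "C1 \<inter> C2 \<subseteq> {p}" "p \<in> C1" "C1 - {p} \<noteq> {}" "z \<notin> C1" "z \<notin> C2"
  shows "\<exists>S. connected S \<and> z \<in> S \<and> ((S \<inter> C1 = {} \<and> S \<inter> (C2 - {p}) \<noteq> {}) \<or> (S \<inter> C2 = {} \<and> S \<inter> (C1 - {p}) \<noteq> {}))"
proof -
  define V where "V = connected_component_set (- C1) z"
  have V: "connected V" "z \<in> V" "V \<subseteq> - C1" "open V"
    unfolding V_def using assms compact_imp_closed[OF assms(1)]
    by (auto simp: open_connected_component open_Compl dest: connected_component_in)
  show ?thesis
  proof (cases "V \<inter> (C2 - {p}) = {}")
    case False
    then show ?thesis using V by blast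
  next
    case True
    have "closure V \<inter> (C1 - {p}) \<noteq> {}"
    proof
      assume *: "closure V \<inter> (C1 - {p}) = {}"
      have "closure V \<subseteq> V \<union> C1"
      proof
        fix y assume y: "y \<in> closure V"
        show "y \<in> V \<union> C1"
        proof (rule ccontr)
          assume n: "y \<notin> V \<union> C1"
          have "connected (insert y V)"
            by (rule connected_intermediate_closure[OF V(1)]) (use y closure_subset in auto)
          then have "insert y V \<subseteq> V"
            unfolding V_def using V n
            by (intro connected_component_maximal) (auto simp: V_def)
          then show False using n by auto
        qed
      qed
      then have "closure V \<inter> (- {p}) = V" using * closure_subset[of V] V assms(3) by blast
      then have "closedin (top_of_set (- {p})) V" 
        by (metis closed_closure closedin_closed_Int inf_commute)
      moreover have "openin (top_of_set (- {p})) V" 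
        using V assms(3) by (intro open_subset) auto
      moreover have "connected (- {p})" by (rule connected_punctured_universe) simp
      ultimately have "V = - {p}" using V(2) unfolding connected_clopen by blast
      then show False using V assms by blast
    qed
    then obtain x where x: "x \<in> closure V" "x \<in> C1 - {p}" by blast
    have "connected (insert x V)"
      by (rule connected_intermediate_closure[OF V(1)]) (use x closure_subset in auto)
    moreover have "insert x V \<inter> C2 = {}" using True x V assms by blast
    ultimately show ?thesis using V x by blast
  qed
qed

text \<open>The winding number of each loop is constant on the other loop away from
  \<open>p\<close>, say \<open>e1\<close> and \<open>e2\<close>. By the dichotomy every point off
  both loops can be joined to one loop without crossing the other, so one of the two winding numbers
  takes that constant value there. A point near infinity shows that \<open>e1\<close> or
  \<open>e2\<close> is zero.\<close>

lemma touching_loops_wn: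
  fixes q1 q2 :: "real \<Rightarrow> complex" and L1 L2 :: real
  defines "C1 \<equiv> q1 ` {0..L1}" and "C2 \<equiv> q2 ` {0..L2}"
  assumes l: "is_loop L1 q1" "is_loop L2 q2" and p: "C1 \<inter> C2 \<subseteq> {p}" "p \<in> C1" "p \<in> C2"
    and ne: "C1 - {p} \<noteq> {}" "C2 - {p} \<noteq> {}" and con: "connected (C1 - {p})" "connected (C2 - {p})"
    and Z: "Z \<inter> (C1 \<union> C2) = {}"
    and w: "\<And>z. z \<in> Z \<Longrightarrow> wn q1 0 L1 z \<in> {0, 1}" "\<And>z. z \<in> Z \<Longrightarrow> wn q2 0 L2 z \<in> {0, 1}"
  shows "(\<forall>z\<in>Z. wn q1 0 L1 z + wn q2 0 L2 z \<in> {0, 1}) \<or> (\<forall>z\<in>Z. wn q2 0 L2 z - wn q1 0 L1 z \<in> {0, 1})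
    \<or> (\<forall>z\<in>Z. wn q1 0 L1 z - wn q2 0 L2 z \<in> {0, 1})"
proof -
  have c: "continuous_on {0..L1} q1" "continuous_on {0..L2} q2" "0 \<le> L1" "0 \<le> L2" "q1 0 = q1 L1" "q2 0 = q2 L2"
    using l by (auto simp: is_loop_def)
  have "compact C1" unfolding C1_def by (intro compact_continuous_image c) auto
  obtain y1 y2 where y: "y1 \<in> C1 - {p}" "y2 \<in> C2 - {p}" using ne by blast
  define e1 e2 where "e1 = wn q1 0 L1 y2" and "e2 = wn q2 0 L2 y1"
  have k1: "wn q1 0 L1 z = wn q1 0 L1 z'" if "connected S" "S \<inter> C1 = {}" "z \<in> S" "z' \<in> S" for S z z'
    using wn_constant[OF c(1,3,5) that(1) _ that(3,4)] that(2) unfolding C1_def by blast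
  have k2: "wn q2 0 L2 z = wn q2 0 L2 z'" if "connected S" "S \<inter> C2 = {}" "z \<in> S" "z' \<in> S" for S z z'
    using wn_constant[OF c(2,4,6) that(1) _ that(3,4)] that(2) unfolding C2_def by blast
  have e1: "wn q1 0 L1 z = e1" if "z \<in> C2 - {p}" for z
    unfolding e1_def by (rule k1[OF con(2)]) (use p y that in blast)+
  have e2: "wn q2 0 L2 z = e2" if "z \<in> C1 - {p}" for z
    unfolding e2_def by (rule k2[OF con(1)]) (use p y that in blast)+
  have dich: "wn q1 0 L1 z = e1 \<or> wn q2 0 L2 z = e2" if z: "z \<notin> C1 \<union> C2" for z
  proof -
    obtain S where S: "connected S" "z \<in> S" "(S \<inter> C1 = {} \<and> S \<inter> (C2 - {p}) \<noteq> {}) \<or> (S \<inter> C2 = {} \<and> S \<inter> (C1 - {p}) \<noteq> {})"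
      using touching_continua_dichotomy[OF \<open>compact C1\<close> p(1,2) ne(1), of z] z by blast
    from S(3) show ?thesis
    proof
      assume "S \<inter> C1 = {} \<and> S \<inter> (C2 - {p}) \<noteq> {}"
      then obtain y where "y \<in> S" "y \<in> C2 - {p}" "S \<inter> C1 = {}" by blast
      then show ?thesis using k1[OF S(1) _ S(2)] e1 by metis
    next
      assume "S \<inter> C2 = {} \<and> S \<inter> (C1 - {p}) \<noteq> {}"
      then obtain y where "y \<in> S" "y \<in> C1 - {p}" "S \<inter> C2 = {}" by blast
      then show ?thesis using k2[OF S(1) _ S(2)] e2 by metis
    qed
  qed
  have "e1 = 0 \<or> e2 = 0"
  proof -
    obtain B1 where B1: "\<And>z. B1 \<le> norm z \<Longrightarrow> wn q1 0 L1 z = 0" using wn_at_infinity[OF c(1,3,5)] by blast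
    obtain B2 where B2: "\<And>z. B2 \<le> norm z \<Longrightarrow> wn q2 0 L2 z = 0" using wn_at_infinity[OF c(2,4,6)] by blast
    have "bounded (C1 \<union> C2)" unfolding C1_def C2_def
      using c by (intro bounded_Un[THEN iffD2] conjI compact_imp_bounded compact_continuous_image) auto
    then obtain B3 where B3: "\<And>z. z \<in> C1 \<union> C2 \<Longrightarrow> norm z \<le> B3" unfolding bounded_iff by blast
    \<comment> \<open>A far point on the real axis; adding the absolute value makes \<open>r\<close>
      nonnegative, so that it is its own norm.\<close>
    define r where "r = max B1 (max B2 (B3 + 1)) + \<bar>B3\<bar>"
    have "r \<ge> B1" "r \<ge> B2" "r > B3" "r \<ge> 0" by (auto simp: r_def)
    then have "norm (complex_of_real r) = r" by simp
    then have "complex_of_real r \<notin> C1 \<union> C2" using B3[of "complex_of_real r"] \<open>r > B3\<close> by auto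
    from dich[OF this] show ?thesis
      using B1[of "complex_of_real r"] B2[of "complex_of_real r"] \<open>norm (complex_of_real r) = r\<close> \<open>r \<ge> B1\<close> \<open>r \<ge> B2\<close> by auto
  qed
  have D: "wn q1 0 L1 z = e1 \<or> wn q2 0 L2 z = e2" if "z \<in> Z" for z using dich Z that by blast
  \<comment> \<open>These are loops side by side, the first inside the second, and the second inside
    the first. In a nested case, wherever the inner loop has a nonzero winding number, the outer one
    has its nonzero constant value, which must be 1 on \<open>Z\<close>; so the difference stays in
    range.\<close>
  consider "e1 = 0" "e2 = 0" | "e1 = 0" "e2 \<noteq> 0" | "e1 \<noteq> 0" "e2 = 0" using \<open>e1 = 0 \<or> e2 = 0\<close> by blast
  then show ?thesis
  proof cases
    case 1
    then have "\<forall>z\<in>Z. wn q1 0 L1 z + wn q2 0 L2 z \<in> {0, 1}" using D w by fastforce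
    then show ?thesis by blast
  next
    case 2
    have "wn q2 0 L2 z - wn q1 0 L1 z \<in> {0, 1}" if "z \<in> Z" for z using 2 D[OF that] w[OF that] by auto
    then show ?thesis by blast
  next
    case 3
    have "wn q1 0 L1 z - wn q2 0 L2 z \<in> {0, 1}" if "z \<in> Z" for z using 3 D[OF that] w[OF that] by auto
    then show ?thesis by blast
  qed
qed

lemma wn_flip_all:
  assumes "is_loop L q" "z \<notin> q ` {0..L}"
  shows "wn (flip1 0 L q) 0 L z = - wn q 0 L z"
proof -
  have "wn (flip1 0 L q) 0 L z = wn (\<lambda>s. q (0 + L - s)) 0 L z"
    using assms by (intro wn_cong) (auto simp: flip1_def is_loop_def)
  then show ?thesis using assms wn_rev[of 0 L q z] by (auto simp: is_loop_def)
qed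

lemma flips_all: "is_loop L q \<Longrightarrow> flips L q (flip1 0 L q)"
  by (intro flips_one) (auto simp: is_loop_def)

lemma flips_flip_all:
  assumes "flips L q q'" "is_loop L q"
  shows "flips L (flip1 0 L q) q'"
proof -
  have "flips L (flip1 0 L q) (flip1 0 L (flip1 0 L q))"
    by (intro flips_all flip1_loop) (use assms in \<open>auto simp: is_loop_def\<close>)
  then show ?thesis using flips_trans[OF assms(1)] by (simp add: flip1_invol)
qed

text \<open>The outer flips are done first and deliver the inserted loop as \<open>q1\<close> or
  reversed. As reversal is itself a flip, \<open>q1'\<close> can be reached from either.\<close>

lemma glue_flips:
  assumes l: "is_loop L1 q1" "is_loop L2 q2" "0 \<le> x" "x \<le> L2" "q2 x = q1 0"
    and f: "flips L1 q1 q1'" "flips L2 q2 q2'"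
  shows "\<exists>q. flips (L2 + L1) (insert_loop q2 q1 L1 x) q \<and>
     (\<forall>z. z \<notin> q1 ` {0..L1} \<longrightarrow> z \<notin> q2 ` {0..L2} \<longrightarrow> wn q 0 (L2 + L1) z = wn q2' 0 L2 z + wn q1' 0 L1 z)"
proof -
  obtain x' q1'' where x': "0 \<le> x'" "x' \<le> L2" "q1'' \<in> {q1, flip1 0 L1 q1}" "q2' x' = q1 0"
    and F: "flips (L2 + L1) (insert_loop q2 q1 L1 x) (insert_loop q2' q1'' L1 x')"
    using insert_flip_outer[OF f(2) l(1,3,4,5)] by blast
  have l'': "is_loop L1 q1''" "q1'' 0 = q1 0" "flips L1 q1'' q1'"
    using x'(3) l(1) flip1_loop[of 0 L1 L1 q1] flips_flip_all[OF f(1) l(1)] f(1) by (auto simp: is_loop_def flip1_def)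
  have "flips (L2 + L1) (insert_loop q2' q1'' L1 x') (insert_loop q2' q1' L1 x') \<and> q1' 0 = q2' x'"
    using insert_flip_inner[OF l''(3,1) x'(1,2)] x' l'' by simp
  then have "flips (L2 + L1) (insert_loop q2 q1 L1 x) (insert_loop q2' q1' L1 x')" "q1' 0 = q2' x'"
    using flips_trans F by blast+
  moreover have "wn (insert_loop q2' q1' L1 x') 0 (L2 + L1) z = wn q2' 0 L2 z + wn q1' 0 L1 z"
    if "z \<notin> q1 ` {0..L1}" "z \<notin> q2 ` {0..L2}" for z
    using flips_loop[OF f(1) l(1)] flips_loop[OF f(2) l(2)] that calculation x'
    by (intro wn_insert_loop) auto
  ultimately show ?thesis by blast
qed

section \<open>Cutting loops along chords\<close>

definition cut_out :: "real \<Rightarrow> real \<Rightarrow> (real \<Rightarrow> complex) \<Rightarrow> real \<Rightarrow> complex" where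
  "cut_out a b q = (\<lambda>s. if s \<le> a then q s else q (s + (b - a)))"

lemma cut_insert: "a \<le> b \<Longrightarrow> q = insert_loop (cut_out a b q) (\<lambda>s. q (s + a)) (b - a) a"
  by (auto simp: insert_loop_def cut_out_def fun_eq_iff)

context
  fixes L a b :: real and q :: "real \<Rightarrow> complex"
  assumes q: "is_loop L q" "1-lipschitz_on {0..L} q" and ab: "0 \<le> a" "a \<le> b" "b \<le> L" "q a = q b"
begin

lemma chord_le_arc: "0 \<le> s \<Longrightarrow> s \<le> t \<Longrightarrow> t \<le> L \<Longrightarrow> norm (q t - q s) \<le> t - s"
  using lipschitz_onD[OF q(2), of s t] by (auto simp: dist_norm norm_minus_commute)

lemma inner_lipschitz: "1-lipschitz_on {0..b - a} (\<lambda>s. q (s + a))"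
proof (rule lipschitz_onI)
  fix x y assume "x \<in> {0..b - a}" "y \<in> {0..b - a}"
  then show "dist (q (x + a)) (q (y + a)) \<le> 1 * dist x y"
    using ab lipschitz_onD[OF q(2), of "x + a" "y + a"] by (auto simp: dist_norm)
qed simp

lemma inner_loop: "is_loop (b - a) (\<lambda>s. q (s + a))"
  using lipschitz_on_continuous_on[OF inner_lipschitz] ab by (auto simp: is_loop_def)

lemma outer_dist:
  assumes "0 \<le> s" "s \<le> t" "t \<le> L - (b - a)"
  shows "dist (cut_out a b q s) (cut_out a b q t) \<le> t - s"
proof -
  consider "t \<le> a" | "s \<le> a" "a < t" | "a < s" by linarith
  then show ?thesis
  proof cases
    case 2
    have "dist (q s) (q a) \<le> a - s" "dist (q b) (q (t + (b - a))) \<le> t - a"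
      using 2 assms ab chord_le_arc[of s a] chord_le_arc[of b "t + (b - a)"] by (auto simp: dist_norm norm_minus_commute)
    then show ?thesis
      using 2 ab dist_triangle[of "q s" "q (t + (b - a))" "q a"] by (simp add: cut_out_def)
  qed (use assms ab chord_le_arc[of s t] chord_le_arc[of "s + (b - a)" "t + (b - a)"] in \<open>auto simp: cut_out_def dist_norm norm_minus_commute\<close>)
qed

lemma outer_lipschitz: "1-lipschitz_on {0..L - (b - a)} (cut_out a b q)"
proof (rule lipschitz_onI)
  fix s t assume "s \<in> {0..L - (b - a)}" "t \<in> {0..L - (b - a)}"
  then show "dist (cut_out a b q s) (cut_out a b q t) \<le> 1 * dist s t"
    using outer_dist[of s t] outer_dist[of t s] by (cases "s \<le> t") (auto simp: dist_commute dist_real_def)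
qed simp

lemma outer_loop: "is_loop (L - (b - a)) (cut_out a b q)"
proof -
  have "cut_out a b q 0 = cut_out a b q (L - (b - a))"
    using ab q(1) by (cases "b = L") (auto simp: cut_out_def is_loop_def)
  then show ?thesis using lipschitz_on_continuous_on[OF outer_lipschitz] ab by (auto simp: is_loop_def)
qed

lemma inner_image: "(\<lambda>s. q (s + a)) ` {0..b - a} = q ` {a..b}"
proof -
  have "(\<lambda>s. s + a) ` {0..b - a} = {a..b}" using image_add_atLeastAtMost'[of a 0 "b - a"] by simp
  then show ?thesis by (metis image_image)
qed

lemma outer_image: "cut_out a b q ` {0..L - (b - a)} = q ` ({0..a} \<union> {b..L})"
proof (intro equalityI subsetI)
  fix y assume "y \<in> cut_out a b q ` {0..L - (b - a)}"
  then show "y \<in> q ` ({0..a} \<union> {b..L})" using ab by (auto simp: cut_out_def)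
next
  fix y assume "y \<in> q ` ({0..a} \<union> {b..L})"
  then obtain s where s: "y = q s" "s \<in> {0..a} \<or> s \<in> {b..L}" by auto
  show "y \<in> cut_out a b q ` {0..L - (b - a)}"
  proof (cases "s \<le> a")
    case True
    then show ?thesis using s ab by (intro image_eqI[of _ _ s]) (auto simp: cut_out_def)
  next
    case False
    then show ?thesis using s ab
      by (cases "s = b"; intro image_eqI[of _ _ "s - (b - a)"]) (auto simp: cut_out_def)
  qed
qed

lemma wn_cut:
  assumes "z \<notin> q ` {0..L}"
  shows "wn q 0 L z = wn (cut_out a b q) 0 (L - (b - a)) z + wn (\<lambda>s. q (s + a)) 0 (b - a) z"
proof -
  have "wn (insert_loop (cut_out a b q) (\<lambda>s. q (s + a)) (b - a) a) 0 (L - (b - a) + (b - a)) z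
    = wn (cut_out a b q) 0 (L - (b - a)) z + wn (\<lambda>s. q (s + a)) 0 (b - a) z"
    by (rule wn_insert_loop[OF inner_loop outer_loop])
       (use ab assms in \<open>auto simp: cut_out_def outer_image inner_image\<close>)
  then show ?thesis using cut_insert[OF ab(2), of q] by simp
qed

lemma inner_unlinked: "unlinked L q \<Longrightarrow> unlinked (b - a) (\<lambda>s. q (s + a))"
  by (rule unlinked_mono[where f = "\<lambda>s. s + a"]) (use ab in auto)

lemma outer_unlinked: "unlinked L q \<Longrightarrow> unlinked (L - (b - a)) (cut_out a b q)"
  by (rule unlinked_mono[where f = "\<lambda>s. if s \<le> a then s else s + (b - a)"]) (use ab in \<open>auto simp: cut_out_def\<close>)

end

text \<open>A continuous image of an interval under a map with connected fibres is again an interval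
  up to homeomorphism, hence simply connected. Inside this image \<open>f\<close> is homotopic to
  any arc with the same ends.\<close>

lemma monotone_path_arc:
  fixes f :: "real \<Rightarrow> complex"
  assumes "continuous_on {0..1} f" "\<And>y. connected ({0..1} \<inter> f -` {y})" "f 1 \<noteq> f 0"
  obtains g where "arc g" "path_image g \<subseteq> f ` {0..1}" "pathstart g = f 0" "pathfinish g = f 1"
    "\<And>z. z \<notin> f ` {0..1} \<Longrightarrow> winding_number f z = winding_number g z"
proof -
  have f: "path f" "path_image f = f ` {0..1}" "pathstart f = f 0" "pathfinish f = f 1"
    using assms(1) by (auto simp: path_def path_image_def pathstart_def pathfinish_def)
  obtain g where g: "arc g" "path_image g \<subseteq> path_image f" "pathstart g = f 0" "pathfinish g = f 1"
    using path_contains_arc[OF f(1,3,4)] assms(3) by metis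
  have "f ` {0..1} homeomorphic {0..1::real}" by (rule homeomorphic_monotone_image_interval[OF assms])
  then have "simply_connected (f ` {0..1})"
    using homeomorphic_simply_connected_eq convex_imp_simply_connected[OF convex_real_interval(5)[of 0 1]] by blast
  then have "homotopic_paths (f ` {0..1}) f g"
    unfolding simply_connected_eq_homotopic_paths using f g by (auto simp: arc_imp_path)
  then have "winding_number f z = winding_number g z" if "z \<notin> f ` {0..1}" for z
    using winding_number_homotopic_paths[OF homotopic_paths_subset[of "f ` {0..1}" f g "- {z}"]] that by blast
  then show ?thesis using that[OF g(1) _ g(3,4)] g(2) f(2) by simp
qed

text \<open>If all chords but the trivial one are short, collapsing the maximal chords yields a path with
  connected fibres, hence up to homotopy a Jordan curve.\<close>

lemma collapse_short_chords:
  fixes q :: "real \<Rightarrow> complex"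
  assumes \<delta>: "0 < \<delta>" "2 * \<delta> \<le> M" and q: "is_loop M q" "1-lipschitz_on {0..M} q" "unlinked M q"
    and short: "\<And>s t. 0 \<le> s \<Longrightarrow> s < t \<Longrightarrow> t \<le> M \<Longrightarrow> q s = q t \<Longrightarrow> t - s < \<delta> \<or> (s = 0 \<and> t = M)"
    and Z: "\<And>z s. z \<in> Z \<Longrightarrow> s \<in> {0..M} \<Longrightarrow> \<delta> < norm (q s - z)"
  shows "(\<forall>z\<in>Z. wn q 0 M z \<in> {0, 1}) \<or> (\<forall>z\<in>Z. wn q 0 M z \<in> {0, - 1})"
proof -
  have M: "0 < M" "\<delta> < M" using \<delta> by auto
  have qc: "continuous_on {0..M} q" and q0M: "q 0 = q M" using q by (auto simp: is_loop_def)
  have lip: "norm (q t - q s) \<le> t - s" if "0 \<le> s" "s \<le> t" "t \<le> M" for s t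
    using lipschitz_onD[OF q(2), of s t] that by (auto simp: dist_norm norm_minus_commute)
  \<comment> \<open>The base point is passed only once: an interior passage would be closer than
    \<open>\<delta>\<close> to both ends, against \<open>2 * \<delta> \<le> M\<close>.\<close>
  have base: "s = 0 \<or> s = M" if "q s = q 0" "0 \<le> s" "s \<le> M" for s
  proof (rule ccontr)
    assume "\<not> ?thesis"
    then have "s - 0 < \<delta>" "M - s < \<delta>" using short[of 0 s] short[of s M] that q0M by auto
    then show False using \<delta> by auto
  qed
  \<comment> \<open>The short chords around \<open>t\<close>, degenerate ones included. The closed
    bound makes the set compact, so that a longest chord exists; \<open>lohi_short\<close> regains
    the strict bound.\<close>
  define Ch where "Ch = (\<lambda>t. {(s, u). 0 \<le> s \<and> s \<le> t \<and> t \<le> u \<and> u \<le> M \<and> q s = q u \<and> u - s \<le> \<delta>})"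
  have ChI: "(s, u) \<in> Ch t \<longleftrightarrow> 0 \<le> s \<and> s \<le> t \<and> t \<le> u \<and> u \<le> M \<and> q s = q u \<and> u - s \<le> \<delta>" for s u t
    by (simp add: Ch_def)
  have "\<exists>s u. (s, u) \<in> Ch t \<and> (\<forall>s' u'. (s', u') \<in> Ch t \<longrightarrow> u' - s' \<le> u - s)" if t: "t \<in> {0..M}" for t
  proof -
    have "continuous_on ({0..t} \<times> {t..M}) (\<lambda>x. q (fst x) - q (snd x))"
      by (intro continuous_intros continuous_on_compose2[OF qc]) (use t in auto)
    then have "closed {x \<in> {0..t} \<times> {t..M}. q (fst x) - q (snd x) = 0}"
      by (intro continuous_closed_preimage_constant) (auto intro: closed_Times)
    moreover have "closed {x::real \<times> real. snd x - fst x \<le> \<delta>}" by (intro closed_Collect_le continuous_intros)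
    ultimately have "closed ({x \<in> {0..t} \<times> {t..M}. q (fst x) - q (snd x) = 0} \<inter> {x. snd x - fst x \<le> \<delta>})" by auto
    also have "\<dots> = Ch t" by (auto simp: Ch_def)
    finally have "closed (Ch t)" .
    moreover have "bounded (Ch t)"
      by (rule bounded_subset[of "{0..t} \<times> {t..M}"]) (auto intro: bounded_Times simp: Ch_def)
    ultimately have "compact (Ch t)" by (simp add: compact_eq_bounded_closed)
    moreover have "(t, t) \<in> Ch t" using t \<delta> by (simp add: ChI)
    then have "Ch t \<noteq> {}" by blast
    moreover have "continuous_on (Ch t) (\<lambda>x. snd x - fst x)" by (intro continuous_intros)
    ultimately obtain x where "x \<in> Ch t" "\<forall>y\<in>Ch t. snd y - fst y \<le> snd x - fst x"
      using continuous_attains_sup by blast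
    then have "(fst x, snd x) \<in> Ch t" "\<And>s' u'. (s', u') \<in> Ch t \<Longrightarrow> u' - s' \<le> snd x - fst x" by force+
    then show ?thesis by blast
  qed
  then obtain lo hi where lh: "\<And>t. t \<in> {0..M} \<Longrightarrow> (lo t, hi t) \<in> Ch t"
    and mx: "\<And>t s u. t \<in> {0..M} \<Longrightarrow> (s, u) \<in> Ch t \<Longrightarrow> u - s \<le> hi t - lo t" by metis
  have lohi: "0 \<le> lo t" "lo t \<le> t" "t \<le> hi t" "hi t \<le> M" "q (lo t) = q (hi t)" "hi t - lo t \<le> \<delta>" if "t \<in> {0..M}" for t
    using lh[OF that] by (auto simp: ChI)
  have uM: "s = M" if "(s, M) \<in> Ch t" for s t
    using that base[of s] q0M M by (auto simp: ChI)
  have hM: "lo t = M" if "hi t = M" "t \<in> {0..M}" for t using lh[OF that(2)] uM that(1) by metis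
  \<comment> \<open>A short chord around \<open>t\<close> that is not contained in the longest one
    would be linked with it. As \<open>unlinked\<close> stops before \<open>M\<close>, chords ending
    in \<open>M\<close> are excluded first, by \<open>uM\<close> and \<open>hM\<close>.\<close>
  have absorb: "lo t \<le> s \<and> u \<le> hi t" if t: "t \<in> {0..M}" and su: "(s, u) \<in> Ch t" for s t u
  proof (rule ccontr)
    assume n: "\<not> ?thesis"
    note l = lohi[OF t] mx[OF t su] su[unfolded ChI]
    show False
    proof (cases "s < lo t")
      case True
      then have "u < hi t" using l by linarith
      moreover have "hi t \<noteq> M" using hM[OF _ t] calculation l by fastforce
      ultimately show False using unlinkedD[OF q(3), of s "lo t" u "hi t"] True l by auto
    next
      case False
      then have "hi t < u" using n by auto
      then have "lo t < s" using False l by linarith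
      moreover have "u \<noteq> M" using uM[of s t] su \<open>hi t < u\<close> l by fastforce
      ultimately show False using unlinkedD[OF q(3), of "lo t" s "hi t" u] \<open>hi t < u\<close> l by auto
    qed
  qed
  have eq_or_disj: "(lo t = lo t' \<and> hi t = hi t') \<or> hi t < lo t'" if t: "t \<in> {0..M}" "t' \<in> {0..M}" "t < t'" for t t'
  proof (rule ccontr)
    assume n: "\<not> ?thesis"
    note l = lohi[OF t(1)] and l' = lohi[OF t(2)]
    show False
    proof (cases "lo t' \<le> t")
      case True
      have 1: "lo t \<le> lo t' \<and> hi t' \<le> hi t" by (rule absorb[OF t(1)]) (use True l' t in \<open>auto simp: ChI\<close>)
      have "lo t' \<le> lo t \<and> hi t \<le> hi t'" by (rule absorb[OF t(2)]) (use 1 l l' t in \<open>auto simp: ChI\<close>)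
      with 1 n show False by auto
    next
      case False
      have "\<not> t' \<le> hi t"
      proof
        assume "t' \<le> hi t"
        then have "lo t' \<le> lo t \<and> hi t \<le> hi t'" by (intro absorb[OF t(2)]) (use l l' t in \<open>auto simp: ChI\<close>)
        then show False using False l by auto
      qed
      moreover have "hi t' \<noteq> M" using hM[OF _ t(2)] n calculation l' l by force
      ultimately show False
        using unlinkedD[OF q(3), of "lo t" "lo t'" "hi t" "hi t'"] False l l' n t by auto
    qed
  qed
  \<comment> \<open>The collapsed curve is constant on maximal chords. It is still 1-Lipschitz,
    because between two disjoint maximal chords only the gap counts.\<close>
  define c where "c = (\<lambda>t. q (lo t))"
  have clip: "norm (c t' - c t) \<le> t' - t" if t: "t \<in> {0..M}" "t' \<in> {0..M}" "t \<le> t'" for t t'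
  proof (cases "t = t'")
    case False
    then consider "lo t = lo t'" | "hi t < lo t'" using eq_or_disj[of t t'] t by force
    then show ?thesis
    proof cases
      case 2
      then have "norm (q (lo t') - q (hi t)) \<le> lo t' - hi t" using lohi[OF t(1)] lohi[OF t(2)] by (intro lip) auto
      then show ?thesis using lohi[OF t(1)] lohi[OF t(2)] by (auto simp: c_def)
    qed (use t in \<open>auto simp: c_def\<close>)
  qed auto
  have "1-lipschitz_on {0..M} c"
  proof (rule lipschitz_onI)
    fix s t assume "s \<in> {0..M}" "t \<in> {0..M}"
    then show "dist (c s) (c t) \<le> 1 * dist s t"
      using clip[of s t] clip[of t s] by (cases "s \<le> t") (auto simp: dist_norm norm_minus_commute)
  qed simp
  then have cc: "continuous_on {0..M} c" by (rule lipschitz_on_continuous_on)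
  have lohi_short: "hi t - lo t < \<delta>" if "t \<in> {0..M}" for t
    using short[of "lo t" "hi t"] lohi[OF that] M \<delta> by (cases "lo t = hi t") auto
  \<comment> \<open>Apart from the two ends, a common value in two different maximal chords would
    make a short chord joining them, which \<open>absorb\<close> forbids.\<close>
  have fib: "(t = 0 \<and> t' = M) \<or> (lo t = lo t' \<and> hi t = hi t')"
    if t: "t \<in> {0..M}" "t' \<in> {0..M}" "t < t'" and e: "c t = c t'" for t t'
  proof (rule ccontr)
    assume n: "\<not> ?thesis"
    note l = lohi[OF t(1)] and l' = lohi[OF t(2)]
    have h: "hi t < lo t'" using eq_or_disj[OF t] n by auto
    show False
    proof (cases "lo t = 0 \<and> lo t' = M")
      case True
      then have "q (hi t) = q 0" using l by simp
      then have "hi t = 0" using base[of "hi t"] l h l' by auto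
      then show False using n True l l' t by auto
    next
      case False
      then have "lo t' - lo t < \<delta>" using short[of "lo t" "lo t'"] l l' h e by (auto simp: c_def)
      then have "lo t' \<le> hi t" using absorb[OF t(1), of "lo t" "lo t'"] l l' h e by (auto simp: ChI c_def)
      then show False using h by simp
    qed
  qed
  have conv: "c r = c t" if "t \<in> {0..M}" "t' \<in> {0..M}" "t \<le> r" "r \<le> t'" "lo t = lo t'" "hi t = hi t'" for t t' r
  proof (cases "t = r")
    case False
    then have "(lo t = lo r \<and> hi t = hi r) \<or> hi t < lo r" using that by (intro eq_or_disj) auto
    then show ?thesis using lohi[of r] lohi[of t'] that by (auto simp: c_def)
  qed auto
  have c0: "c 0 = q 0" using lohi[of 0] M by (auto simp: c_def)
  have cM: "c M = q 0" using lohi[of M] hM[of M] M q0M by (auto simp: c_def)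
  \<comment> \<open>On the whole interval the fibre over the base point consists of the two ends and
    is not connected, hence the halving. A half has length at least \<open>\<delta>\<close>, more
    than any collapsed chord, so its ends keep distinct images.\<close>
  have half: "continuous_on {0..1} (\<lambda>x. c (a + (b - a) * x))"
    "connected ({0..1} \<inter> (\<lambda>x. c (a + (b - a) * x)) -` {y})"
    "c (a + (b - a) * 1) \<noteq> c (a + (b - a) * 0)" "(\<lambda>x. c (a + (b - a) * x)) ` {0..1} = c ` {a..b}"
    if ab: "0 \<le> a" "b \<le> M" "b - a = M / 2" for a b y
  proof -
    have le: "a \<le> b" using ab M by auto
    have cab: "continuous_on {a..b} c" by (rule continuous_on_subset[OF cc]) (use ab in auto)
    show "continuous_on {0..1} (\<lambda>x. c (a + (b - a) * x))"
      using path_affine(1)[OF cab le] by (simp add: path_def)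
    show "(\<lambda>x. c (a + (b - a) * x)) ` {0..1} = c ` {a..b}"
      using path_affine(2)[OF cab le] by (simp add: path_image_def)
    have ne: "\<not> (s = 0 \<and> t = M)" if "s \<in> {a..b}" "t \<in> {a..b}" for s t using that ab M by auto
    show "connected ({0..1} \<inter> (\<lambda>x. c (a + (b - a) * x)) -` {y})"
    proof (rule is_interval_connected, unfold is_interval_1, intro ballI allI impI)
      fix x x' r assume x: "x \<in> {0..1} \<inter> (\<lambda>x. c (a + (b - a) * x)) -` {y}"
        "x' \<in> {0..1} \<inter> (\<lambda>x. c (a + (b - a) * x)) -` {y}" and r: "x \<le> r \<and> r \<le> x'"
      let ?h = "\<lambda>x. a + (b - a) * x"
      have mono: "?h x \<le> ?h r" "?h r \<le> ?h x'" using r le by (auto intro!: mult_left_mono)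
      have m: "?h x \<in> {a..b}" "?h x' \<in> {a..b}" using affine_image_Icc[OF le] x by blast+
      have e: "c (?h x) = c (?h x')" using x by simp
      have "c w = c u" if "u \<in> {a..b}" "u' \<in> {a..b}" "u \<le> w" "w \<le> u'" "c u = c u'" for u u' w
      proof (cases "u = u'")
        case False
        have u: "u \<in> {0..M}" "u' \<in> {0..M}" "u < u'" using that ab(1,2) False by auto
        from fib[OF u that(5)] ne[OF that(1,2)] have "lo u = lo u'" "hi u = hi u'" by blast+
        then show ?thesis by (intro conv[OF u(1,2) that(3,4)])
      next
        case True
        then have "w = u" using that(3,4) by linarith
        then show ?thesis by simp
      qed
      from this[OF m mono e] have "c (?h r) = c (?h x)" .
      then show "r \<in> {0..1} \<inter> (\<lambda>x. c (a + (b - a) * x)) -` {y}" using x r by auto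
    qed
    have "c b \<noteq> c a"
    proof
      assume "c b = c a"
      moreover have "a \<in> {0..M}" "b \<in> {0..M}" "a < b" using ab M by auto
      ultimately have "lo a = lo b \<and> hi a = hi b" using fib[of a b] ne[of a b] le by auto
      then have "b - a < \<delta>" using lohi_short[of a] lohi[of a] lohi[of b] ab le by auto
      then show False using ab \<delta> by auto
    qed
    then show "c (a + (b - a) * 1) \<noteq> c (a + (b - a) * 0)" by simp
  qed
  define m where "m = M / 2"
  have m: "0 \<le> m" "m \<le> M" "m - 0 = M / 2" "M - m = M / 2" using M by (auto simp: m_def)
  have half_arc: "\<exists>g. arc g \<and> path_image g \<subseteq> c ` {a..b} \<and> pathstart g = c a \<and> pathfinish g = c b \<and>
      (\<forall>z. z \<notin> c ` {a..b} \<longrightarrow> wn c a b z = winding_number g z)"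
    if ab: "0 \<le> a" "b \<le> M" "b - a = M / 2" for a b
  proof -
    obtain g where g: "arc g" "path_image g \<subseteq> c ` {a..b}" "pathstart g = c (a + (b - a) * 0)"
      "pathfinish g = c (a + (b - a) * 1)"
      "\<And>z. z \<notin> c ` {a..b} \<Longrightarrow> winding_number (\<lambda>x. c (a + (b - a) * x)) z = winding_number g z"
      using monotone_path_arc[OF half(1,2,3)[OF ab]] unfolding half(4)[OF ab] by metis
    then show ?thesis unfolding wn_def by (intro exI[of _ g]) simp
  qed
  obtain g1 where g1: "arc g1" "path_image g1 \<subseteq> c ` {0..m}" "pathstart g1 = c 0" "pathfinish g1 = c m"
    "\<And>z. z \<notin> c ` {0..m} \<Longrightarrow> wn c 0 m z = winding_number g1 z"
    using half_arc[OF order_refl m(2,3)] by blast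
  obtain g2 where g2: "arc g2" "path_image g2 \<subseteq> c ` {m..M}" "pathstart g2 = c m" "pathfinish g2 = c M"
    "\<And>z. z \<notin> c ` {m..M} \<Longrightarrow> wn c m M z = winding_number g2 z"
    using half_arc[OF m(1) order_refl m(4)] by blast
  have inter: "c ` {0..m} \<inter> c ` {m..M} \<subseteq> {c 0, c m}"
  proof
    fix y assume "y \<in> c ` {0..m} \<inter> c ` {m..M}"
    then obtain t t' where t: "t \<in> {0..m}" "t' \<in> {m..M}" "y = c t" "y = c t'" by auto
    show "y \<in> {c 0, c m}"
    proof (cases "t = t'")
      case False
      then have "(t = 0 \<and> t' = M) \<or> (lo t = lo t' \<and> hi t = hi t')" using t m by (intro fib) auto
      then show ?thesis
      proof
        assume "lo t = lo t' \<and> hi t = hi t'"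
        then have "c m = c t" using t m(1,2) by (intro conv[of t t' m]) auto
        then show ?thesis using t by simp
      qed (use t in simp)
    qed (use t in auto)
  qed
  have sp: "simple_path (g1 +++ g2)"
    by (rule simple_path_join_loop[OF g1(1) g2(1)]) (use g1(2) g2(2) inter in \<open>auto simp: g1(3,4) g2(3,4) c0 cM\<close>)
  have wnc: "wn q 0 M z = winding_number (g1 +++ g2) z \<and> z \<notin> path_image (g1 +++ g2)" if z: "z \<in> Z" for z
  proof -
    \<comment> \<open>Collapsing moves points by at most \<open>\<delta>\<close>, which is less than
      their distance to \<open>z\<close>.\<close>
    have near: "norm (c t - q t) < norm (q t - z)" if "t \<in> {0..M}" for t
    proof -
      have "norm (c t - q t) \<le> t - lo t" using lip[of "lo t" t] lohi[OF that] that by (auto simp: c_def norm_minus_commute)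
      then show ?thesis using lohi[OF that] Z[OF z that] by linarith
    qed
    have zc: "z \<notin> c ` {0..M}"
    proof
      assume "z \<in> c ` {0..M}"
      then obtain t where "t \<in> {0..M}" "z = c t" by auto
      then show False using near[of t] by (simp add: norm_minus_commute)
    qed
    have "wn c 0 M z = wn q 0 M z" by (rule wn_nearby[OF cc qc]) (use M near c0 cM q0M in auto)
    moreover have "wn c 0 M z = wn c 0 m z + wn c m M z" using wn_combine[OF cc _ _ zc, of m] m by simp
    moreover have sub: "c ` {0..m} \<subseteq> c ` {0..M}" "c ` {m..M} \<subseteq> c ` {0..M}" using m(1,2) by (auto intro!: image_mono)
    then have zm: "z \<notin> c ` {0..m}" "z \<notin> c ` {m..M}" using zc by blast+
    then have "wn c 0 m z = winding_number g1 z" "wn c m M z = winding_number g2 z"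
      using g1(5) g2(5) by blast+
    moreover have zp: "z \<notin> path_image g1" "z \<notin> path_image g2" using g1(2) g2(2) zm by blast+
    moreover have "winding_number (g1 +++ g2) z = winding_number g1 z + winding_number g2 z"
      by (rule winding_number_join) (use zp in \<open>simp_all add: g1(1,4) g2(1,3) arc_imp_path\<close>)
    moreover have "z \<notin> path_image (g1 +++ g2)" using zp by (simp add: path_image_join g1(4) g2(3))
    ultimately show ?thesis by simp
  qed
  have out: "winding_number (g1 +++ g2) z = 0" if "z \<in> outside (path_image (g1 +++ g2))" for z
    by (rule winding_number_zero_in_outside[OF simple_path_imp_path[OF sp] _ that])
       (simp add: g1(3) g2(4) c0 cM)
  have inout: "z \<in> inside (path_image (g1 +++ g2)) \<or> z \<in> outside (path_image (g1 +++ g2))" if "z \<in> Z" for z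
    using inside_Un_outside[of "path_image (g1 +++ g2)"] wnc[OF that] by blast
  show ?thesis
  proof (rule simple_closed_path_winding_number_inside[OF sp])
    assume *: "\<And>z. z \<in> inside (path_image (g1 +++ g2)) \<Longrightarrow> winding_number (g1 +++ g2) z = 1"
    have "wn q 0 M z \<in> {0, 1}" if "z \<in> Z" for z
      using inout[OF that] *[of z] out[of z] wnc[OF that] by fastforce
    then show ?thesis by blast
  next
    assume *: "\<And>z. z \<in> inside (path_image (g1 +++ g2)) \<Longrightarrow> winding_number (g1 +++ g2) z = - 1"
    have "wn q 0 M z \<in> {0, - 1}" if "z \<in> Z" for z
      using inout[OF that] *[of z] out[of z] wnc[OF that] by fastforce
    then show ?thesis by blast
  qed
qed

text \<open>Here a chord may be short on either side. The shortest chord \<open>(a, b)\<close> among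
  those of length at least \<open>L - \<delta>\<close> bounds an inner loop to which
  \<open>collapse_short_chords\<close> applies, while the outer loop has length at most
  \<open>\<delta>\<close> and lies in a ball that misses \<open>z\<close>. A loop shorter than
  \<open>3 * \<delta>\<close> lies in such a ball altogether; in the other case \<open>b - a\<close>
  is at least \<open>2 * \<delta>\<close>.\<close>

lemma wn_only_short_chords:
  fixes q :: "real \<Rightarrow> complex"
  assumes \<delta>: "0 < \<delta>" and q: "is_loop L q" "1-lipschitz_on {0..L} q" "unlinked L q"
    and short: "\<And>s t. 0 \<le> s \<Longrightarrow> s < t \<Longrightarrow> t < L \<Longrightarrow> q s = q t \<Longrightarrow> t - s < \<delta> \<or> L - (t - s) < \<delta>"
    and Z: "\<And>z s. z \<in> Z \<Longrightarrow> s \<in> {0..L} \<Longrightarrow> 4 * \<delta> \<le> norm (q s - z)"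
  shows "(\<forall>z\<in>Z. wn q 0 L z \<in> {0, 1}) \<or> (\<forall>z\<in>Z. wn q 0 L z \<in> {0, - 1})"
proof (cases "L < 3 * \<delta>")
  case True
  have L: "0 \<le> L" "continuous_on {0..L} q" "q 0 = q L" using q by (auto simp: is_loop_def)
  have "wn q 0 L z = 0" if "z \<in> Z" for z
  proof (rule wn_convex[OF L(2,1,3), of "cball (q 0) (3 * \<delta>)"])
    show "q ` {0..L} \<subseteq> cball (q 0) (3 * \<delta>)"
    proof
      fix y assume "y \<in> q ` {0..L}"
      then obtain s where s: "y = q s" "s \<in> {0..L}" by auto
      then have "dist (q 0) (q s) \<le> s" using chord_le_arc[OF q(1,2), of 0 0 0 s] lipschitz_onD[OF q(2), of 0 s] L by auto
      then show "y \<in> cball (q 0) (3 * \<delta>)" using s True by auto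
    qed
    show "z \<notin> cball (q 0) (3 * \<delta>)" using Z[OF that, of 0] L \<delta> by (auto simp: dist_norm)
  qed auto
  then show ?thesis by auto
next
  case False
  have L: "0 \<le> L" "continuous_on {0..L} q" "q 0 = q L" using q by (auto simp: is_loop_def)
  \<comment> \<open>The long chords as a compact set, nonempty because the trivial chord belongs to
    it.\<close>
  define K where "K = {x \<in> {0..L} \<times> {0..L}. q (fst x) - q (snd x) = 0} \<inter> {x. L - \<delta> \<le> snd x - fst x}"
  have "continuous_on ({0..L} \<times> {0..L}) (\<lambda>x. q (fst x) - q (snd x))"
    by (intro continuous_intros continuous_on_compose2[OF L(2)]) auto
  then have "closed {x \<in> {0..L} \<times> {0..L}. q (fst x) - q (snd x) = 0}"
    by (intro continuous_closed_preimage_constant) (auto intro: closed_Times)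
  moreover have "closed {x::real \<times> real. L - \<delta> \<le> snd x - fst x}" by (intro closed_Collect_le continuous_intros)
  ultimately have "closed K" unfolding K_def by auto
  moreover have "bounded K"
    by (rule bounded_subset[of "{0..L} \<times> {0..L}"]) (auto intro: bounded_Times simp: K_def)
  ultimately have "compact K" by (simp add: compact_eq_bounded_closed)
  moreover have "(0, L) \<in> K" using L \<delta> by (simp add: K_def)
  then have "K \<noteq> {}" by blast
  moreover have "continuous_on K (\<lambda>x. snd x - fst x)" by (intro continuous_intros)
  ultimately obtain x where x: "x \<in> K" "\<forall>y\<in>K. snd x - fst x \<le> snd y - fst y"
    using continuous_attains_inf by blast
  define a b where "a = fst x" and "b = snd x"
  have ab: "0 \<le> a" "b \<le> L" "q a = q b" "L - \<delta> \<le> b - a" using x(1) by (auto simp: K_def a_def b_def)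
  have le: "a \<le> b" using ab False \<delta> by auto
  have mn: "b - a \<le> t - s" if "0 \<le> s" "t \<le> L" "s \<le> t" "q s = q t" "L - \<delta> \<le> t - s" for s t
    using x(2)[rule_format, of "(s, t)"] that by (auto simp: K_def a_def b_def)
  let ?p = "\<lambda>s. q (s + a)" and ?r = "cut_out a b q"
  note H = q(1,2) ab(1) le ab(2,3)
  have short': "t - s < \<delta> \<or> L - (t - s) < \<delta>" if st: "0 \<le> s" "s < t" "t \<le> L" "q s = q t" for s t
  proof (cases "t = L")
    case True
    then show ?thesis using short[of 0 s] st L \<delta> by (cases "s = 0") auto
  qed (use short st in auto)
  have *: "(\<forall>z\<in>Z. wn ?p 0 (b - a) z \<in> {0, 1}) \<or> (\<forall>z\<in>Z. wn ?p 0 (b - a) z \<in> {0, - 1})"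
  proof (rule collapse_short_chords[OF \<delta> _ inner_loop[OF H] inner_lipschitz[OF H] inner_unlinked[OF H q(3)]])
    show "2 * \<delta> \<le> b - a" using ab False by auto
    fix s t assume st: "0 \<le> s" "s < t" "t \<le> b - a" "q (s + a) = q (t + a)"
    show "t - s < \<delta> \<or> s = 0 \<and> t = b - a"
    proof (cases "t - s < \<delta>")
      case False
      then have "L - (t - s) < \<delta>" using short'[of "s + a" "t + a"] st ab by auto
      then have "b - a \<le> t - s" using mn[of "s + a" "t + a"] st ab by auto
      then show ?thesis using st by auto
    qed simp
  next
    fix z s assume "z \<in> Z" "s \<in> {0..b - a}"
    then show "\<delta> < norm (q (s + a) - z)" using Z[of z "s + a"] ab \<delta> by auto
  qed
  have "wn q 0 L z = wn ?p 0 (b - a) z" if z: "z \<in> Z" for z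
  proof -
    have zn: "z \<notin> q ` {0..L}" using Z[OF z] \<delta> by force
    note ol = outer_loop[OF H, unfolded is_loop_def]
    have "wn ?r 0 (L - (b - a)) z = 0"
    proof (rule wn_convex[of _ _ _ "cball (q a) \<delta>"])
      show "?r ` {0..L - (b - a)} \<subseteq> cball (q a) \<delta>"
      proof
        fix y assume "y \<in> ?r ` {0..L - (b - a)}"
        then obtain s where s: "y = q s" "s \<in> {0..a} \<or> s \<in> {b..L}" unfolding outer_image[OF H] by auto
        then show "y \<in> cball (q a) \<delta>"
        proof (cases "s \<in> {0..a}")
          case True
          then show ?thesis using s chord_le_arc[OF H, of s a] ab le by (auto simp: dist_norm)
        next
          case False
          then show ?thesis using s chord_le_arc[OF H, of b s] ab le by (auto simp: dist_norm norm_minus_commute)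
        qed
      qed
      show "z \<notin> cball (q a) \<delta>" using Z[OF z, of a] ab le \<delta> by (auto simp: dist_norm)
    qed (use ol in auto)
    then show ?thesis using wn_cut[OF H zn] by simp
  qed
  then show ?thesis using * by auto
qed

text \<open>A common value of the two arcs other than \<open>q a\<close> would give a chord linked
  with \<open>(a, b)\<close>. As there are no triple points, removing \<open>q a\<close> from a
  piece removes only the ends of its parameter interval, so what is left is connected.\<close>

lemma cut_touching:
  fixes q :: "real \<Rightarrow> complex"
  assumes q: "is_loop L q" "unlinked L q" and ab: "0 \<le> a" "a < b" "b < L" "q a = q b"
  defines "C1 \<equiv> q ` {a..b}" and "C2 \<equiv> q ` ({0..a} \<union> {b..L})"
  shows "C1 \<inter> C2 \<subseteq> {q a}" "C1 - {q a} \<noteq> {}" "C2 - {q a} \<noteq> {}" "connected (C1 - {q a})" "connected (C2 - {q a})"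
proof -
  have L: "continuous_on {0..L} q" "q 0 = q L" using q by (auto simp: is_loop_def)
  have p: "s = a \<or> s = b" if "q s = q a" "0 \<le> s" "s < L" for s
  proof (rule ccontr)
    assume "\<not> ?thesis"
    then consider "s < a" | "a < s" "s < b" | "b < s" by linarith
    then show False
    proof cases
      case 1
      then show False using unlinked_triple[OF q(2) that(2) _ ab(2,3)] that(1) ab(4) by blast
    next
      case 2
      then show False using unlinked_triple[OF q(2) ab(1) _ _ ab(3)] that(1) ab(4) by metis
    next
      case 3
      then show False using unlinked_triple[OF q(2) ab(1,2) _ that(3)] that(1) ab(4) by metis
    qed
  qed
  have C1: "C1 - {q a} = q ` {a<..<b}"
  proof (intro equalityI subsetI)
    fix y assume "y \<in> C1 - {q a}"
    then obtain s where "s \<in> {a..b}" "y = q s" "q s \<noteq> q a" by (auto simp: C1_def)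
    then show "y \<in> q ` {a<..<b}" using ab by (cases "s = a"; cases "s = b") auto
  next
    fix y assume "y \<in> q ` {a<..<b}"
    then obtain s where "s \<in> {a<..<b}" "y = q s" by auto
    then show "y \<in> C1 - {q a}" using p[of s] ab by (auto simp: C1_def)
  qed
  have disj: "q s \<noteq> q t" if s: "a < s" "s < b" and t: "0 \<le> t" "t < a \<or> b < t" "t < L" for s t
    using t(2)
  proof
    assume "t < a"
    then show ?thesis using unlinkedD[OF q(2), of t a s b] s t ab by fastforce
  next
    assume "b < t"
    then show ?thesis using unlinkedD[OF q(2), of a s b t] s t ab by fastforce
  qed
  show "C1 \<inter> C2 \<subseteq> {q a}"
  proof
    fix y assume y: "y \<in> C1 \<inter> C2"
    show "y \<in> {q a}"
    proof (rule ccontr)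
      assume n: "y \<notin> {q a}"
      then have "y \<in> q ` {a<..<b}" using C1 y by blast
      then obtain s where s: "a < s" "s < b" "y = q s" by auto
      obtain t where t: "t \<in> {0..a} \<or> t \<in> {b..L}" "y = q t" using y unfolding C2_def by blast
      \<comment> \<open>The parameter \<open>L\<close> is replaced by \<open>0\<close>, because
        \<open>unlinked\<close> speaks only of parameters below \<open>L\<close>.\<close>
      define t' where "t' = (if t = L then 0 else t)"
      have t': "q t' = y" "0 \<le> t'" "t' < L" "t' \<le> a \<or> b \<le> t'" using t L ab by (auto simp: t'_def)
      then have "t' \<noteq> a" "t' \<noteq> b" using n ab(4) by auto
      then have "t' < a \<or> b < t'" using t'(4) by linarith
      then show False using disj[OF s(1,2) t'(2) _ t'(3)] t'(1) s(3) by simp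
    qed
  qed
  show "C1 - {q a} \<noteq> {}" using C1 ab by auto
  show "connected (C1 - {q a})" unfolding C1
    by (intro connected_continuous_image continuous_on_subset[OF L(1)]) (use ab in auto)
  \<comment> \<open>If \<open>a = 0\<close>, the base point itself is removed and one open interval
    remains. Otherwise the two remaining intervals are joined through
    \<open>q 0 = q L\<close>.\<close>
  have C2: "C2 - {q a} = (if a = 0 then q ` {b<..<L} else q ` {0..<a} \<union> q ` {b<..L})"
  proof (intro equalityI subsetI)
    fix y assume "y \<in> C2 - {q a}"
    then obtain s where s: "s \<in> {0..a} \<or> s \<in> {b..L}" "y = q s" "q s \<noteq> q a" unfolding C2_def by blast
    then have "s \<noteq> a" "s \<noteq> b" "a = 0 \<longrightarrow> s \<noteq> L" using ab L by auto
    then show "y \<in> (if a = 0 then q ` {b<..<L} else q ` {0..<a} \<union> q ` {b<..L})" using s by auto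
  next
    fix y assume y: "y \<in> (if a = 0 then q ` {b<..<L} else q ` {0..<a} \<union> q ` {b<..L})"
    show "y \<in> C2 - {q a}"
    proof (cases "a = 0")
      case True
      then obtain s where "s \<in> {b<..<L}" "y = q s" using y by auto
      then show ?thesis using p[of s] ab by (auto simp: C2_def)
    next
      case False
      then have "y \<in> q ` ({0..<a} \<union> {b<..L})" using y by auto
      then obtain s where s: "s \<in> {0..<a} \<or> s \<in> {b<..L}" "y = q s" by blast
      have "q s \<noteq> q a" using p[of s] p[of 0] s False ab L by (cases "s = L") auto
      then show ?thesis using s by (auto simp: C2_def)
    qed
  qed
  have c: "connected (q ` I)" if "connected I" "I \<subseteq> {0..L}" for I
    by (intro connected_continuous_image continuous_on_subset[OF L(1)] that)
  show "C2 - {q a} \<noteq> {}" using C2 ab by auto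
  show "connected (C2 - {q a})"
  proof (cases "a = 0")
    case True
    have "{b<..<L} \<subseteq> {0..L}" using ab by force
    from c[OF connected_Ioo this] show ?thesis unfolding C2 using True by simp
  next
    case False
    have I: "{0..<a} \<subseteq> {0..L}" "{b<..L} \<subseteq> {0..L}" using ab by force+
    have "q 0 \<in> q ` {0..<a}" "q L \<in> q ` {b<..L}" using False ab by auto
    then have "q 0 \<in> q ` {0..<a} \<inter> q ` {b<..L}" using L by simp
    then have "connected (q ` {0..<a} \<union> q ` {b<..L})"
      by (intro connected_Un c connected_Ico connected_Ioc I) auto
    then show ?thesis unfolding C2 using False by simp
  qed
qed

text \<open>Induction on a number \<open>n\<close> with \<open>L \<le> n * \<delta>\<close>: a chord
  with both sides at least \<open>\<delta>\<close> cuts the loop into two that are each shorter by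
  at least \<open>\<delta>\<close>, and \<open>Z\<close> keeps its distance since their images are
  parts of the old one. If there is no such chord, all winding numbers have one sign and at most one
  reversal is needed.\<close>

lemma flips_wn:
  fixes q :: "real \<Rightarrow> complex"
  assumes \<delta>: "0 < \<delta>" and q: "is_loop L q" "1-lipschitz_on {0..L} q" "unlinked L q"
    and Z: "\<And>z s. z \<in> Z \<Longrightarrow> s \<in> {0..L} \<Longrightarrow> 4 * \<delta> \<le> norm (q s - z)"
  shows "\<exists>q'. flips L q q' \<and> (\<forall>z\<in>Z. wn q' 0 L z \<in> {0, 1})"
proof -
  have main: "\<exists>q'. flips L q q' \<and> (\<forall>z\<in>Z. wn q' 0 L z \<in> {0, 1})"
    if "L \<le> real n * \<delta>" "is_loop L q" "1-lipschitz_on {0..L} q" "unlinked L q"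
      "\<And>z s. z \<in> Z \<Longrightarrow> s \<in> {0..L} \<Longrightarrow> 4 * \<delta> \<le> norm (q s - z)" for n L q
    using that
  proof (induction n arbitrary: L q)
    case 0
    have "wn q 0 L z = 0" if "z \<in> Z" for z
    proof -
      have L0: "L = 0" using "0.prems"(1,2) by (simp add: is_loop_def)
      then have "4 * \<delta> \<le> norm (q 0 - z)" by (intro "0.prems"(5)[OF that]) simp
      then have "q 0 \<noteq> z" using \<delta> by auto
      then show ?thesis unfolding L0 by (rule wn_same)
    qed
    then show ?case using flips.refl by blast
  next
    case (Suc n)
    note q = Suc.prems(2-4) and Z = Suc.prems(5)
    have zn: "z \<notin> q ` {0..L}" if "z \<in> Z" for z 
    proof
      assume "z \<in> q ` {0..L}"
      then obtain s where "s \<in> {0..L}" "z = q s" by blast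
      then show False using Z[OF that] \<delta> by fastforce
    qed
    show ?case
    proof (cases "\<forall>s t. 0 \<le> s \<longrightarrow> s < t \<longrightarrow> t < L \<longrightarrow> q s = q t \<longrightarrow> t - s < \<delta> \<or> L - (t - s) < \<delta>")
      case True
      then have "(\<forall>z\<in>Z. wn q 0 L z \<in> {0, 1}) \<or> (\<forall>z\<in>Z. wn q 0 L z \<in> {0, - 1})"
        by (intro wn_only_short_chords[OF \<delta> q _ Z]) auto
      then show ?thesis
      proof
        assume "\<forall>z\<in>Z. wn q 0 L z \<in> {0, 1}"
        then show ?thesis using flips.refl by blast
      next
        assume "\<forall>z\<in>Z. wn q 0 L z \<in> {0, - 1}"
        then have "\<forall>z\<in>Z. wn (flip1 0 L q) 0 L z \<in> {0, 1}" using wn_flip_all[OF q(1) zn] by force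
        then show ?thesis using flips_all[OF q(1)] by blast
      qed
    next
      case False
      then obtain a b where ab: "0 \<le> a" "a < b" "b < L" "q a = q b" "\<delta> \<le> b - a" "\<delta> \<le> L - (b - a)" by fastforce
      have le: "a \<le> b" "b \<le> L" using ab by auto
      note H = q(1,2) ab(1) le ab(4)
      define q1 q2 L1 L2 where d: "q1 = (\<lambda>s. q (s + a))" "q2 = cut_out a b q" "L1 = b - a" "L2 = L - (b - a)"
      have L: "L2 + L1 = L" by (simp add: d)
      note T = cut_touching[OF q(1,3) ab(1-4)]
      have im: "q1 ` {0..L1} = q ` {a..b}" "q2 ` {0..L2} = q ` ({0..a} \<union> {b..L})"
        unfolding d inner_image[OF H] outer_image[OF H] by auto
      have sub: "q1 ` {0..L1} \<subseteq> q ` {0..L}" "q2 ` {0..L2} \<subseteq> q ` {0..L}" unfolding im using ab by auto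
      have l: "is_loop L1 q1" "is_loop L2 q2" unfolding d using inner_loop[OF H] outer_loop[OF H] by auto
      have "\<exists>q'. flips L1 q1 q' \<and> (\<forall>z\<in>Z. wn q' 0 L1 z \<in> {0, 1})"
      proof (rule Suc.IH)
        show "L1 \<le> n * \<delta>" using Suc.prems(1) ab by (simp add: d algebra_simps)
        show "is_loop L1 q1" "1-lipschitz_on {0..L1} q1" "unlinked L1 q1"
          unfolding d using inner_loop[OF H] inner_lipschitz[OF H] inner_unlinked[OF H q(3)] by auto
        show "4 * \<delta> \<le> cmod (q1 s - z)" if "z \<in> Z" "s \<in> {0..L1}" for z s
          using Z[OF that(1), of "s + a"] that ab by (auto simp: d)
      qed
      then obtain q1' where q1': "flips L1 q1 q1'" "\<And>z. z \<in> Z \<Longrightarrow> wn q1' 0 L1 z \<in> {0, 1}" by blast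
      have "\<exists>q'. flips L2 q2 q' \<and> (\<forall>z\<in>Z. wn q' 0 L2 z \<in> {0, 1})"
      proof (rule Suc.IH)
        show "L2 \<le> n * \<delta>" using Suc.prems(1) ab by (simp add: d algebra_simps)
        show "is_loop L2 q2" "1-lipschitz_on {0..L2} q2" "unlinked L2 q2"
          unfolding d using outer_loop[OF H] outer_lipschitz[OF H] outer_unlinked[OF H q(3)] by auto
        show "4 * \<delta> \<le> cmod (q2 s - z)" if z: "z \<in> Z" and s: "s \<in> {0..L2}" for z s
        proof -
          have "q2 s \<in> q ` {0..L}" using sub(2) s by blast
          then show ?thesis using Z[OF z] by auto
        qed
      qed
      then obtain q2' where q2': "flips L2 q2 q2'" "\<And>z. z \<in> Z \<Longrightarrow> wn q2' 0 L2 z \<in> {0, 1}" by blast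
      have l1': "is_loop L1 q1'" "q1' ` {0..L1} = q1 ` {0..L1}" using flips_loop[OF q1'(1) l(1)] by auto
      have l2': "is_loop L2 q2'" "q2' ` {0..L2} = q2 ` {0..L2}" using flips_loop[OF q2'(1) l(2)] by auto
      have z1: "z \<notin> q1 ` {0..L1}" and z2: "z \<notin> q2 ` {0..L2}" if "z \<in> Z" for z using zn[OF that] sub by auto
      have x: "0 \<le> a" "a \<le> L2" "q2 a = q1 0" using ab(1,3) by (simp_all add: d cut_out_def)
      have ins: "q = insert_loop q2 q1 L1 a" unfolding d by (fact cut_insert[OF le(1)])
      have G: "\<exists>q'. flips L q q' \<and> (\<forall>z\<in>Z. wn q' 0 L z = wn r2 0 L2 z + wn r1 0 L1 z)"
        if r: "flips L1 q1 r1" "flips L2 q2 r2" for r1 r2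
        
      proof -
        obtain q' where "flips L q q'" "\<And>z. z \<notin> q1 ` {0..L1} \<Longrightarrow> z \<notin> q2 ` {0..L2} \<Longrightarrow> wn q' 0 L z = wn r2 0 L2 z + wn r1 0 L1 z"
          using glue_flips[OF l x r] unfolding L ins[symmetric] by blast
        then show ?thesis using z1 z2 by blast
      qed
      \<comment> \<open>Reversing one of the two loops changes the sign of its contribution, so each
        of the three combinations offered by \<open>touching_loops_wn\<close> is realised by
        flips.\<close>
      have neg: "wn (flip1 0 L1 q1') 0 L1 z = - wn q1' 0 L1 z" "wn (flip1 0 L2 q2') 0 L2 z = - wn q2' 0 L2 z" if "z \<in> Z" for z
        using wn_flip_all[OF l1'(1), of z] wn_flip_all[OF l2'(1), of z] z1[OF that] z2[OF that] l1'(2) l2'(2) by auto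
      have F: "flips L1 q1 (flip1 0 L1 q1')" "flips L2 q2 (flip1 0 L2 q2')"
        using flips_trans[OF flips_all[OF l1'(1)] q1'(1)] flips_trans[OF flips_all[OF l2'(1)] q2'(1)] .
      have "(\<forall>z\<in>Z. wn q1' 0 L1 z + wn q2' 0 L2 z \<in> {0, 1}) \<or> (\<forall>z\<in>Z. wn q2' 0 L2 z - wn q1' 0 L1 z \<in> {0, 1})
        \<or> (\<forall>z\<in>Z. wn q1' 0 L1 z - wn q2' 0 L2 z \<in> {0, 1})"
      proof (rule touching_loops_wn[OF l1'(1) l2'(1), of "q a"])
        show "q a \<in> q1' ` {0..L1}" "q a \<in> q2' ` {0..L2}" unfolding l1' l2' im using ab by auto
        show "Z \<inter> (q1' ` {0..L1} \<union> q2' ` {0..L2}) = {}" unfolding l1' l2' using z1 z2 by auto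
      qed (use T q1' q2' in \<open>simp_all add: l1' l2' im\<close>)
      then show ?thesis
      proof (elim disjE)
        assume *: "\<forall>z\<in>Z. wn q1' 0 L1 z + wn q2' 0 L2 z \<in> {0, 1}"
        then show ?thesis using G[OF q1'(1) q2'(1)] by (fastforce simp: add.commute)
      next
        assume *: "\<forall>z\<in>Z. wn q2' 0 L2 z - wn q1' 0 L1 z \<in> {0, 1}"
        then show ?thesis using G[OF F(1) q2'(1)] neg(1) by (fastforce simp: add.commute)
      next
        assume *: "\<forall>z\<in>Z. wn q1' 0 L1 z - wn q2' 0 L2 z \<in> {0, 1}"
        then show ?thesis using G[OF q1'(1) F(2)] neg(2) by (fastforce simp: add.commute)
      qed
    qed
  qed
  obtain n :: nat where "L / \<delta> \<le> n" using real_arch_simple[of "L / \<delta>"] ..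
  then have "L \<le> real n * \<delta>" by (simp only: pos_divide_le_eq[OF \<delta>])
  then show ?thesis using main q Z by blast
qed

section \<open>Weak derivatives on the circle\<close>

lemma set_integrable_lborel_iff:
  fixes f :: "real \<Rightarrow> 'b::euclidean_space"
  assumes [measurable]: "f \<in> borel_measurable borel"
  shows "set_integrable lborel {a..b} f \<longleftrightarrow> f absolutely_integrable_on {a..b}"
  unfolding set_integrable_def by (rule integrable_completion[symmetric]) simp

lemma bounded_imp_absolutely_integrable:
  fixes f :: "real \<Rightarrow> 'b::euclidean_space"
  assumes [measurable]: "f \<in> borel_measurable borel"
    and g: "g absolutely_integrable_on {a..b}" and le: "\<And>t. t \<in> {a..b} \<Longrightarrow> norm (f t) \<le> g t"
  shows "f absolutely_integrable_on {a..b}"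
  unfolding set_integrable_def
proof (rule Bochner_Integration.integrable_bound)
  show "integrable lebesgue (\<lambda>x. indicat_real {a..b} x *\<^sub>R g x)" using g by (simp add: set_integrable_def)
  show "(\<lambda>x. indicat_real {a..b} x *\<^sub>R f x) \<in> borel_measurable lebesgue"
    by (rule measurable_completion) measurable
  show "AE x in lebesgue. norm (indicat_real {a..b} x *\<^sub>R f x) \<le> norm (indicat_real {a..b} x *\<^sub>R g x)"
    using le by (intro AE_I2) (auto simp: indicator_def intro: order_trans[OF le])
qed

lemma L2_circleI:
  assumes [measurable]: "h \<in> borel_measurable borel" and "\<And>t. h (t + p) = h t"
    and "(\<lambda>t. (norm (h t))\<^sup>2) integrable_on {0..p}"
  shows "h \<in> L2_circle p"
proof -
  have "(\<lambda>t. (norm (h t))\<^sup>2) absolutely_integrable_on {0..p}"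
    using assms(3) by (rule nonnegative_absolutely_integrable_1) simp
  moreover have "(\<lambda>t. (norm (h t))\<^sup>2) \<in> borel_measurable borel" by measurable
  ultimately have "set_integrable lborel {0..p} (\<lambda>t. (norm (h t))\<^sup>2)" using set_integrable_lborel_iff by blast
  then show ?thesis using assms by (simp add: L2_circle_def)
qed

lemma L2_circleD:
  assumes "h \<in> L2_circle p"
  shows "h \<in> borel_measurable borel" "h (t + p) = h t" "(\<lambda>t. (norm (h t))\<^sup>2) absolutely_integrable_on {0..p}"
    "h absolutely_integrable_on {0..p}" "(LBINT t:{0..p}. (norm (h t))\<^sup>2) = integral {0..p} (\<lambda>t. (norm (h t))\<^sup>2)"
proof -
  show [measurable]: "h \<in> borel_measurable borel" using assms by (simp add: L2_circle_def)
  show "h (t + p) = h t" using assms by (simp add: L2_circle_def)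
  have s: "set_integrable lborel {0..p} (\<lambda>t. (norm (h t))\<^sup>2)" using assms by (simp add: L2_circle_def)
  have "(\<lambda>t. (norm (h t))\<^sup>2) \<in> borel_measurable borel" by measurable
  with s show *: "(\<lambda>t. (norm (h t))\<^sup>2) absolutely_integrable_on {0..p}" using set_integrable_lborel_iff by blast
  have "(\<lambda>t. 1 + (norm (h t))\<^sup>2) absolutely_integrable_on {0..p}"
    using * by (intro set_integral_add) auto
  moreover have "x \<le> 1 + x\<^sup>2" for x :: real
    using zero_le_power2[of "x - 1/2"] by (simp add: power2_eq_square algebra_simps)
  ultimately show "h absolutely_integrable_on {0..p}"
    by (intro bounded_imp_absolutely_integrable[where f = h and g = "\<lambda>t. 1 + (norm (h t))\<^sup>2"]) auto
  show "(LBINT t:{0..p}. (norm (h t))\<^sup>2) = integral {0..p} (\<lambda>t. (norm (h t))\<^sup>2)"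
    using set_borel_integral_eq_integral(2)[OF s] .
qed

lemma continuous_mult_absolutely_integrable:
  fixes h :: "real \<Rightarrow> complex" and \<phi> :: "real \<Rightarrow> real"
  assumes [measurable]: "h \<in> borel_measurable borel" and h: "h absolutely_integrable_on {a..b}" and \<phi>: "continuous_on UNIV \<phi>"
  shows "(\<lambda>t. \<phi> t *\<^sub>R h t) absolutely_integrable_on {a..b}"
proof -
  have [measurable]: "\<phi> \<in> borel_measurable borel" using \<phi> by (rule borel_measurable_continuous_onI)
  have "compact (\<phi> ` {a..b})" by (intro compact_continuous_image continuous_on_subset[OF \<phi>]) auto
  then obtain C where "\<forall>x\<in>\<phi> ` {a..b}. norm x \<le> C"
    unfolding compact_eq_bounded_closed bounded_iff by blast
  then have C: "\<bar>\<phi> t\<bar> \<le> C" if "t \<in> {a..b}" for t using that by auto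
  show ?thesis
  proof (rule bounded_imp_absolutely_integrable[where g = "\<lambda>t. C * norm (h t)"])
    show "(\<lambda>t. C * cmod (h t)) absolutely_integrable_on {a..b}"
      using absolutely_integrable_norm[OF h] by (intro set_integrable_mult_right) (simp add: o_def)
    show "norm (\<phi> t *\<^sub>R h t) \<le> C * cmod (h t)" if "t \<in> {a..b}" for t
      using C[OF that] by (auto intro!: mult_right_mono)
  qed measurable
qed

lemma continuous_mult_L2:
  fixes \<phi> :: "real \<Rightarrow> real"
  assumes h: "h \<in> L2_circle p" and \<phi>: "continuous_on UNIV \<phi>"
  shows "(\<lambda>t. \<phi> t *\<^sub>R h t) absolutely_integrable_on {0..p}"
    "(LBINT t:{0..p}. \<phi> t *\<^sub>R h t) = integral {0..p} (\<lambda>t. \<phi> t *\<^sub>R h t)"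
proof -
  note [measurable] = L2_circleD(1)[OF h]
  have [measurable]: "\<phi> \<in> borel_measurable borel" using \<phi> by (rule borel_measurable_continuous_onI)
  show *: "(\<lambda>t. \<phi> t *\<^sub>R h t) absolutely_integrable_on {0..p}"
    using continuous_mult_absolutely_integrable[OF L2_circleD(1)[OF h] L2_circleD(4)[OF h] \<phi>] .
  have "(\<lambda>t. \<phi> t *\<^sub>R h t) \<in> borel_measurable borel" by measurable
  with * show "(LBINT t:{0..p}. \<phi> t *\<^sub>R h t) = integral {0..p} (\<lambda>t. \<phi> t *\<^sub>R h t)"
    using set_borel_integral_eq_integral(2) set_integrable_lborel_iff by blast
qed

lemma continuous_L2_circle:
  assumes "continuous_on UNIV f" "\<And>t. f (t + p) = f t"
  shows "f \<in> L2_circle p"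
  by (intro L2_circleI borel_measurable_continuous_onI assms integrable_continuous_interval
      continuous_on_subset[of UNIV _ "{0..p}"] continuous_intros) auto

section \<open>Calculus of periodic test functions\<close>

lemma test_functionsD:
  assumes "\<phi> \<in> test_functions p"
  shows "\<phi> (t + p) = \<phi> t" "(\<phi> has_real_derivative deriv \<phi> t) (at t)" "deriv \<phi> \<in> test_functions p"
    "continuous_on UNIV \<phi>"
proof -
  have d: "(deriv ^^ n) \<phi> differentiable (at t)" for n t using assms by (auto simp: test_functions_def)
  show 1: "\<phi> (t + p) = \<phi> t" for t using assms by (auto simp: test_functions_def)
  show 2: "(\<phi> has_real_derivative deriv \<phi> t) (at t)" for t
    using d[of 0 t] DERIV_deriv_iff_real_differentiable by auto
  have "((\<lambda>t. \<phi> (t + p)) has_real_derivative deriv \<phi> (t + p)) (at t)" for t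
    using DERIV_shift[THEN iffD1, OF 2[of "t + p"]] .
  then have "deriv \<phi> (t + p) = deriv \<phi> t" for t
    using DERIV_unique[OF _ 2[of t]] by (simp add: 1)
  moreover have "(deriv ^^ n) (deriv \<phi>) differentiable (at t)" for n t
    using d[of "Suc n" t] by (simp add: funpow_swap1)
  ultimately show "deriv \<phi> \<in> test_functions p" by (auto simp: test_functions_def)
  show "continuous_on UNIV \<phi>"
    using 2 by (meson DERIV_isCont continuous_at_imp_continuous_on)
qed

lemma test_functionsI:
  assumes "\<And>t. \<phi> (t + p) = \<phi> t" "\<And>t. (\<phi> has_real_derivative \<psi> t) (at t)" "\<psi> \<in> test_functions p"
  shows "\<phi> \<in> test_functions p" "deriv \<phi> = \<psi>"
proof -
  show d: "deriv \<phi> = \<psi>" by (intro ext DERIV_imp_deriv assms(2))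
  have "(deriv ^^ n) \<phi> differentiable (at t)" for n t
  proof (cases n)
    case 0
    then show ?thesis unfolding real_differentiable_def using assms(2) by auto
  next
    case (Suc m)
    then show ?thesis using assms(3) d by (simp add: funpow_swap1 test_functions_def)
  qed
  then show "\<phi> \<in> test_functions p" using assms(1) by (auto simp: test_functions_def)
qed

lemma continuous_antiderivative:
  fixes f :: "real \<Rightarrow> 'a::euclidean_space"
  assumes "continuous_on UNIV f"
  obtains F where "\<And>t. (F has_vector_derivative f t) (at t)"
  using einterval_antiderivative[of "-\<infinity>" "\<infinity>" f] assms continuous_on_eq_continuous_at[of UNIV f] by auto

lemma periodic_antiderivative:
  fixes f :: "real \<Rightarrow> 'a::euclidean_space"
  assumes "0 < p" "continuous_on UNIV f" "\<And>t. f (t + p) = f t" "integral {0..p} f = 0"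
    and F: "\<And>t. (F has_vector_derivative f t) (at t)"
  shows "F (t + p) = F t"
proof -
  have "((\<lambda>t. F (t + p) - F t) has_derivative (\<lambda>h. 0)) (at t within UNIV)" for t
  proof -
    have "((\<lambda>t. F (t + p)) has_vector_derivative 1 *\<^sub>R f (t + p)) (at t)"
    proof -
      have "((\<lambda>t. t + p) has_vector_derivative 1) (at t)"
        by (auto intro!: derivative_eq_intros simp flip: has_real_derivative_iff_has_vector_derivative)
      from vector_diff_chain_at[OF this F[of "t + p"]] show ?thesis by (simp add: o_def)
    qed
    then have "((\<lambda>t. F (t + p) - F t) has_vector_derivative 1 *\<^sub>R f (t + p) - f t) (at t)"
      by (intro has_vector_derivative_diff F)
    then show ?thesis using assms(3) by (simp add: has_vector_derivative_def)
  qed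
  from has_derivative_zero_constant[OF convex_UNIV this]
  obtain c where c: "\<And>t. F (t + p) - F t = c" by auto
  have "(f has_integral F p - F 0) {0..p}"
    using assms(1) by (intro fundamental_theorem_of_calculus has_vector_derivative_at_within[OF F]) simp
  from integral_unique[OF this] have "F p - F 0 = 0" using assms(4) by simp
  then show ?thesis using c[of 0] c[of t] by simp
qed

lemma const_test_function: "(\<lambda>t. c) \<in> test_functions p"
proof -
  have "(deriv ^^ n) (\<lambda>t. c) = (\<lambda>t. if n = 0 then c else 0)" for n
    by (induction n) auto
  then show ?thesis by (auto simp: test_functions_def)
qed

lemma test_function_diff_const: "\<phi> \<in> test_functions p \<Longrightarrow> (\<lambda>t. \<phi> t - c) \<in> test_functions p \<and> deriv (\<lambda>t. \<phi> t - c) = deriv \<phi>"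
proof -
  assume \<phi>: "\<phi> \<in> test_functions p"
  have "((\<lambda>t. \<phi> t - c) has_real_derivative deriv \<phi> t) (at t)" for t
    using test_functionsD(2)[OF \<phi>, of t] by (auto intro!: derivative_eq_intros)
  from test_functionsI[OF _ this test_functionsD(3)[OF \<phi>]] show ?thesis
    using test_functionsD(1)[OF \<phi>] by simp
qed

text \<open>Mean zero is what makes the antiderivative periodic. The antiderivative is normalised to
  mean zero again, so that the step can be repeated.\<close>

lemma test_function_antiderivative:
  assumes "0 < p" "\<psi> \<in> test_functions p" "integral {0..p} \<psi> = 0"
  shows "\<exists>\<phi>\<in>test_functions p. deriv \<phi> = \<psi> \<and> integral {0..p} \<phi> = 0"
proof -
  obtain F where F: "\<And>t. (F has_vector_derivative \<psi> t) (at t)"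
    using continuous_antiderivative[OF test_functionsD(4)[OF assms(2)]] by blast
  have per: "F (t + p) = F t" for t
    by (rule periodic_antiderivative[OF assms(1) test_functionsD(4)[OF assms(2)] _ assms(3) F])
       (use test_functionsD(1)[OF assms(2)] in auto)
  have F': "F \<in> test_functions p" "deriv F = \<psi>"
  proof -
    have "(F has_real_derivative \<psi> t) (at t)" for t using F by (simp add: has_real_derivative_iff_has_vector_derivative)
    note T = test_functionsI[where \<phi> = F and \<psi> = \<psi> and p = p, OF per this assms(2)]
    show "F \<in> test_functions p" "deriv F = \<psi>" using T by auto
  qed
  define c where "c = integral {0..p} F / p"
  have i: "F integrable_on {0..p}"
    by (intro integrable_continuous_interval continuous_on_subset[OF test_functionsD(4)[OF F'(1)]]) auto
  have "integral {0..p} (\<lambda>t. F t - c) = integral {0..p} F - p * c"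
    using i assms(1) by (subst integral_diff) auto
  then have "integral {0..p} (\<lambda>t. F t - c) = 0" using assms(1) by (simp add: c_def)
  then show ?thesis using test_function_diff_const[OF F'(1), of c] F'(2) by (intro bexI[of _ "\<lambda>t. F t - c"]) auto
qed

section \<open>Trigonometric polynomials and their density\<close>

inductive_set trig_polys :: "real \<Rightarrow> (real \<Rightarrow> real) set" for p where
  const: "(\<lambda>t. c) \<in> trig_polys p"
| cos: "(\<lambda>t. cos (2 * pi * t / p)) \<in> trig_polys p"
| sin: "(\<lambda>t. sin (2 * pi * t / p)) \<in> trig_polys p"
| add: "f \<in> trig_polys p \<Longrightarrow> g \<in> trig_polys p \<Longrightarrow> (\<lambda>t. f t + g t) \<in> trig_polys p"
| mult: "f \<in> trig_polys p \<Longrightarrow> g \<in> trig_polys p \<Longrightarrow> (\<lambda>t. f t * g t) \<in> trig_polys p"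

lemma trig_polys_deriv:
  assumes "f \<in> trig_polys p" "0 < p"
  shows "\<exists>g\<in>trig_polys p. \<forall>t. (f has_real_derivative g t) (at t)"
  using assms(1)
proof induction
  case (const c)
  show ?case by (rule bexI[OF _ trig_polys.const[of 0]]) auto
next
  case cos
  show ?case
    by (rule bexI[OF _ trig_polys.mult[OF trig_polys.const[of "- (2 * pi / p)"] trig_polys.sin]])
       (use assms(2) in \<open>auto intro!: derivative_eq_intros\<close>)
next
  case sin
  show ?case
    by (rule bexI[OF _ trig_polys.mult[OF trig_polys.const[of "2 * pi / p"] trig_polys.cos]])
       (use assms(2) in \<open>auto intro!: derivative_eq_intros\<close>)
next
  case (add f g)
  then obtain f' g' where *: "f' \<in> trig_polys p" "g' \<in> trig_polys p"
    "\<And>t. (f has_real_derivative f' t) (at t)" "\<And>t. (g has_real_derivative g' t) (at t)" by blast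
  show ?case
    by (rule bexI[OF _ trig_polys.add[OF *(1,2)]]) (use *(3,4) in \<open>auto intro!: derivative_eq_intros\<close>)
next
  case (mult f g)
  then obtain f' g' where *: "f' \<in> trig_polys p" "g' \<in> trig_polys p"
    "\<And>t. (f has_real_derivative f' t) (at t)" "\<And>t. (g has_real_derivative g' t) (at t)" by blast
  have "(\<lambda>t. f' t * g t + g' t * f t) \<in> trig_polys p"
    by (intro trig_polys.add trig_polys.mult * mult.hyps)
  then show ?case by (rule bexI[rotated]) (use *(3,4) DERIV_mult in blast)
qed

lemma trig_polys_periodic: "f \<in> trig_polys p \<Longrightarrow> 0 < p \<Longrightarrow> f (t + p) = f t"
proof (induction rule: trig_polys.induct)
  case cos
  then have "2 * pi * (t + p) / p = 2 * pi * t / p + 2 * pi" by (simp add: field_simps)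
  then show ?case by simp
next
  case sin
  then have "2 * pi * (t + p) / p = 2 * pi * t / p + 2 * pi" by (simp add: field_simps)
  then show ?case by simp
qed auto

lemma trig_polys_test_functions:
  assumes "f \<in> trig_polys p" "0 < p"
  shows "f \<in> test_functions p"
proof -
  have "\<exists>g\<in>trig_polys p. (deriv ^^ n) f = g" for n
  proof (induction n)
    case (Suc n)
    then obtain g where g: "g \<in> trig_polys p" "(deriv ^^ n) f = g" by blast
    obtain g' where g': "g' \<in> trig_polys p" "\<forall>t. (g has_real_derivative g' t) (at t)"
      using trig_polys_deriv[OF g(1) assms(2)] by blast
    have "deriv g = g'" using g'(2) by (intro ext DERIV_imp_deriv) simp
    then show ?case using g g' by auto
  qed (use assms in auto)
  moreover have "g differentiable (at t)" if "g \<in> trig_polys p" for g t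
    using trig_polys_deriv[OF that assms(2)] unfolding real_differentiable_def by auto
  ultimately show ?thesis
    using trig_polys_periodic[OF assms] by (auto simp: test_functions_def)
qed

text \<open>A periodic continuous function factors through the unit circle, where Stone-Weierstrass
  approximates it by polynomials in the coordinates, that is, in sine and cosine.\<close>

lemma trig_polys_dense:
  fixes r :: "real \<Rightarrow> real"
  assumes "0 < p" "continuous_on UNIV r" "\<And>t. r (t + p) = r t" "0 < e"
  shows "\<exists>\<psi>\<in>trig_polys p. \<forall>t\<in>{0..p}. \<bar>r t - \<psi> t\<bar> < e"
proof -
  define E where "E = (\<lambda>t. cis (2 * pi * t / p))"
  have cE: "continuous_on S E" for S unfolding E_def cis_conv_exp using assms(1) by (intro continuous_intros) auto
  have surj: "\<exists>t\<in>{0..p}. z = E t" if "norm z = 1" for z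
  proof -
    have "cis (Arg2pi z) = z" using that Arg2pi_eq[of z] by (simp add: cis_conv_exp)
    moreover have "2 * pi * (p * Arg2pi z / (2 * pi)) / p = Arg2pi z" using assms(1) by simp
    moreover have "p * Arg2pi z / (2 * pi) \<in> {0..p}"
      using Arg2pi_ge_0[of z] Arg2pi_lt_2pi[of z] assms(1)
      by (auto simp: field_simps intro!: mult_left_mono)
    ultimately show ?thesis unfolding E_def by metis
  qed
  have same: "r s = r t" if st: "s \<in> {0..p}" "t \<in> {0..p}" "s \<le> t" "E s = E t" for s t
  proof -
    have "cos (2 * pi * s / p) = cos (2 * pi * t / p)" "sin (2 * pi * s / p) = sin (2 * pi * t / p)"
      using st(4) by (auto simp: E_def complex_eq_iff)
    then obtain n :: int where n: "2 * pi * s / p = 2 * pi * t / p + 2 * pi * n"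
      using sin_cos_eq_iff by metis
    have "2 * pi * s / p * p = (2 * pi * t / p + 2 * pi * n) * p" by (simp only: n)
    then have "2 * pi * s = 2 * pi * (t + n * p)" using assms(1) by (simp add: algebra_simps)
    then have sn: "s = t + n * p" by simp
    then have "n * p \<le> 0" "- p \<le> n * p" using st by auto
    then have "real_of_int n \<le> 0" "- 1 \<le> real_of_int n" using assms(1)
      by (auto simp: mult_le_0_iff) (metis mult_le_cancel_right_pos mult_minus1)
    then have "n = 0 \<or> n = - 1" by linarith
    then show ?thesis using sn assms(3)[of s] by auto
  qed
  \<comment> \<open>Any parameter of \<open>z\<close> in the period may be chosen: by
    \<open>same\<close>, all of them give the same value of \<open>r\<close>.\<close>
  define R where "R = (\<lambda>z. r (SOME t. t \<in> {0..p} \<and> z = E t))"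
  have R: "R (E t) = r t" if "t \<in> {0..p}" for t
  proof -
    have "\<exists>s. s \<in> {0..p} \<and> E t = E s" using that by blast
    from someI_ex[OF this] have "(SOME s. s \<in> {0..p} \<and> E t = E s) \<in> {0..p}" "E t = E (SOME s. s \<in> {0..p} \<and> E t = E s)" by auto
    then show ?thesis unfolding R_def using same that by (metis linear)
  qed
  have sph: "sphere 0 1 = E ` {0..p}"
  proof
    show "sphere 0 1 \<subseteq> E ` {0..p}" using surj by (metis dist_0_norm image_iff mem_sphere subsetI)
  qed (auto simp: E_def)
  \<comment> \<open>The graph of \<open>R\<close> is a continuous image of the period interval,
    hence compact; a map into a compact set with closed graph is continuous.\<close>
  have "continuous_on (sphere 0 1) R"
  proof (rule continuous_from_closed_graph)
    show "compact (r ` {0..p})" by (intro compact_continuous_image continuous_on_subset[OF assms(2)]) auto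
    show "R \<in> sphere 0 1 \<rightarrow> r ` {0..p}" unfolding sph using R by auto
    have "(\<lambda>z. (z, R z)) ` sphere 0 1 = (\<lambda>t. (E t, r t)) ` {0..p}"
      unfolding sph image_image using R by auto
    moreover have "compact ((\<lambda>t. (E t, r t)) ` {0..p})"
      by (intro compact_continuous_image continuous_intros cE continuous_on_subset[OF assms(2)]) auto
    ultimately show "closed ((\<lambda>z. (z, R z)) ` sphere 0 1)" by (simp add: compact_imp_closed)
  qed
  then obtain g where g: "real_polynomial_function g" "\<And>z. z \<in> sphere 0 1 \<Longrightarrow> \<bar>R z - g z\<bar> < e"
    using Stone_Weierstrass_real_polynomial_function[of "sphere 0 (1::real)" R e] assms(4)
    by (metis Stone_Weierstrass_real_polynomial_function compact_sphere)
  have "(\<lambda>t. g (E t)) \<in> trig_polys p" using g(1)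
  proof induction
    case (linear f)
    have "f (E t) = cos (2 * pi * t / p) * f 1 + sin (2 * pi * t / p) * f \<i>" for t
    proof -
      have "E t = cos (2 * pi * t / p) *\<^sub>R 1 + sin (2 * pi * t / p) *\<^sub>R \<i>"
        by (rule complex_eqI) (simp_all add: E_def)
      moreover note l = bounded_linear.linear[OF linear]
      ultimately show ?thesis by (simp only: linear_add[OF l] linear_scale[OF l] real_scaleR_def)
    qed
    moreover have "(\<lambda>t. cos (2 * pi * t / p) * f 1 + sin (2 * pi * t / p) * f \<i>) \<in> trig_polys p"
      by (intro trig_polys.intros)
    ultimately show ?case by simp
  qed (auto intro: trig_polys.intros)
  moreover have "\<bar>r t - g (E t)\<bar> < e" if "t \<in> {0..p}" for t
    using g(2)[of "E t"] R[OF that] that unfolding sph by auto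
  ultimately show ?thesis by (intro bexI[of _ "\<lambda>t. g (E t)"]) auto
qed

text \<open>Every test function of mean zero is a second derivative, so \<open>u\<close> is
  orthogonal to all of these, and \<open>u\<close> minus its mean \<open>m\<close> is orthogonal to
  all test functions. Approximating a real coordinate \<open>r\<close> of this difference by
  trigonometric polynomials makes the integral of \<open>r\<close> squared arbitrarily
  small.\<close>

lemma du_bois_reymond:
  fixes u :: "real \<Rightarrow> complex"
  assumes "0 < p" and cu: "continuous_on UNIV u" and per: "\<And>t. u (t + p) = u t"
    and orth: "\<And>\<phi>. \<phi> \<in> test_functions p \<Longrightarrow> integral {0..p} (\<lambda>t. deriv (deriv \<phi>) t *\<^sub>R u t) = 0"
  shows "\<exists>c. \<forall>t\<in>{0..p}. u t = c"
proof -
  have ci: "f integrable_on {0..p}" if "continuous_on UNIV f" for f :: "real \<Rightarrow> 'x::banach"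
    by (intro integrable_continuous_interval continuous_on_subset[OF that]) auto
  have 1: "integral {0..p} (\<lambda>t. \<psi> t *\<^sub>R u t) = 0" if \<psi>: "\<psi> \<in> test_functions p" "integral {0..p} \<psi> = 0" for \<psi>
  proof -
    obtain f1 where f1: "f1 \<in> test_functions p" "deriv f1 = \<psi>" "integral {0..p} f1 = 0"
      using test_function_antiderivative[OF assms(1) \<psi>] by blast
    obtain f2 where "f2 \<in> test_functions p" "deriv f2 = f1"
      using test_function_antiderivative[OF assms(1) f1(1,3)] by blast
    then show ?thesis using orth[of f2] f1 by simp
  qed
  define m where "m = (1 / p) *\<^sub>R integral {0..p} u"
  have 2: "integral {0..p} (\<lambda>t. \<psi> t *\<^sub>R (u t - m)) = 0" if \<psi>: "\<psi> \<in> test_functions p" for \<psi>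
  proof -
    define c where "c = integral {0..p} \<psi> / p"
    note c\<psi> = test_functionsD(4)[OF \<psi>]
    have "integral {0..p} (\<lambda>t. \<psi> t - c) = 0"
      using assms(1) by (subst integral_diff) (auto simp: c_def intro!: ci c\<psi>)
    then have "integral {0..p} (\<lambda>t. (\<psi> t - c) *\<^sub>R u t) = 0"
      using 1 test_function_diff_const[OF \<psi>] by blast
    then have "integral {0..p} (\<lambda>t. \<psi> t *\<^sub>R u t) = c *\<^sub>R integral {0..p} u"
      by (simp add: scaleR_diff_left integral_diff ci cu c\<psi> continuous_intros)
    moreover have "integral {0..p} (\<lambda>t. \<psi> t *\<^sub>R (u t - m)) = integral {0..p} (\<lambda>t. \<psi> t *\<^sub>R u t) - integral {0..p} (\<lambda>t. \<psi> t *\<^sub>R m)"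
      by (simp add: scaleR_diff_right integral_diff ci cu c\<psi> continuous_intros)
    moreover have "integral {0..p} (\<lambda>t. \<psi> t *\<^sub>R m) = integral {0..p} \<psi> *\<^sub>R m"
      using has_integral_scaleR_left[OF integrable_integral[OF ci[OF c\<psi>]], of m] integral_unique by blast
    ultimately show ?thesis by (simp add: m_def c_def)
  qed
  have 3: "\<forall>t\<in>{0..p}. B (u t - m) = 0" if B: "bounded_linear B" for B :: "complex \<Rightarrow> real"
  proof -
    define r where "r = (\<lambda>t. B (u t - m))"
    have cr: "continuous_on UNIV r" unfolding r_def
      by (intro bounded_linear.continuous_on[OF B] continuous_intros cu)
    have rper: "r (t + p) = r t" for t by (simp add: r_def per)
    have orth': "integral {0..p} (\<lambda>t. \<psi> t * r t) = 0" if \<psi>: "\<psi> \<in> test_functions p" for \<psi>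
    proof -
      have "(\<lambda>t. \<psi> t *\<^sub>R (u t - m)) integrable_on {0..p}"
        by (intro ci continuous_intros cu test_functionsD(4)[OF \<psi>])
      from integral_linear[OF this B] have "integral {0..p} (\<lambda>t. B (\<psi> t *\<^sub>R (u t - m))) = 0"
        using 2[OF \<psi>] bounded_linear.linear[OF B] linear_0 by (auto simp: o_def)
      then show ?thesis by (simp add: r_def linear_scale[OF bounded_linear.linear[OF B]])
    qed
    let ?I = "integral {0..p} (\<lambda>t. r t * r t)" and ?J = "integral {0..p} (\<lambda>t. \<bar>r t\<bar>)"
    have "?I \<le> e * ?J" if "0 < e" for e
    proof -
      obtain \<psi> where \<psi>: "\<psi> \<in> trig_polys p" "\<And>t. t \<in> {0..p} \<Longrightarrow> \<bar>r t - \<psi> t\<bar> < e"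
        using trig_polys_dense[OF assms(1) cr rper \<open>0 < e\<close>] by blast
      note t\<psi> = trig_polys_test_functions[OF \<psi>(1) assms(1)]
      \<comment> \<open>The approximant \<open>\<psi>\<close> is orthogonal to \<open>r\<close>, so
        it can be subtracted for free.\<close>
      have "?I = integral {0..p} (\<lambda>t. (r t - \<psi> t) * r t)"
        using orth'[OF t\<psi>] by (simp add: left_diff_distrib integral_diff ci cr test_functionsD(4)[OF t\<psi>] continuous_intros)
      also have "\<dots> \<le> integral {0..p} (\<lambda>t. e * \<bar>r t\<bar>)"
      proof (rule integral_le)
        fix t assume t: "t \<in> {0..p}"
        have "(r t - \<psi> t) * r t \<le> \<bar>r t - \<psi> t\<bar> * \<bar>r t\<bar>" by (metis abs_ge_self abs_mult)
        also have "\<dots> \<le> e * \<bar>r t\<bar>" using \<psi>(2)[OF t] by (intro mult_right_mono) auto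
        finally show "(r t - \<psi> t) * r t \<le> e * \<bar>r t\<bar>" .
      qed (auto intro!: ci continuous_intros cr test_functionsD(4)[OF t\<psi>])
      finally show ?thesis by simp
    qed
    moreover have J: "0 \<le> ?J" by (rule integral_nonneg) (auto intro!: ci continuous_intros cr)
    ultimately have "?I \<le> 0"
    proof -
      have "?I \<le> e" if "0 < e" for e
      proof -
        have "?I \<le> e / (?J + 1) * ?J" using J that by (intro \<open>\<And>e. 0 < e \<Longrightarrow> ?I \<le> e * ?J\<close>) auto
        also have "\<dots> \<le> e" using J that by (simp add: field_simps)
        finally show ?thesis .
      qed
      then show ?thesis by (meson dense_ge)
    qed
    moreover have "0 \<le> ?I" by (rule integral_nonneg) (auto intro!: ci continuous_intros cr)
    ultimately have "((\<lambda>t. r t * r t) has_integral 0) (cbox 0 p)"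
      using integrable_integral[OF ci[of "\<lambda>t. r t * r t"]] cr by (auto intro!: continuous_intros)
    then have "r t * r t = 0" if "t \<in> {0..p}" for t
      using has_integral_0_cbox_imp_0[of 0 p "\<lambda>t. r t * r t" t] that assms(1)
      by (auto intro!: continuous_intros continuous_on_subset[OF cr])
    then show ?thesis by (auto simp: r_def)
  qed
  have "u t = m" if "t \<in> {0..p}" for t
    using 3[OF bounded_linear_Re] 3[OF bounded_linear_Im] that by (auto simp: complex_eq_iff)
  then show ?thesis by blast
qed

section \<open>Periodic extension from one period\<close>

definition per :: "real \<Rightarrow> (real \<Rightarrow> 'a) \<Rightarrow> real \<Rightarrow> 'a" where
  "per p g t = g (t - p * of_int \<lfloor>t / p\<rfloor>)"

lemma per_periodic: "0 < p \<Longrightarrow> per p g (t + p) = per p g t"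
proof -
  assume "0 < p"
  then have "(t + p) / p = t / p + 1" by (simp add: add_divide_distrib)
  then have "\<lfloor>(t + p) / p\<rfloor> = \<lfloor>t / p\<rfloor> + 1" by simp
  then show ?thesis unfolding per_def by (simp add: algebra_simps)
qed

lemma per_eq_Ico: "0 < p \<Longrightarrow> 0 \<le> t \<Longrightarrow> t < p \<Longrightarrow> per p g t = g t"
proof -
  assume "0 < p" "0 \<le> t" "t < p"
  then have "\<lfloor>t / p\<rfloor> = 0" by (simp add: floor_eq_iff)
  then show ?thesis by (simp add: per_def)
qed

lemma per_eq_ne: "0 < p \<Longrightarrow> 0 \<le> t \<Longrightarrow> t \<le> p \<Longrightarrow> t \<noteq> p \<Longrightarrow> per p g t = g t"
  using per_eq_Ico[of p t g] by simp

lemma per_eq: "0 < p \<Longrightarrow> g 0 = g p \<Longrightarrow> t \<in> {0..p} \<Longrightarrow> per p g t = g t"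
  using per_eq_Ico[of p t g] per_periodic[of p g 0] per_eq_Ico[of p 0 g] by (cases "t = p") auto

lemma periodic_int:
  fixes f :: "real \<Rightarrow> 'a" and p :: real
  assumes "\<And>t. f (t + p) = f t"
  shows "f (t + of_int k * p) = f t"
proof -
  have n: "f (t + of_nat n * p) = f t" for n t
  proof (induction n)
    case (Suc n)
    have "f (t + real (Suc n) * p) = f ((t + real n * p) + p)" by (simp add: algebra_simps)
    then show ?case using Suc assms by simp
  qed simp
  show ?thesis
  proof (cases "k \<ge> 0")
    case True
    then show ?thesis using n[of t "nat k"] by simp
  next
    case False
    then have "f ((t + of_int k * p) + real (nat (- k)) * p) = f (t + of_int k * p)" using n by blast
    then show ?thesis using False by (simp add: algebra_simps)
  qed
qed

lemma periodic_reduce: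
  fixes p t :: real
  assumes "0 < p"
  obtains k :: int and s where "t = s + of_int k * p" "0 \<le> s" "s < p"
proof (rule that[of "t - p * of_int \<lfloor>t / p\<rfloor>" "\<lfloor>t / p\<rfloor>"])
  have "of_int \<lfloor>t / p\<rfloor> \<le> t / p" "t / p < of_int \<lfloor>t / p\<rfloor> + 1" by linarith+
  then have "of_int \<lfloor>t / p\<rfloor> * p \<le> t" "t < (of_int \<lfloor>t / p\<rfloor> + 1) * p"
    using assms by (simp_all only: pos_le_divide_eq pos_divide_less_eq)
  then show "0 \<le> t - p * of_int \<lfloor>t / p\<rfloor>" "t - p * of_int \<lfloor>t / p\<rfloor> < p"
    by (simp_all add: algebra_simps)
qed simp

lemma per_measurable [measurable]:
  assumes [measurable]: "g \<in> borel_measurable borel"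
  shows "per p g \<in> borel_measurable borel"
  unfolding per_def by measurable

lemma per_continuous:
  fixes g :: "real \<Rightarrow> 'a::topological_space"
  assumes "0 < p" "continuous_on {0..p} g" "g 0 = g p"
  shows "continuous_on UNIV (per p g)"
proof -
  have per: "per p g (t + p) = per p g t" for t by (rule per_periodic[OF assms(1)])
  have c: "continuous_on {of_int k * p..of_int k * p + p} (per p g)" for k :: int
  proof (rule continuous_on_eq)
    show "continuous_on {of_int k * p..of_int k * p + p} (\<lambda>t. g (t - of_int k * p))"
      by (rule continuous_on_compose2[OF assms(2)]) (auto intro!: continuous_intros)
    fix t assume "t \<in> {of_int k * p..of_int k * p + p}"
    then have "g (t - of_int k * p) = per p g (t - of_int k * p)"
      by (intro per_eq[symmetric] assms) auto
    also have "\<dots> = per p g ((t - of_int k * p) + of_int k * p)" by (rule periodic_int[where f = "per p g", symmetric]) (rule per)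
    finally show "g (t - of_int k * p) = per p g t" by simp
  qed
  show ?thesis unfolding continuous_on_eq_continuous_at[OF open_UNIV]
  proof
    fix t
    obtain k s where t: "t = s + of_int k * p" "0 \<le> s" "s < p" using periodic_reduce[OF assms(1)] .
    \<comment> \<open>Two adjacent periods are glued, so that every point becomes interior, a
      multiple of \<open>p\<close> included.\<close>
    have "continuous_on ({of_int (k - 1) * p..of_int (k - 1) * p + p} \<union> {of_int k * p..of_int k * p + p}) (per p g)"
      by (intro continuous_on_closed_Un c) auto
    moreover have "{of_int (k - 1) * p..of_int (k - 1) * p + p} \<union> {of_int k * p..of_int k * p + p} = {of_int (k - 1) * p..of_int k * p + p}"
      using assms(1) ivl_disj_un_two_touch(4)[of "of_int (k - 1) * p" "of_int k * p" "of_int k * p + p"]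
      by (simp add: algebra_simps)
    ultimately have "continuous_on {of_int (k - 1) * p..of_int k * p + p} (per p g)" by simp
    then have "continuous_on {of_int (k - 1) * p<..<of_int k * p + p} (per p g)"
      by (rule continuous_on_subset) (simp add: greaterThanLessThan_subseteq_atLeastAtMost_iff)
    moreover have "t \<in> {of_int (k - 1) * p<..<of_int k * p + p}" using t assms(1) by (auto simp: algebra_simps)
    ultimately show "isCont (per p g) t"
      using continuous_on_eq_continuous_at[OF open_greaterThanLessThan] by blast
  qed
qed

lemma per_L2:
  assumes "0 < p" "h \<in> borel_measurable borel" "(\<lambda>t. (norm (h t))\<^sup>2) integrable_on {0..p}"
  shows "per p h \<in> L2_circle p"
proof (rule L2_circleI)
  show "per p h \<in> borel_measurable borel" by (rule per_measurable[OF assms(2)])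
  show "per p h (t + p) = per p h t" for t by (rule per_periodic[OF assms(1)])
  have "(\<lambda>t. (norm (per p h t))\<^sup>2) integrable_on {0..p} \<longleftrightarrow> (\<lambda>t. (norm (h t))\<^sup>2) integrable_on {0..p}"
    by (rule integrable_spike_finite_eq[of "{p}"]) (auto simp: per_eq_ne[OF assms(1)])
  then show "(\<lambda>t. (norm (per p h t))\<^sup>2) integrable_on {0..p}" using assms(3) by simp
qed

lemma per_has_integral:
  assumes "0 < p" "0 \<le> a" "b \<le> p" "(h has_integral I) {a..b}"
  shows "(per p h has_integral I) {a..b}"
  by (rule has_integral_spike_finite[OF _ _ assms(4), of "{p}"]) (use assms(2,3) in \<open>auto simp: per_eq_ne[OF assms(1)]\<close>)

text \<open>The continuity of \<open>V\<close> makes the increments of \<open>\<Psi>\<close> small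
  compared with \<open>t - s\<close>, so the derivative of \<open>\<Psi>\<close> vanishes at every
  point.\<close>

lemma superlinear_imp_constant:
  fixes \<Psi> :: "real \<Rightarrow> 'a::real_normed_vector"
  assumes V: "continuous_on {0..p} V" and le: "\<And>s t. 0 \<le> s \<Longrightarrow> s \<le> t \<Longrightarrow> t \<le> p \<Longrightarrow> norm (\<Psi> t - \<Psi> s) \<le> K * (t - s) * (V t - V s)"
    and "0 \<le> p"
  shows "\<Psi> p = \<Psi> 0"
proof -
  have "(\<Psi> has_derivative (\<lambda>h. 0)) (at t within {0..p})" if t: "t \<in> {0..p}" for t
  proof (rule has_derivativeI)
    have "((\<lambda>s. \<bar>K\<bar> * \<bar>V s - V t\<bar>) \<longlongrightarrow> \<bar>K\<bar> * \<bar>V t - V t\<bar>) (at t within {0..p})"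
      using V t by (intro tendsto_intros) (auto simp: continuous_on_def)
    then have lim: "((\<lambda>s. \<bar>K\<bar> * \<bar>V s - V t\<bar>) \<longlongrightarrow> 0) (at t within {0..p})" by simp
    show "((\<lambda>y. (\<Psi> y - \<Psi> t - 0) /\<^sub>R norm (y - t)) \<longlongrightarrow> 0) (at t within {0..p})"
    proof (rule Lim_null_comparison[OF _ lim])
      have "norm ((\<Psi> y - \<Psi> t - 0) /\<^sub>R norm (y - t)) \<le> \<bar>K\<bar> * \<bar>V y - V t\<bar>" if y: "y \<in> {0..p}" "y \<noteq> t" for y
      proof -
        have "norm (\<Psi> y - \<Psi> t) \<le> \<bar>K\<bar> * \<bar>y - t\<bar> * \<bar>V y - V t\<bar>"
        proof (cases "t \<le> y")
          case True
          then have "norm (\<Psi> y - \<Psi> t) \<le> K * (y - t) * (V y - V t)" using le[of t y] y t by auto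
          also have "\<dots> \<le> \<bar>K * (y - t) * (V y - V t)\<bar>" by simp
          finally show ?thesis by (simp only: abs_mult)
        next
          case False
          then have "norm (\<Psi> t - \<Psi> y) \<le> K * (t - y) * (V t - V y)" using le[of y t] y t by auto
          also have "\<dots> \<le> \<bar>K * (t - y) * (V t - V y)\<bar>" by simp
          finally show ?thesis by (simp only: abs_mult norm_minus_commute abs_minus_commute)
        qed
        moreover have "0 < \<bar>y - t\<bar>" using y by simp
        ultimately have "norm (\<Psi> y - \<Psi> t) / \<bar>y - t\<bar> \<le> \<bar>K\<bar> * \<bar>V y - V t\<bar>"
          by (simp only: pos_divide_le_eq mult.assoc mult.commute mult.left_commute)
        moreover have "norm ((\<Psi> y - \<Psi> t - 0) /\<^sub>R norm (y - t)) = norm (\<Psi> y - \<Psi> t) / \<bar>y - t\<bar>"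
          by (simp add: divide_inverse mult.commute)
        ultimately show ?thesis by simp
      qed
      then show "\<forall>\<^sub>F y in at t within {0..p}. norm ((\<Psi> y - \<Psi> t - 0) /\<^sub>R norm (y - t)) \<le> \<bar>K\<bar> * \<bar>V y - V t\<bar>"
        unfolding eventually_at_filter by (intro always_eventually) auto
    qed
  qed (rule bounded_linear_zero)
  then obtain c where "\<forall>x\<in>{0..p}. \<Psi> x = c"
    using has_derivative_zero_constant[OF convex_real_interval(5), of 0 p \<Psi>] by blast
  then show ?thesis using assms(3) by simp
qed

text \<open>Absolute continuity of \<open>f\<close> with derivative \<open>h\<close> almost
  everywhere, expressed by increments: this form is easy to cut, shift and reverse and avoids
  pointwise derivatives.\<close>

definition has_density :: "real \<Rightarrow> (real \<Rightarrow> complex) \<Rightarrow> (real \<Rightarrow> complex) \<Rightarrow> bool" where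
  "has_density p f h \<longleftrightarrow> (\<forall>a b. 0 \<le> a \<longrightarrow> a \<le> b \<longrightarrow> b \<le> p \<longrightarrow> (h has_integral (f b - f a)) {a..b})"

lemma has_densityD: "has_density p f h \<Longrightarrow> 0 \<le> a \<Longrightarrow> a \<le> b \<Longrightarrow> b \<le> p \<Longrightarrow> (h has_integral (f b - f a)) {a..b}"
  unfolding has_density_def by blast

lemma has_densityI:
  assumes "h integrable_on {0..p}" "\<And>t. t \<in> {0..p} \<Longrightarrow> f t = f 0 + integral {0..t} h"
  shows "has_density p f h"
  unfolding has_density_def
proof (intro allI impI)
  fix a b assume ab: "0 \<le> a" "a \<le> b" "b \<le> p"
  have i: "h integrable_on {0..b}" "h integrable_on {a..b}"
    by (rule integrable_subinterval_real[OF assms(1)]; use ab in auto)+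
  have "integral {0..a} h + integral {a..b} h = integral {0..b} h"
    by (rule Henstock_Kurzweil_Integration.integral_combine[OF ab(1,2) i(1)])
  then have "f b - f a = integral {a..b} h" using assms(2)[of a] assms(2)[of b] ab by (simp add: algebra_simps)
  then show "(h has_integral (f b - f a)) {a..b}" using i(2) by (simp add: has_integral_integral)
qed

lemma has_density_continuous: 
  assumes "has_density p f h" "0 \<le> p"
  shows "continuous_on {0..p} f"
proof -
  have i: "h integrable_on {0..p}" using has_densityD[OF assms(1), of 0 p] assms(2) by (auto simp: integrable_on_def)
  have "continuous_on {0..p} (\<lambda>t. f 0 + integral {0..t} h)"
    by (intro continuous_intros indefinite_integral_continuous_1 i)
  then show ?thesis
  proof (rule continuous_on_eq)
    fix t assume "t \<in> {0..p}"
    then show "f 0 + integral {0..t} h = f t" using integral_unique[OF has_densityD[OF assms(1), of 0 t]] by simp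
  qed
qed

text \<open>As \<open>h\<close> is only integrable, the product rule does not hold at every point.
  Instead, the defect \<open>\<Psi>\<close> has increments of order
  \<open>(t - s) * (V t - V s)\<close>, where \<open>V\<close> is the indefinite integral of the
  norm of \<open>h\<close>; by \<open>superlinear_imp_constant\<close> they cannot add up to
  anything.\<close>

lemma integration_by_parts_density:
  fixes f h :: "real \<Rightarrow> complex" and \<phi> \<phi>' :: "real \<Rightarrow> real"
  assumes "0 \<le> p" and f: "has_density p f h"
    and h: "h absolutely_integrable_on {0..p}" "h \<in> borel_measurable borel"
    and \<phi>: "\<And>t. (\<phi> has_real_derivative \<phi>' t) (at t)" "continuous_on UNIV \<phi>'"
  shows "integral {0..p} (\<lambda>t. \<phi>' t *\<^sub>R f t) = \<phi> p *\<^sub>R f p - \<phi> 0 *\<^sub>R f 0 - integral {0..p} (\<lambda>t. \<phi> t *\<^sub>R h t)"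
proof -
  have c\<phi>: "continuous_on S \<phi>" for S using \<phi>(1) by (meson DERIV_isCont continuous_at_imp_continuous_on)
  have c\<phi>': "continuous_on S \<phi>'" for S by (rule continuous_on_subset[OF \<phi>(2)]) auto
  have cf: "continuous_on {0..p} f" by (rule has_density_continuous[OF f assms(1)])
  have "compact (\<phi>' ` {0..p})" by (intro compact_continuous_image c\<phi>') auto
  then obtain C0 where "\<forall>x\<in>\<phi>' ` {0..p}. norm x \<le> C0"
    unfolding compact_eq_bounded_closed bounded_iff by blast
  then have C0: "\<bar>\<phi>' t\<bar> \<le> C0" if "t \<in> {0..p}" for t using that by auto
  define C where "C = max C0 0"
  have C: "\<bar>\<phi>' t\<bar> \<le> C" if "t \<in> {0..p}" for t using C0[OF that] by (simp add: C_def)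
  have "0 \<le> C" by (simp add: C_def)
  define V where "V = (\<lambda>t. integral {0..t} (\<lambda>u. norm (h u)))"
  have nh: "(\<lambda>u. norm (h u)) integrable_on {0..p}" using h by (simp add: absolutely_integrable_on_def)
  have cV: "continuous_on {0..p} V" unfolding V_def by (rule indefinite_integral_continuous_1[OF nh])
  have Vd: "V b - V a = integral {a..b} (\<lambda>u. norm (h u))" if ab: "0 \<le> a" "a \<le> b" "b \<le> p" for a b
  proof -
    have "(\<lambda>u. norm (h u)) integrable_on {0..b}" by (rule integrable_subinterval_real[OF nh]) (use ab in auto)
    from Henstock_Kurzweil_Integration.integral_combine[OF ab(1,2) this] show ?thesis by (simp add: V_def)
  qed
  have nh': "(\<lambda>u. norm (h u)) integrable_on {a..b}" if ab: "0 \<le> a" "a \<le> b" "b \<le> p" for a b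
    by (rule integrable_subinterval_real[OF nh]) (use ab in auto)
  have fV: "norm (f b - f a) \<le> V b - V a" if ab: "0 \<le> a" "a \<le> b" "b \<le> p" for a b
  proof -
    have "norm (integral {a..b} h) \<le> integral {a..b} (\<lambda>u. norm (h u))"
      by (rule integral_norm_bound_integral[OF _ nh'[OF ab]])
         (use has_densityD[OF f ab] in \<open>auto simp: integrable_on_def\<close>)
    then show ?thesis using integral_unique[OF has_densityD[OF f ab]] Vd[OF ab] by simp
  qed
  have V0: "0 \<le> V b - V a" if ab: "0 \<le> a" "a \<le> b" "b \<le> p" for a b
    unfolding Vd[OF ab] by (rule integral_nonneg[OF nh'[OF ab]]) simp
  have ph: "(\<lambda>t. \<phi> t *\<^sub>R h t) integrable_on {a..b}" if ab: "0 \<le> a" "a \<le> b" "b \<le> p" for a b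
    by (rule integrable_subinterval_real[of _ 0 p])
       (use continuous_mult_absolutely_integrable[OF h(2,1) c\<phi>] ab set_lebesgue_integral_eq_integral(1) in auto)
  have pf: "(\<lambda>t. \<phi>' t *\<^sub>R f t) integrable_on {a..b}" if ab: "0 \<le> a" "a \<le> b" "b \<le> p" for a b
    by (intro integrable_continuous_interval continuous_intros c\<phi>' continuous_on_subset[OF cf]) (use ab in auto)
  define \<Psi> where "\<Psi> = (\<lambda>t. \<phi> t *\<^sub>R f t - integral {0..t} (\<lambda>t. \<phi>' t *\<^sub>R f t) - integral {0..t} (\<lambda>t. \<phi> t *\<^sub>R h t))"
  have "\<Psi> p = \<Psi> 0"
  proof (rule superlinear_imp_constant[OF cV _ assms(1)])
    fix s t assume st: "0 \<le> s" "s \<le> t" "t \<le> p"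
    have 1: "((\<lambda>u. \<phi>' u *\<^sub>R f t) has_integral (\<phi> t - \<phi> s) *\<^sub>R f t) {s..t}"
    proof (rule has_integral_scaleR_left, rule fundamental_theorem_of_calculus[OF st(2)])
      show "(\<phi> has_vector_derivative \<phi>' x) (at x within {s..t})" for x
        using \<phi>(1)[of x] has_vector_derivative_at_within by (simp add: has_real_derivative_iff_has_vector_derivative) blast
    qed
    have 2: "((\<lambda>u. \<phi> s *\<^sub>R h u) has_integral \<phi> s *\<^sub>R (f t - f s)) {s..t}"
      by (rule has_integral_cmul[OF has_densityD[OF f st]])
    \<comment> \<open>With \<open>f\<close> frozen at \<open>t\<close> and \<open>\<phi>\<close>
      frozen at \<open>s\<close>, the two main terms add up exactly to the increment of the product;
      what remains are integrals of differences, which are small.\<close>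
    have tot: "((\<lambda>u. (\<phi>' u *\<^sub>R f t - \<phi>' u *\<^sub>R f u) + (\<phi> s *\<^sub>R h u - \<phi> u *\<^sub>R h u)) has_integral \<Psi> t - \<Psi> s) {s..t}"
    proof -
      have "integral {0..s} (\<lambda>t. \<phi>' t *\<^sub>R f t) + integral {s..t} (\<lambda>t. \<phi>' t *\<^sub>R f t) = integral {0..t} (\<lambda>t. \<phi>' t *\<^sub>R f t)"
        by (rule Henstock_Kurzweil_Integration.integral_combine[OF st(1,2)]) (rule pf, use st in auto)
      moreover have "integral {0..s} (\<lambda>t. \<phi> t *\<^sub>R h t) + integral {s..t} (\<lambda>t. \<phi> t *\<^sub>R h t) = integral {0..t} (\<lambda>t. \<phi> t *\<^sub>R h t)"
        by (rule Henstock_Kurzweil_Integration.integral_combine[OF st(1,2)]) (rule ph, use st in auto)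
      ultimately have "\<Psi> t - \<Psi> s = ((\<phi> t - \<phi> s) *\<^sub>R f t - integral {s..t} (\<lambda>t. \<phi>' t *\<^sub>R f t)) + (\<phi> s *\<^sub>R (f t - f s) - integral {s..t} (\<lambda>t. \<phi> t *\<^sub>R h t))"
        unfolding \<Psi>_def by (simp add: algebra_simps)
      then show ?thesis
        by (simp only:) (intro has_integral_add has_integral_diff 1 2 integrable_integral pf ph st)
    qed
    have "norm (\<Psi> t - \<Psi> s) \<le> integral {s..t} (\<lambda>u. C * (V t - V s) + C * (t - s) * norm (h u))"
    proof -
      have "norm (integral {s..t} (\<lambda>u. (\<phi>' u *\<^sub>R f t - \<phi>' u *\<^sub>R f u) + (\<phi> s *\<^sub>R h u - \<phi> u *\<^sub>R h u)))
        \<le> integral {s..t} (\<lambda>u. C * (V t - V s) + C * (t - s) * norm (h u))"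
      proof (rule integral_norm_bound_integral)
        show "(\<lambda>u. \<phi>' u *\<^sub>R f t - \<phi>' u *\<^sub>R f u + (\<phi> s *\<^sub>R h u - \<phi> u *\<^sub>R h u)) integrable_on {s..t}"
          using tot by (auto simp: integrable_on_def)
        show "(\<lambda>u. C * (V t - V s) + C * (t - s) * norm (h u)) integrable_on {s..t}"
          by (intro integrable_add integrable_const_ivl integrable_on_mult_right nh' st)
        fix u assume u: "u \<in> {s..t}"
        have "norm (\<phi>' u *\<^sub>R f t - \<phi>' u *\<^sub>R f u) = \<bar>\<phi>' u\<bar> * norm (f t - f u)"
          by (metis norm_scaleR scaleR_diff_right)
        also have "\<dots> \<le> C * (V t - V s)"
        proof (rule mult_mono)
          show "\<bar>\<phi>' u\<bar> \<le> C" using C u st by auto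
          have "norm (f t - f u) \<le> V t - V u" using u st by (intro fV) auto
          also have "\<dots> \<le> V t - V s" using V0[of s u] u st by auto
          finally show "norm (f t - f u) \<le> V t - V s" .
        qed (use \<open>0 \<le> C\<close> in auto)
        finally have A: "norm (\<phi>' u *\<^sub>R f t - \<phi>' u *\<^sub>R f u) \<le> C * (V t - V s)" .
        have "\<bar>\<phi> s - \<phi> u\<bar> \<le> C * \<bar>s - u\<bar>"
        proof -
          have "norm (\<phi> s - \<phi> u) \<le> C * norm (s - u)"
            by (rule field_differentiable_bound[of "{0..p}" \<phi> \<phi>'])
               (use u st C has_field_derivative_at_within[OF \<phi>(1)] in auto)
          then show ?thesis by simp
        qed
        also have "\<dots> \<le> C * (t - s)" using u \<open>0 \<le> C\<close> by (intro mult_left_mono) auto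
        finally have "\<bar>\<phi> s - \<phi> u\<bar> * norm (h u) \<le> C * (t - s) * norm (h u)" by (rule mult_right_mono) simp
        moreover have "norm (\<phi> s *\<^sub>R h u - \<phi> u *\<^sub>R h u) = \<bar>\<phi> s - \<phi> u\<bar> * norm (h u)"
          by (metis norm_scaleR scaleR_diff_left)
        ultimately show "norm (\<phi>' u *\<^sub>R f t - \<phi>' u *\<^sub>R f u + (\<phi> s *\<^sub>R h u - \<phi> u *\<^sub>R h u)) \<le> C * (V t - V s) + C * (t - s) * norm (h u)"
          using A norm_triangle_ineq[of "\<phi>' u *\<^sub>R f t - \<phi>' u *\<^sub>R f u" "\<phi> s *\<^sub>R h u - \<phi> u *\<^sub>R h u"] by linarith
      qed
      then show ?thesis using integral_unique[OF tot] by simp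
    qed
    also have "\<dots> = C * (V t - V s) * (t - s) + C * (t - s) * (V t - V s)"
    proof -
      have "((\<lambda>u. C * (V t - V s) + C * (t - s) * norm (h u)) has_integral (t - s) *\<^sub>R (C * (V t - V s)) + C * (t - s) * (V t - V s)) {s..t}"
        unfolding Vd[OF st]
        using has_integral_const_real[of "C * (V t - V s)" s t] st
        by (intro has_integral_add has_integral_mult_right integrable_integral nh') (auto simp: Vd[OF st])
      from integral_unique[OF this] show ?thesis by (simp add: algebra_simps)
    qed
    finally show "norm (\<Psi> t - \<Psi> s) \<le> (2 * C) * (t - s) * (V t - V s)" by (simp add: algebra_simps)
  qed
  then show ?thesis by (simp add: \<Psi>_def algebra_simps)
qed

section \<open>From weak second derivatives to classical first derivatives with a density, and
  back\<close>

definition sobolev2 :: "real \<Rightarrow> (real \<Rightarrow> complex) \<Rightarrow> (real \<Rightarrow> complex) \<Rightarrow> (real \<Rightarrow> complex) \<Rightarrow> bool" where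
  "sobolev2 p f T h \<longleftrightarrow> (\<forall>t. f (t + p) = f t) \<and> (\<forall>t. T (t + p) = T t)
     \<and> (\<forall>t. (f has_vector_derivative T t) (at t)) \<and> h \<in> L2_circle p \<and> has_density p T h"

lemma per_of_periodic:
  assumes "\<And>t. f (t + p) = f t"
  shows "per p f = f"
proof
  fix t
  have "f (t + of_int (- \<lfloor>t / p\<rfloor>) * p) = f t" by (rule periodic_int[where f = f]) (rule assms)
  then show "per p f t = f t" by (simp add: per_def mult.commute)
qed

lemma has_density_continuous_UNIV:
  assumes "0 < p" "has_density p T h" "\<And>t. T (t + p) = T t"
  shows "continuous_on UNIV T"
proof -
  have "T 0 = T p" using assms(3)[of 0] by simp
  then have "continuous_on UNIV (per p T)"
    using assms(1) by (intro per_continuous has_density_continuous[OF assms(2)]) auto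
  then show ?thesis using per_of_periodic[of T p] assms(3) by simp
qed

lemma antiderivative_has_density:
  assumes "\<And>t. (f has_vector_derivative T t) (at t)"
  shows "has_density p f T"
  unfolding has_density_def
  by (intro allI impI fundamental_theorem_of_calculus has_vector_derivative_at_within[OF assms])

lemma weak_deriv_density:
  assumes p: "0 < p" and f: "has_density p f h" "\<And>t. f (t + p) = f t" and h: "h \<in> L2_circle p"
  shows "weak_deriv p f h"
  unfolding weak_deriv_def
proof
  fix \<phi> assume \<phi>: "\<phi> \<in> test_functions p"
  have cf: "continuous_on UNIV f" by (rule has_density_continuous_UNIV[OF p f])
  have fL2: "f \<in> L2_circle p" by (rule continuous_L2_circle[OF cf f(2)])
  note c = test_functionsD(4)[OF \<phi>] test_functionsD(4)[OF test_functionsD(3)[OF \<phi>]]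
  have e: "\<phi> p = \<phi> 0" "f p = f 0" using test_functionsD(1)[OF \<phi>, of 0] f(2)[of 0] by auto
  have "integral {0..p} (\<lambda>t. deriv \<phi> t *\<^sub>R f t) = \<phi> p *\<^sub>R f p - \<phi> 0 *\<^sub>R f 0 - integral {0..p} (\<lambda>t. \<phi> t *\<^sub>R h t)"
    by (rule integration_by_parts_density[OF less_imp_le[OF p] f(1) L2_circleD(4,1)[OF h] test_functionsD(2)[OF \<phi>] c(2)])
  then show "(LBINT t:{0..p}. deriv \<phi> t *\<^sub>R f t) = - (LBINT t:{0..p}. \<phi> t *\<^sub>R h t)"
    unfolding continuous_mult_L2(2)[OF fL2 c(2)] continuous_mult_L2(2)[OF h c(1)] e by simp
qed

lemma sobolev2_imp_weak:
  assumes p: "0 < p" and s: "sobolev2 p f T h"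
  shows "weak_deriv2_L2 p f h"
proof -
  have s': "\<And>t. f (t + p) = f t" "\<And>t. T (t + p) = T t" "\<And>t. (f has_vector_derivative T t) (at t)" "h \<in> L2_circle p" "has_density p T h"
    using s by (auto simp: sobolev2_def)
  have cT: "continuous_on UNIV T" by (rule has_density_continuous_UNIV[OF p s'(5,2)])
  have TL: "T \<in> L2_circle p" by (rule continuous_L2_circle[OF cT s'(2)])
  note df = antiderivative_has_density[OF s'(3)]
  have "f \<in> L2_circle p" by (intro continuous_L2_circle has_density_continuous_UNIV[OF p df] s'(1))
  moreover have "weak_deriv p f T" by (rule weak_deriv_density[OF p df s'(1) TL])
  moreover have "weak_deriv p T h" by (rule weak_deriv_density[OF p s'(5,2,4)])
  ultimately show ?thesis unfolding weak_deriv2_L2_def using TL s'(4) by blast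
qed

text \<open>Integrate \<open>h\<close> twice, choosing the constant of the first integral so that
  the second becomes periodic. The result \<open>K\<close> has the same weak second derivative as
  \<open>f\<close>, so \<open>f - K\<close> is orthogonal to second derivatives of test functions
  and therefore constant; hence \<open>f\<close> inherits the classical derivative of
  \<open>K\<close>.\<close>

lemma weak_imp_sobolev2:
  assumes p: "0 < p" and cf: "continuous_on UNIV f" and w: "weak_deriv2_L2 p f h"
  shows "\<exists>T. sobolev2 p f T h"
proof -
  obtain g where f: "f \<in> L2_circle p" and h: "h \<in> L2_circle p" and g: "g \<in> L2_circle p"
    and w1: "weak_deriv p f g" and w2: "weak_deriv p g h" using w by (auto simp: weak_deriv2_L2_def)
  note hD = L2_circleD[OF h]
  have hi: "h integrable_on {0..p}" using hD(4) set_lebesgue_integral_eq_integral(1) by blast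
  define H where "H = (\<lambda>t. integral {0..t} h)"
  have dH: "has_density p H h" by (rule has_densityI[OF hi]) (simp add: H_def)
  \<comment> \<open>Testing with the constant 1 shows that \<open>h\<close> has mean zero.\<close>
  have "H p = 0"
  proof -
    have "(LBINT t:{0..p}. deriv (\<lambda>_. 1) t *\<^sub>R g t) = - (LBINT t:{0..p}. (1::real) *\<^sub>R h t)"
      using w2 const_test_function[of 1 p] unfolding weak_deriv_def by blast
    then show ?thesis
      unfolding continuous_mult_L2(2)[OF h continuous_on_const] by (simp add: H_def)
  qed
  have cH: "continuous_on {0..p} H" using has_density_continuous[OF dH] p by simp
  define c where "c = (1 / p) *\<^sub>R integral {0..p} H"
  define T where "T = per p (\<lambda>t. H t - c)"
  have H0: "H 0 = 0" by (simp add: H_def)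
  have T_eq: "T t = H t - c" if "t \<in> {0..p}" for t
    unfolding T_def by (rule per_eq[OF p _ that]) (simp add: H0 \<open>H p = 0\<close>)
  have cT: "continuous_on UNIV T" unfolding T_def
    by (rule per_continuous[OF p]) (auto intro!: continuous_intros cH simp: H0 \<open>H p = 0\<close>)
  have perT: "T (t + p) = T t" for t unfolding T_def by (rule per_periodic[OF p])
  have dT: "has_density p T h"
    unfolding has_density_def
  proof (intro allI impI)
    fix a b assume ab: "0 \<le> a" "a \<le> b" "b \<le> p"
    then have "T b - T a = H b - H a" using T_eq[of a] T_eq[of b] by simp
    then show "(h has_integral (T b - T a)) {a..b}" using has_densityD[OF dH ab] by simp
  qed
  have iT: "integral {0..p} T = 0"
  proof -
    have "integral {0..p} T = integral {0..p} (\<lambda>t. H t - c)" by (rule integral_cong) (rule T_eq)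
    also have "\<dots> = integral {0..p} H - p *\<^sub>R c"
      using p by (subst integral_diff) (auto intro!: integrable_continuous_interval cH)
    finally show ?thesis using p by (simp add: c_def)
  qed
  obtain K where K: "\<And>t. (K has_vector_derivative T t) (at t)" using continuous_antiderivative[OF cT] by blast
  have perK: "K (t + p) = K t" for t by (rule periodic_antiderivative[OF p cT perT iT K])
  note dK = antiderivative_has_density[OF K]
  have cK: "continuous_on UNIV K" by (rule has_density_continuous_UNIV[OF p dK perK])
  have KL: "K \<in> L2_circle p" "T \<in> L2_circle p" by (intro continuous_L2_circle cK perK cT perT)+
  have wK: "weak_deriv p K T" "weak_deriv p T h"
    by (rule weak_deriv_density[OF p dK perK KL(2)], rule weak_deriv_density[OF p dT perT h])
  have two: "integral {0..p} (\<lambda>t. deriv (deriv \<phi>) t *\<^sub>R u t) = (LBINT t:{0..p}. \<phi> t *\<^sub>R h t)"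
    if u: "u \<in> L2_circle p" "weak_deriv p u v" "weak_deriv p v h" and \<phi>: "\<phi> \<in> test_functions p" for u v \<phi>
  proof -
    note d = test_functionsD(3)[OF \<phi>] test_functionsD(3)[OF test_functionsD(3)[OF \<phi>]]
    have "(LBINT t:{0..p}. deriv (deriv \<phi>) t *\<^sub>R u t) = - (LBINT t:{0..p}. deriv \<phi> t *\<^sub>R v t)"
      using u(2) d(1) unfolding weak_deriv_def by blast
    also have "(LBINT t:{0..p}. deriv \<phi> t *\<^sub>R v t) = - (LBINT t:{0..p}. \<phi> t *\<^sub>R h t)"
      using u(3) \<phi> unfolding weak_deriv_def by blast
    finally show ?thesis unfolding continuous_mult_L2(2)[OF u(1) test_functionsD(4)[OF d(2)]] by simp
  qed
  have perf: "f (t + p) = f t" for t using L2_circleD(2)[OF f] .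
  have "\<exists>c. \<forall>t\<in>{0..p}. f t - K t = c"
  proof (rule du_bois_reymond[OF p])
    show "continuous_on UNIV (\<lambda>t. f t - K t)" by (intro continuous_intros cf cK)
    show "f (t + p) - K (t + p) = f t - K t" for t by (simp add: perf perK)
    fix \<phi> assume \<phi>: "\<phi> \<in> test_functions p"
    note c2 = test_functionsD(4)[OF test_functionsD(3)[OF test_functionsD(3)[OF \<phi>]]]
    have i: "(\<lambda>t. deriv (deriv \<phi>) t *\<^sub>R u t) integrable_on {0..p}" if "u \<in> L2_circle p" for u
      using continuous_mult_L2(1)[OF that c2] set_lebesgue_integral_eq_integral(1) by blast
    show "integral {0..p} (\<lambda>t. deriv (deriv \<phi>) t *\<^sub>R (f t - K t)) = 0"
      unfolding scaleR_diff_right integral_diff[OF i[OF f] i[OF KL(1)]]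
      using two[OF f w1 w2 \<phi>] two[OF KL(1) wK \<phi>] by simp
  qed
  then obtain c' where c': "\<And>t. t \<in> {0..p} \<Longrightarrow> f t - K t = c'" by blast
  have fK: "f t = K t + c'" for t
  proof -
    obtain k s where t: "t = s + of_int k * p" "0 \<le> s" "s < p" using periodic_reduce[OF p] .
    have "f t = f s" "K t = K s" unfolding t(1)
      using periodic_int[where f = f and p = p, OF perf] periodic_int[where f = K and p = p, OF perK] by auto
    then show ?thesis using c'[of s] t by (simp add: algebra_simps)
  qed
  have "(f has_vector_derivative T t) (at t)" for t
    unfolding fK[abs_def] using has_vector_derivative_add[OF K[of t] has_vector_derivative_const[of c']] by simp
  then show ?thesis unfolding sobolev2_def using perf perT h dT by blast
qed

text \<open>The difference has integral zero over every interval. Intervals are stable under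
  intersection and generate the Borel sets, so its integral over every Borel set is zero.\<close>

lemma density_unique_AE:
  assumes d: "has_density p T h" "has_density p T h'" and L: "h \<in> L2_circle p" "h' \<in> L2_circle p"
  shows "AE t in lborel. t \<in> {0..p} \<longrightarrow> h t = h' t"
proof -
  note [measurable] = L2_circleD(1)[OF L(1)] L2_circleD(1)[OF L(2)]
  define d where "d = (\<lambda>t. indicat_real {0..p} t *\<^sub>R (h t - h' t))"
  have si: "set_integrable lborel {0..p} h" "set_integrable lborel {0..p} h'"
    using L2_circleD(4)[OF L(1)] L2_circleD(4)[OF L(2)] set_integrable_lborel_iff[of h 0 p] set_integrable_lborel_iff[of h' 0 p]
    by auto
  have "set_integrable lborel {0..p} (\<lambda>t. h t - h' t)" by (rule set_integral_diff(1)[OF si])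
  then have di: "integrable lborel d" by (simp add: d_def set_integrable_def)
  have ivl: "(LBINT t:{a..b}. d t) = 0" for a b
  proof -
    let ?a = "max a 0" and ?b = "min b p"
    have eq: "(LBINT t:{a..b}. d t) = (LBINT t:{?a..?b}. h t - h' t)"
      unfolding set_lebesgue_integral_def d_def
      by (intro Bochner_Integration.integral_cong) (auto simp: indicator_def)
    have "set_integrable lborel {?a..?b} (\<lambda>t. h t - h' t)"
      by (rule set_integrable_subset[OF \<open>set_integrable lborel {0..p} (\<lambda>t. h t - h' t)\<close>]) auto
    then have "(LBINT t:{?a..?b}. h t - h' t) = integral {?a..?b} (\<lambda>t. h t - h' t)"
      by (rule set_borel_integral_eq_integral(2))
    also have "\<dots> = 0"
    proof (cases "?a \<le> ?b")
      case True
      then have "((\<lambda>t. h t - h' t) has_integral (T ?b - T ?a) - (T ?b - T ?a)) {?a..?b}"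
        by (intro has_integral_diff has_densityD[OF assms(1)] has_densityD[OF assms(2)]) auto
      from integral_unique[OF this] show ?thesis by simp
    qed auto
    finally show ?thesis using eq by simp
  qed
  have all: "(LBINT t:A. d t) = 0" if "A \<in> sets lborel" for A
  proof -
    let ?G = "range (\<lambda>(a, b). {a..b::real})"
    have "Int_stable ?G"
      unfolding Int_stable_def by (auto simp: image_iff Int_atLeastAtMost)
    moreover have "?G \<subseteq> Pow UNIV" by simp
    moreover have "A \<in> sigma_sets UNIV ?G" using that by (simp add: borel_eq_atLeastAtMost)
    ultimately show ?thesis
    proof (induction rule: sigma_sets_induct_disjoint)
      case (basic A)
      then show ?case using ivl by auto
    next
      case empty
      then show ?case by (simp add: set_lebesgue_integral_def)
    next
      case (compl A)
      have "(LBINT t:UNIV. d t) = (LBINT t:{0..p}. d t)"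
        unfolding set_lebesgue_integral_def d_def by (intro Bochner_Integration.integral_cong) (auto simp: indicator_def)
      then have U: "(LBINT t:UNIV. d t) = 0" using ivl by simp
      have As: "A \<in> sets borel" using compl(1) by (simp add: borel_eq_atLeastAtMost)
      have i: "set_integrable lborel B d" if "B \<in> sets borel" for B
        using di that unfolding set_integrable_def by (intro integrable_mult_indicator) auto
      have "(LBINT t:A \<union> (UNIV - A). d t) = (LBINT t:A. d t) + (LBINT t:UNIV - A. d t)"
        by (rule set_integral_Un) (use As i in auto)
      then show ?case using U compl(2) by (simp add: Un_absorb1)
    next
      case (union A)
      have As: "A i \<in> sets lborel" for i using union(2) by (auto simp: borel_eq_atLeastAtMost)
      have "(LBINT t:(\<Union>i. A i). d t) = (\<Sum>i. (LBINT t:A i. d t))"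
      proof (rule lebesgue_integral_countable_add[OF As])
        show "A i \<inter> A j = {}" if "i \<noteq> j" for i j using union(1) that by (auto simp: disjoint_family_on_def)
        have "(\<Union>i. A i) \<in> sets lborel" using As by blast
        then show "set_integrable lborel (\<Union> (range A)) d"
          using di unfolding set_integrable_def by (intro integrable_mult_indicator) auto
      qed
      then show ?case using union(3) by simp
    qed
  qed
  have "AE t in lborel. d t = 0" by (rule sigma_finite_measure.density_zero[OF sigma_finite_lborel di all])
  then show ?thesis by eventually_elim (auto simp: d_def indicator_def split: if_splits)
qed

text \<open>This makes the arbitrary choice in \<open>bending_energy\<close> harmless.\<close>

lemma sobolev2_energy_unique:
  assumes p: "0 < p" and s: "sobolev2 p f T h" "sobolev2 p f T' h'"
  shows "T = T'" "(LBINT t:{0..p}. (norm (h t))\<^sup>2) = (LBINT t:{0..p}. (norm (h' t))\<^sup>2)"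
proof -
  have v: "\<And>t. (f has_vector_derivative T t) (at t)" "\<And>t. (f has_vector_derivative T' t) (at t)"
    using s by (auto simp: sobolev2_def)
  show "T = T'" using vector_derivative_unique_at[OF v] by blast
  then have "AE t in lborel. t \<in> {0..p} \<longrightarrow> h t = h' t"
    using s by (intro density_unique_AE[of p T]) (auto simp: sobolev2_def)
  moreover have [measurable]: "h \<in> borel_measurable borel" "h' \<in> borel_measurable borel"
    using s L2_circleD(1) by (auto simp: sobolev2_def)
  ultimately show "(LBINT t:{0..p}. (norm (h t))\<^sup>2) = (LBINT t:{0..p}. (norm (h' t))\<^sup>2)"
    unfolding set_lebesgue_integral_def
    by (intro integral_cong_AE) (auto elim!: eventually_mono simp: indicator_def)
qed

section \<open>A criterion for square integrable densities\<close>

lemma has_integral_combine_pieces: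
  fixes f :: "real \<Rightarrow> 'a::banach"
  assumes "0 \<le> d" "\<And>k. k < N \<Longrightarrow> (f has_integral c k) {real k * d..real (Suc k) * d}"
  shows "(f has_integral (\<Sum>k<N. c k)) {0..real N * d}"
  using assms(2)
proof (induction N)
  case (Suc N)
  have "(f has_integral (\<Sum>k<N. c k) + c N) {0..real (Suc N) * d}"
    by (rule has_integral_combine[of 0 "real N * d"]) (use Suc assms(1) in \<open>auto simp: mult_right_mono\<close>)
  then show ?case by simp
qed (use has_integral_refl(2)[of f 0] in simp)

context
  fixes p :: real and T :: "real \<Rightarrow> complex"
  assumes p: "0 < p"
begin

definition mesh :: "nat \<Rightarrow> real" where "mesh n = p / 2 ^ n"

definition dquot :: "nat \<Rightarrow> nat \<Rightarrow> complex" where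
  "dquot n k = (1 / mesh n) *\<^sub>R (T (real (Suc k) * mesh n) - T (real k * mesh n))"

definition dstep :: "nat \<Rightarrow> real \<Rightarrow> complex" where
  "dstep n t = dquot n (nat \<lfloor>t / mesh n\<rfloor>)"

text \<open>The Dirichlet energy of the piecewise linear interpolant of \<open>T\<close> at the
  dyadic points; \<open>dstep\<close> is the derivative of that interpolant.\<close>

definition denergy :: "nat \<Rightarrow> real" where
  "denergy n = (\<Sum>k<2 ^ n. (norm (T (real (Suc k) * mesh n) - T (real k * mesh n)))\<^sup>2 / mesh n)"

lemma mesh_pos: "0 < mesh n" using p by (simp add: mesh_def)

lemma mesh_Suc: "mesh n = 2 * mesh (Suc n)" by (simp add: mesh_def)

lemma mesh_total: "real (2 ^ n) * mesh n = p" by (simp add: mesh_def)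

lemma dstep_measurable: "dstep n \<in> borel_measurable borel"
proof -
  have "(\<lambda>t. nat \<lfloor>t / mesh n\<rfloor>) \<in> borel \<rightarrow>\<^sub>M count_space UNIV" by measurable
  from measurable_compose[OF this, of "dquot n" borel] show ?thesis by (simp add: dstep_def[abs_def])
qed

lemma dstep_eq:
  assumes "t \<in> {real k * mesh n..real (Suc k) * mesh n} - {real (Suc k) * mesh n}"
  shows "dstep n t = dquot n k"
proof -
  have "real k \<le> t / mesh n" "t / mesh n < real (Suc k)"
    using assms mesh_pos[of n] by (auto simp: pos_le_divide_eq pos_divide_less_eq)
  then have "\<lfloor>t / mesh n\<rfloor> = int k" by (intro floor_unique) auto
  then show ?thesis by (simp add: dstep_def)
qed

lemma dstep_has_integral_self:
  "(dstep n has_integral T (real (Suc k) * mesh n) - T (real k * mesh n)) {real k * mesh n..real (Suc k) * mesh n}"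
proof -
  have "((\<lambda>t. dquot n k) has_integral (real (Suc k) * mesh n - real k * mesh n) *\<^sub>R dquot n k) {real k * mesh n..real (Suc k) * mesh n}"
    using mesh_pos[of n] by (intro has_integral_const_real[THEN has_integral_eq_rhs]) (auto simp: mult_right_mono)
  moreover have "(real (Suc k) * mesh n - real k * mesh n) *\<^sub>R dquot n k = T (real (Suc k) * mesh n) - T (real k * mesh n)"
    using mesh_pos[of n] by (simp add: dquot_def algebra_simps)
  ultimately show ?thesis
    by (intro has_integral_spike_finite[of "{real (Suc k) * mesh n}" _ "dstep n" "\<lambda>t. dquot n k"]) (auto simp: dstep_eq)
qed

text \<open>The martingale property: the mean of a finer step function over a coarser cell is the
  coarser difference quotient, by telescoping.\<close>

lemma dstep_has_integral:
  "n \<le> m \<Longrightarrow> (dstep m has_integral T (real (Suc k) * mesh n) - T (real k * mesh n)) {real k * mesh n..real (Suc k) * mesh n}"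
proof (induction "m - n" arbitrary: n k)
  case 0
  then show ?case using dstep_has_integral_self by simp
next
  case (Suc d)
  let ?m = "mesh (Suc n)"
  have IH: "(dstep m has_integral T (real (Suc j) * ?m) - T (real j * ?m)) {real j * ?m..real (Suc j) * ?m}" for j
    using Suc by (intro Suc.hyps(1)) auto
  have e: "real k * mesh n = real (2 * k) * ?m" "real (Suc k) * mesh n = real (Suc (Suc (2 * k))) * ?m"
    by (simp_all add: mesh_Suc[of n] algebra_simps)
  have "(dstep m has_integral (T (real (Suc (2 * k)) * ?m) - T (real (2 * k) * ?m))
      + (T (real (Suc (Suc (2 * k))) * ?m) - T (real (Suc (2 * k)) * ?m))) {real (2 * k) * ?m..real (Suc (Suc (2 * k))) * ?m}"
    by (rule has_integral_combine[OF _ _ IH IH]) (use mesh_pos[of "Suc n"] in \<open>auto simp: mult_right_mono\<close>)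
  then show ?case unfolding e by simp
qed

lemma dstep_inner_has_integral:
  assumes "n \<le> m"
  shows "((\<lambda>t. inner (dstep m t) (dstep n t)) has_integral denergy n) {0..p}"
proof -
  have "((\<lambda>t. inner (dstep m t) (dstep n t)) has_integral (norm (T (real (Suc k) * mesh n) - T (real k * mesh n)))\<^sup>2 / mesh n)
     {real k * mesh n..real (Suc k) * mesh n}" for k
  proof -
    let ?d = "T (real (Suc k) * mesh n) - T (real k * mesh n)"
    have "((\<lambda>t. inner (dstep m t) (dquot n k)) has_integral inner ?d (dquot n k)) {real k * mesh n..real (Suc k) * mesh n}"
      using has_integral_linear[OF dstep_has_integral[OF assms] bounded_linear_inner_left[of "dquot n k"]] by (simp add: o_def)
    moreover have "inner ?d (dquot n k) = (norm ?d)\<^sup>2 / mesh n"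
      by (simp add: dquot_def power2_norm_eq_inner)
    ultimately show ?thesis
      by (intro has_integral_spike_finite[of "{real (Suc k) * mesh n}" _ "\<lambda>t. inner (dstep m t) (dstep n t)" "\<lambda>t. inner (dstep m t) (dquot n k)"])
         (auto simp: dstep_eq)
  qed
  from has_integral_combine_pieces[OF less_imp_le[OF mesh_pos] this, of "2 ^ n"]
  show ?thesis unfolding denergy_def mesh_total .
qed

lemma dstep_norm_has_integral: "((\<lambda>t. (norm (dstep n t))\<^sup>2) has_integral denergy n) {0..p}"
  using dstep_inner_has_integral[of n n] by (simp add: power2_norm_eq_inner)

text \<open>Pythagoras: \<open>dstep n\<close> is the orthogonal projection of
  \<open>dstep m\<close> to the coarser step functions. So bounded energies make the sequence
  Cauchy.\<close>

lemma dstep_diff_has_integral: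
  assumes "n \<le> m"
  shows "((\<lambda>t. (norm (dstep m t - dstep n t))\<^sup>2) has_integral denergy m - denergy n) {0..p}"
proof -
  have "((\<lambda>t. (norm (dstep m t))\<^sup>2 - 2 * inner (dstep m t) (dstep n t) + (norm (dstep n t))\<^sup>2)
    has_integral denergy m - 2 * denergy n + denergy n) {0..p}"
    by (intro has_integral_add has_integral_diff has_integral_mult_right dstep_norm_has_integral dstep_inner_has_integral assms)
  moreover have "(norm (dstep m t))\<^sup>2 - 2 * inner (dstep m t) (dstep n t) + (norm (dstep n t))\<^sup>2 = (norm (dstep m t - dstep n t))\<^sup>2" for t
    by (simp add: power2_norm_eq_inner inner_diff inner_commute algebra_simps)
  ultimately show ?thesis by simp
qed

lemma denergy_mono: "n \<le> m \<Longrightarrow> denergy n \<le> denergy m"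
  using has_integral_nonneg[OF dstep_diff_has_integral[of n m]] by simp

lemma nonneg_has_integral_lborel:
  fixes f :: "real \<Rightarrow> real"
  assumes [measurable]: "f \<in> borel_measurable borel" and "\<And>t. 0 \<le> f t" "(f has_integral I) {0..p}"
  shows "integrable (restrict_space lborel {0..p}) f" "integral\<^sup>L (restrict_space lborel {0..p}) f = I"
    "(\<integral>\<^sup>+t. ennreal (f t) \<partial>restrict_space lborel {0..p}) = ennreal I"
proof -
  have "f absolutely_integrable_on {0..p}"
    using assms by (intro nonnegative_absolutely_integrable_1) (auto simp: integrable_on_def)
  then have s: "set_integrable lborel {0..p} f" using set_integrable_lborel_iff[OF assms(1)] by simp
  then show i: "integrable (restrict_space lborel {0..p}) f"
    by (simp add: set_integrable_def integrable_restrict_space)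
  show e: "integral\<^sup>L (restrict_space lborel {0..p}) f = I"
    using set_borel_integral_eq_integral(2)[OF s] integral_unique[OF assms(3)]
    by (simp add: set_lebesgue_integral_def integral_restrict_space)
  show "(\<integral>\<^sup>+t. ennreal (f t) \<partial>restrict_space lborel {0..p}) = ennreal I"
    using nn_integral_eq_integral[OF i] assms(2) e by simp
qed

text \<open>Riesz: dyadic difference quotients of bounded energy form an \<open>L\<^sup>2\<close>-martingale.\<close>

lemma riesz_criterion:
  assumes cT: "continuous_on {0..p} T" and M: "\<And>n. denergy n \<le> M"
  shows "\<exists>h. h \<in> borel_measurable borel \<and> (\<lambda>t. (norm (h t))\<^sup>2) integrable_on {0..p}
     \<and> integral {0..p} (\<lambda>t. (norm (h t))\<^sup>2) \<le> M \<and> has_density p T h"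
proof -
  note [measurable] = dstep_measurable
  let ?N = "restrict_space lborel {0..p}"
  define E where "E = (SUP n. denergy n)"
  have bdd: "bdd_above (range denergy)" using M by (auto simp: bdd_above_def)
  have EE: "denergy n \<le> E" for n unfolding E_def by (rule cSUP_upper[OF _ bdd]) simp
  have "\<exists>n. \<forall>m\<ge>n. E - denergy m \<le> e" if "0 < e" for e
  proof -
    have "E - e < E" using that by simp
    then obtain n where "E - e < denergy n" unfolding E_def using less_cSUP_iff[OF _ bdd] by blast
    then show ?thesis using denergy_mono[of n] by (intro exI[of _ n]) force
  qed
  then have "\<exists>n. \<forall>m\<ge>n. E - denergy m \<le> (1 / 4) ^ k" for k by simp
  then obtain N where N: "\<And>k m. N k \<le> m \<Longrightarrow> E - denergy m \<le> (1 / 4) ^ k" by metis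
  \<comment> \<open>The sum makes \<open>r\<close> monotone and at least \<open>N k\<close>; the
    summand \<open>k\<close> makes it tend to infinity.\<close>
  define r where "r = (\<lambda>k. (\<Sum>i\<le>k. N i) + k)"
  have rN: "N k \<le> r k" for k unfolding r_def using member_le_sum[of k "{..k}" N] by simp
  have rmono: "r k \<le> r (Suc k)" for k by (simp add: r_def)
  have rk: "k \<le> r k" for k by (simp add: r_def)
  define g where "g = (\<lambda>k t. dstep (r (Suc k)) t - dstep (r k) t)"
  have [measurable]: "g k \<in> borel_measurable borel" for k unfolding g_def by measurable
  have g2: "((\<lambda>t. (norm (g k t))\<^sup>2) has_integral denergy (r (Suc k)) - denergy (r k)) {0..p}" for k
    unfolding g_def by (rule dstep_diff_has_integral[OF rmono])
  have gsmall: "denergy (r (Suc k)) - denergy (r k) \<le> (1 / 4) ^ k" for k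
    using N[OF rN, of k] EE[of "r (Suc k)"] by simp
  define C where "C = (p + 1) / 2"
  have gi: "integrable ?N (g k)" "(LINT t|?N. norm (g k t)) \<le> C * (1 / 2) ^ k" for k
  proof -
    \<comment> \<open>The weights \<open>2 ^ k\<close> and its inverse balance the energy bound
      \<open>(1 / 4) ^ k\<close>, so that the integrals of the norms are of order
      \<open>(1 / 2) ^ k\<close> and summable.\<close>
    have le: "norm (g k t) \<le> (1 / 2) * ((1 / 2) ^ k + 2 ^ k * (norm (g k t))\<^sup>2)" for t
    proof -
      have "0 \<le> (2 ^ k * norm (g k t) - 1)\<^sup>2 / 2 ^ k" by simp
      also have "\<dots> = 2 ^ k * (norm (g k t))\<^sup>2 - 2 * norm (g k t) + (1 / 2) ^ k"
        by (simp add: power2_eq_square field_simps power_one_over)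
      finally show ?thesis by simp
    qed
    let ?b = "\<lambda>t. (1 / 2) * ((1 / 2) ^ k + 2 ^ k * (norm (g k t))\<^sup>2)"
    have hb: "(?b has_integral (1 / 2) * ((1 / 2) ^ k * p + 2 ^ k * (denergy (r (Suc k)) - denergy (r k)))) {0..p}"
      using p has_integral_const_real[of "(1 / 2 :: real) ^ k" 0 p]
      by (intro has_integral_mult_right has_integral_add g2) (auto simp: mult.commute)
    have bI: "integrable ?N ?b" "integral\<^sup>L ?N ?b = (1 / 2) * ((1 / 2) ^ k * p + 2 ^ k * (denergy (r (Suc k)) - denergy (r k)))"
      by (rule nonneg_has_integral_lborel[OF _ _ hb]; simp)+
    show "integrable ?N (g k)"
      by (rule Bochner_Integration.integrable_bound[OF bI(1)])
         (use le in \<open>auto intro!: AE_I2 measurable_restrict_space1 intro: order_trans[OF le]\<close>)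
    then have "(LINT t|?N. norm (g k t)) \<le> integral\<^sup>L ?N ?b"
      by (intro integral_mono bI) (use le in auto)
    also have "\<dots> \<le> (1 / 2) * ((1 / 2) ^ k * p + 2 ^ k * (1 / 4) ^ k)"
      unfolding bI(2) using gsmall[of k] by (intro mult_left_mono add_left_mono) auto
    also have "\<dots> = C * (1 / 2) ^ k"
      by (simp add: C_def field_simps power_mult_distrib[symmetric])
    finally show "(LINT t|?N. norm (g k t)) \<le> C * (1 / 2) ^ k" .
  qed
  have sumC: "summable (\<lambda>k. C * (1 / 2) ^ k)" by (intro summable_mult summable_geometric) simp
  have sg: "summable (\<lambda>k. LINT t|?N. norm (g k t))"
    by (rule summable_comparison_test'[OF sumC, of 0]) (use gi(2) in auto)
  have AEs: "AE t in ?N. summable (\<lambda>k. norm (g k t))"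
  proof -
    have "(\<integral>\<^sup>+t. (\<Sum>k. ennreal (norm (g k t))) \<partial>?N) = (\<Sum>k. \<integral>\<^sup>+t. ennreal (norm (g k t)) \<partial>?N)"
      by (rule nn_integral_suminf) (auto intro!: measurable_restrict_space1)
    also have "\<dots> = (\<Sum>k. ennreal (LINT t|?N. norm (g k t)))"
      using gi(1) by (intro suminf_cong nn_integral_eq_integral) auto
    also have "\<dots> \<noteq> \<infinity>" using sg by (simp add: suminf_ennreal2)
    finally have "AE t in ?N. (\<Sum>k. ennreal (norm (g k t))) \<noteq> \<infinity>"
      by (intro nn_integral_PInf_AE) (auto intro!: measurable_restrict_space1)
    then show ?thesis
      by eventually_elim (auto intro!: summable_suminf_not_top)
  qed
  \<comment> \<open>The telescoping series converges absolutely almost everywhere. Where it does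
    not, \<open>suminf\<close> has some default value, which no integral sees.\<close>
  define h where "h = (\<lambda>t. dstep (r 0) t + (\<Sum>k. g k t))"
  have hm [measurable]: "h \<in> borel_measurable borel" unfolding h_def by measurable
  have tele: "dstep (r 0) t + (\<Sum>k<n. g k t) = dstep (r n) t" for n t
  proof (induction n)
    case (Suc n)
    have "dstep (r 0) t + (\<Sum>k<Suc n. g k t) = (dstep (r 0) t + (\<Sum>k<n. g k t)) + g n t" by (simp add: algebra_simps)
    also have "\<dots> = dstep (r (Suc n)) t" unfolding Suc by (simp add: g_def)
    finally show ?case .
  qed simp
  have d0: "integrable ?N (dstep n)" for n
  proof -
    have "set_integrable lborel {0..p} (dstep n)"
    proof (subst set_integrable_lborel_iff[OF dstep_measurable], rule bounded_imp_absolutely_integrable[OF dstep_measurable])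
      show "(\<lambda>t. 1 + (norm (dstep n t))\<^sup>2) absolutely_integrable_on {0..p}"
        using dstep_norm_has_integral[of n]
        by (intro nonnegative_absolutely_integrable_1 integrable_add) (auto simp: integrable_on_def)
      show "norm (dstep n t) \<le> 1 + (norm (dstep n t))\<^sup>2" for t
        using zero_le_power2[of "norm (dstep n t) - 1/2"] by (simp add: power2_eq_square algebra_simps)
    qed
    then show ?thesis by (simp add: set_integrable_def integrable_restrict_space)
  qed
  have AEs': "AE t in ?N. summable (\<lambda>k. norm (g k t))" by (rule AEs)
  have hI: "integrable ?N h"
    unfolding h_def by (rule Bochner_Integration.integrable_add[OF d0 integrable_suminf[OF gi(1) AEs sg]])
  have lim: "AE t in ?N. (\<lambda>n. dstep (r n) t) \<longlonglongrightarrow> h t"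
    using AEs
  proof eventually_elim
    case (elim t)
    then have "(\<lambda>n. \<Sum>k<n. g k t) \<longlonglongrightarrow> (\<Sum>k. g k t)" by (rule summable_LIMSEQ[OF summable_norm_cancel])
    then have "(\<lambda>n. dstep (r 0) t + (\<Sum>k<n. g k t)) \<longlonglongrightarrow> dstep (r 0) t + (\<Sum>k. g k t)" by (intro tendsto_intros)
    then show ?case by (simp add: tele h_def)
  qed
  have L1: "(\<lambda>n. integral {a..b} (dstep (r n))) \<longlonglongrightarrow> integral {a..b} h" if ab: "0 \<le> a" "b \<le> p" for a b
  proof -
    let ?I = "indicat_real {a..b}"
    have abN: "{a..b} \<in> sets ?N"
      unfolding sets_restrict_space by (rule image_eqI[of _ _ "{a..b}"]) (use ab in auto)
    have Iab: "integral {a..b} f = (LINT t|?N. ?I t *\<^sub>R f t)" if "integrable ?N f" for f :: "real \<Rightarrow> complex"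
    proof -
      have "set_integrable lborel {0..p} f" using that by (simp add: set_integrable_def integrable_restrict_space)
      then have "set_integrable lborel {a..b} f" by (rule set_integrable_subset) (use ab in auto)
      then have "integral {a..b} f = (LBINT t:{a..b}. f t)" by (rule set_borel_integral_eq_integral(2)[symmetric])
      also have "\<dots> = (LBINT t. indicator {0..p} t *\<^sub>R (?I t *\<^sub>R f t))"
        unfolding set_lebesgue_integral_def
        by (rule Bochner_Integration.integral_cong) (use ab in \<open>auto simp: indicator_def\<close>)
      also have "\<dots> = (LINT t|?N. ?I t *\<^sub>R f t)"
        by (rule integral_restrict_space[symmetric]) simp
      finally show ?thesis .
    qed
    have gI: "integrable ?N (\<lambda>t. ?I t *\<^sub>R g k t)" for k
      by (rule integrable_mult_indicator[OF abN gi(1)])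
    have sI: "(\<lambda>k. LINT t|?N. ?I t *\<^sub>R g k t) sums (LINT t|?N. (\<Sum>k. ?I t *\<^sub>R g k t))"
    proof (rule sums_integral[OF gI])
      show "AE t in ?N. summable (\<lambda>k. norm (?I t *\<^sub>R g k t))"
        using AEs by eventually_elim (auto simp: indicator_def)
      show "summable (\<lambda>k. LINT t|?N. norm (?I t *\<^sub>R g k t))"
      proof (rule summable_comparison_test'[OF sg, of 0])
        fix k
        have "(LINT t|?N. norm (?I t *\<^sub>R g k t)) \<le> (LINT t|?N. norm (g k t))"
          using gI[of k] gi(1)[of k] by (intro integral_mono integrable_norm) (auto simp: indicator_def)
        then show "norm (LINT t|?N. norm (?I t *\<^sub>R g k t)) \<le> (LINT t|?N. norm (g k t))" by simp
      qed
    qed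
    have "(\<lambda>n. (LINT t|?N. ?I t *\<^sub>R dstep (r 0) t) + (\<Sum>k<n. LINT t|?N. ?I t *\<^sub>R g k t)) \<longlonglongrightarrow>
      (LINT t|?N. ?I t *\<^sub>R dstep (r 0) t) + (LINT t|?N. (\<Sum>k. ?I t *\<^sub>R g k t))"
      using sI unfolding sums_def by (intro tendsto_intros)
    moreover have "(LINT t|?N. ?I t *\<^sub>R dstep (r 0) t) + (\<Sum>k<n. LINT t|?N. ?I t *\<^sub>R g k t) = (LINT t|?N. ?I t *\<^sub>R dstep (r n) t)" for n
    proof -
      have d: "integrable ?N (\<lambda>t. ?I t *\<^sub>R dstep (r 0) t)"
        by (rule integrable_mult_indicator[OF abN d0[of "r 0"]])
      have "(LINT t|?N. ?I t *\<^sub>R dstep (r n) t) = (LINT t|?N. ?I t *\<^sub>R dstep (r 0) t + (\<Sum>k<n. ?I t *\<^sub>R g k t))"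
        by (rule Bochner_Integration.integral_cong[OF HOL.refl]) (simp only: tele[of _ n, symmetric] scaleR_add_right scaleR_sum_right)
      also have "\<dots> = (LINT t|?N. ?I t *\<^sub>R dstep (r 0) t) + (LINT t|?N. (\<Sum>k<n. ?I t *\<^sub>R g k t))"
        by (rule Bochner_Integration.integral_add[OF d Bochner_Integration.integrable_sum]) (rule gI)
      also have "(LINT t|?N. (\<Sum>k<n. ?I t *\<^sub>R g k t)) = (\<Sum>k<n. LINT t|?N. ?I t *\<^sub>R g k t)"
        by (rule Bochner_Integration.integral_sum) (rule gI)
      finally show ?thesis ..
    qed
    moreover have "(LINT t|?N. ?I t *\<^sub>R dstep (r 0) t) + (LINT t|?N. (\<Sum>k. ?I t *\<^sub>R g k t)) = (LINT t|?N. ?I t *\<^sub>R h t)"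
    proof -
      have d: "integrable ?N (\<lambda>t. ?I t *\<^sub>R dstep (r 0) t)"
        by (rule integrable_mult_indicator[OF abN d0[of "r 0"]])
      have hh: "integrable ?N (\<lambda>t. ?I t *\<^sub>R h t)"
        by (rule integrable_mult_indicator[OF abN hI])
      have e: "(\<Sum>k. ?I t *\<^sub>R g k t) = ?I t *\<^sub>R h t - ?I t *\<^sub>R dstep (r 0) t" for t
        by (cases "t \<in> {a..b}") (auto simp: h_def)
      show ?thesis unfolding e using d hh by simp
    qed
    ultimately show ?thesis using Iab[OF d0] Iab[OF hI] by simp
  qed
  \<comment> \<open>At a dyadic point the integrals of the step functions no longer change once the
    mesh is fine enough, so the limit is exact there. Continuity then carries the identity to all
    points.\<close>
  have dy: "integral {0..real k * mesh n} h = T (real k * mesh n) - T 0" if k: "k \<le> 2 ^ n" for k n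
  proof -
    have kp: "real k * mesh n \<le> p"
    proof -
      have "real k * mesh n \<le> real (2 ^ n) * mesh n" using k mesh_pos[of n] by (intro mult_right_mono) linarith+
      then show ?thesis by (simp only: mesh_total)
    qed
    have "eventually (\<lambda>m. integral {0..real k * mesh n} (dstep (r m)) = T (real k * mesh n) - T 0) sequentially"
      using eventually_ge_at_top[of n]
    proof eventually_elim
      case (elim m)
      then have "n \<le> r m" using rk[of m] by simp
      from has_integral_combine_pieces[OF less_imp_le[OF mesh_pos] dstep_has_integral[OF this], of k]
      have "(dstep (r m) has_integral (\<Sum>j<k. T (real (Suc j) * mesh n) - T (real j * mesh n))) {0..real k * mesh n}" .
      moreover have "(\<Sum>j<k. T (real (Suc j) * mesh n) - T (real j * mesh n)) = T (real k * mesh n) - T 0"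
        using sum_lessThan_telescope[of "\<lambda>j. T (real j * mesh n)" k] by simp
      ultimately show ?case using integral_unique by metis
    qed
    from tendsto_unique[OF _ tendsto_eventually[OF this] L1[of 0 "real k * mesh n"]] kp show ?thesis by simp
  qed
  have si: "set_integrable lborel {0..p} h" using hI by (simp add: set_integrable_def integrable_restrict_space)
  have hint: "h integrable_on {0..p}" by (rule set_borel_integral_eq_integral(1)[OF si])
  have cI: "continuous_on {0..p} (\<lambda>t. integral {0..t} h)" by (rule indefinite_integral_continuous_1[OF hint])
  have Teq: "T t = T 0 + integral {0..t} h" if t: "t \<in> {0..p}" for t
  proof -
    define x where "x = (\<lambda>n. real (nat \<lfloor>t / mesh n\<rfloor>) * mesh n)"
    have fl: "real (nat \<lfloor>t / mesh n\<rfloor>) = of_int \<lfloor>t / mesh n\<rfloor>" for n using t mesh_pos[of n] by simp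
    have x1: "x n \<le> t" "t < x n + mesh n" for n
    proof -
      have "of_int \<lfloor>t / mesh n\<rfloor> \<le> t / mesh n" "t / mesh n < of_int \<lfloor>t / mesh n\<rfloor> + 1" by linarith+
      then have "of_int \<lfloor>t / mesh n\<rfloor> * mesh n \<le> t" "t < (of_int \<lfloor>t / mesh n\<rfloor> + 1) * mesh n"
        using mesh_pos[of n] by (simp_all only: pos_le_divide_eq pos_divide_less_eq)
      then show "x n \<le> t" "t < x n + mesh n" by (simp_all add: x_def fl algebra_simps)
    qed
    have x0: "0 \<le> x n" for n using mesh_pos[of n] by (simp add: x_def)
    have "(\<lambda>n. mesh n) \<longlonglongrightarrow> 0"
    proof -
      have "(\<lambda>n. (1 / 2 :: real) ^ n) \<longlonglongrightarrow> 0" by (rule LIMSEQ_power_zero) simp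
      from tendsto_mult_right_zero[OF this, of p] show ?thesis
        by (simp add: mesh_def[abs_def] power_one_over)
    qed
    then have "(\<lambda>n. t - mesh n) \<longlonglongrightarrow> t - 0" by (intro tendsto_intros)
    then have xt: "x \<longlonglongrightarrow> t"
      by (intro tendsto_sandwich[of "\<lambda>n. t - mesh n" x _ "\<lambda>n. t"])
         (use x1 in \<open>auto intro!: always_eventually simp: less_imp_le algebra_simps\<close>)
    have xin: "x n \<in> {0..p}" for n using x0[of n] x1(1)[of n] t by auto
    have lt: "(\<lambda>n. f (x n)) \<longlonglongrightarrow> f t" if "continuous_on {0..p} f" for f :: "real \<Rightarrow> complex"
      using continuous_on_tendsto_compose[OF that xt t] xin by auto
    have k2: "nat \<lfloor>t / mesh n\<rfloor> \<le> 2 ^ n" for n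
    proof -
      have "t / mesh n \<le> p / mesh n" using t mesh_pos[of n] by (intro divide_right_mono) auto
      also have "p / mesh n = 2 ^ n" using p by (simp add: mesh_def)
      finally have "of_int \<lfloor>t / mesh n\<rfloor> \<le> (2 ^ n :: real)" by linarith
      then have "real (nat \<lfloor>t / mesh n\<rfloor>) \<le> real (2 ^ n)" unfolding fl by simp
      then show ?thesis by (simp only: of_nat_le_iff)
    qed
    have "integral {0..x n} h = T (x n) - T 0" for n unfolding x_def by (rule dy[OF k2])
    then have "(\<lambda>n. T (x n) - T 0) \<longlonglongrightarrow> integral {0..t} h" using lt[OF cI] by simp
    moreover have "(\<lambda>n. T (x n) - T 0) \<longlonglongrightarrow> T t - T 0" by (intro tendsto_intros lt[OF cT])
    ultimately show ?thesis using LIMSEQ_unique by fastforce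
  qed
  have dens: "has_density p T h" by (rule has_densityI[OF hint Teq])
  \<comment> \<open>Fatou bounds the energy of the limit by the energies of the step
    functions.\<close>
  have fat: "(\<integral>\<^sup>+t. ennreal ((norm (h t))\<^sup>2) \<partial>?N) \<le> ennreal M"
  proof -
    have "(\<integral>\<^sup>+t. ennreal ((norm (h t))\<^sup>2) \<partial>?N) \<le> (\<integral>\<^sup>+t. liminf (\<lambda>n. ennreal ((norm (dstep (r n) t))\<^sup>2)) \<partial>?N)"
    proof (rule nn_integral_mono_AE)
      show "AE t in ?N. ennreal ((norm (h t))\<^sup>2) \<le> liminf (\<lambda>n. ennreal ((norm (dstep (r n) t))\<^sup>2))"
        using lim
      proof eventually_elim
        case (elim t)
        then have "(\<lambda>n. ennreal ((norm (dstep (r n) t))\<^sup>2)) \<longlonglongrightarrow> ennreal ((norm (h t))\<^sup>2)"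
          by (intro tendsto_intros)
        then show ?case using lim_imp_Liminf[OF trivial_limit_sequentially] by fastforce
      qed
    qed
    also have "\<dots> \<le> liminf (\<lambda>n. \<integral>\<^sup>+t. ennreal ((norm (dstep (r n) t))\<^sup>2) \<partial>?N)"
      by (rule nn_integral_liminf) (auto intro!: measurable_restrict_space1)
    also have "\<dots> = liminf (\<lambda>n. ennreal (denergy (r n)))"
      by (subst nonneg_has_integral_lborel(3)[OF _ _ dstep_norm_has_integral]) auto
    also have "\<dots> \<le> limsup (\<lambda>n. ennreal (denergy (r n)))" by (rule Liminf_le_Limsup) simp
    also have "\<dots> \<le> ennreal M"
      by (rule Limsup_bounded) (auto intro!: always_eventually ennreal_leI M)
    finally show ?thesis .
  qed
  have M0: "0 \<le> M" using M[of 0] has_integral_nonneg[OF dstep_norm_has_integral[of 0]] by simp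
  have i2: "integrable ?N (\<lambda>t. (norm (h t))\<^sup>2)"
    by (rule integrableI_nonneg) (use fat in \<open>auto intro!: measurable_restrict_space1 simp: le_less_trans[OF fat]\<close>)
  have si2: "set_integrable lborel {0..p} (\<lambda>t. (norm (h t))\<^sup>2)"
    using i2 by (simp add: set_integrable_def integrable_restrict_space)
  have "ennreal (LINT t|?N. (norm (h t))\<^sup>2) \<le> ennreal M"
    using fat nn_integral_eq_integral[OF i2] by simp
  then have "(LINT t|?N. (norm (h t))\<^sup>2) \<le> M" using M0 by (simp add: ennreal_le_iff)
  then have "integral {0..p} (\<lambda>t. (norm (h t))\<^sup>2) \<le> M"
    using set_borel_integral_eq_integral(2)[OF si2] by (simp add: set_lebesgue_integral_def integral_restrict_space)
  then show ?thesis using hm set_borel_integral_eq_integral(1)[OF si2] dens by blast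
qed

end

section \<open>Unit speed curves of finite bending energy\<close>

lemma has_integral_stretch_Icc:
  fixes f :: "real \<Rightarrow> 'b::real_normed_vector"
  assumes "(f has_integral I) {m * a..m * b}" "0 < m"
  shows "((\<lambda>x. f (m * x)) has_integral (1 / m) *\<^sub>R I) {a..b}"
proof -
  have "inverse m * (m * a) = a" "inverse m * (m * b) = b" using assms(2) by auto
  moreover have "((\<lambda>x. f (m * x)) has_integral I /\<^sub>R m) {inverse m * (m * a)..inverse m * (m * b)}"
    using has_integral_affinity'[of f I "m * a" "m * b" m 0] assms by simp
  ultimately show ?thesis by (simp only: inverse_eq_divide)
qed

lemma has_integral_reflect_Icc:
  fixes f :: "real \<Rightarrow> 'b::real_normed_vector"
  assumes "(f has_integral I) {k - b..k - a}"
  shows "((\<lambda>x. f (k - x)) has_integral I) {a..b}"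
proof -
  have "((\<lambda>x. f (- x)) has_integral I) {- (k - a)..- (k - b)}"
    by (rule has_integral_reflect_lemma_real[OF assms])
  from has_integral_shift_real_ivl[OF this, of "- k"] show ?thesis by simp
qed

text \<open>The integral of the squared distance between \<open>h\<close> and its mean
  \<open>m\<close> is nonnegative; expanding it gives the inequality.\<close>

lemma has_density_cauchy_schwarz:
  assumes f: "has_density p f h" and h: "(\<lambda>t. (norm (h t))\<^sup>2) integrable_on {0..p}" and ab: "0 \<le> a" "a \<le> b" "b \<le> p"
  shows "(norm (f b - f a))\<^sup>2 \<le> (b - a) * integral {a..b} (\<lambda>t. (norm (h t))\<^sup>2)"
proof (cases "a = b")
  case False
  define m where "m = (1 / (b - a)) *\<^sub>R (f b - f a)"
  have "(\<lambda>t. (norm (h t))\<^sup>2) integrable_on {a..b}"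
    by (rule integrable_subinterval_real[OF h]) (use ab in auto)
  from integrable_integral[OF this]
  have 1: "((\<lambda>t. (norm (h t))\<^sup>2) has_integral integral {a..b} (\<lambda>t. (norm (h t))\<^sup>2)) {a..b}" (is "(_ has_integral ?E) _") .
  have 2: "((\<lambda>t. inner (h t) m) has_integral inner (f b - f a) m) {a..b}"
    using has_integral_linear[OF has_densityD[OF f ab] bounded_linear_inner_left[of m]] by (simp add: o_def)
  have "((\<lambda>t. (norm (h t))\<^sup>2 - 2 * inner (h t) m + (norm m)\<^sup>2) has_integral ?E - 2 * inner (f b - f a) m + (b - a) * (norm m)\<^sup>2) {a..b}"
    using has_integral_const_real[of "(norm m)\<^sup>2" a b] ab
    by (intro has_integral_add has_integral_diff has_integral_mult_right 1 2) auto
  moreover have "(norm (h t))\<^sup>2 - 2 * inner (h t) m + (norm m)\<^sup>2 = (norm (h t - m))\<^sup>2" for t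
    by (simp add: power2_norm_eq_inner inner_diff inner_commute algebra_simps)
  ultimately have "0 \<le> ?E - 2 * inner (f b - f a) m + (b - a) * (norm m)\<^sup>2"
    using has_integral_nonneg[of "\<lambda>t. (norm (h t - m))\<^sup>2"] by force
  moreover have "inner (f b - f a) m = (norm (f b - f a))\<^sup>2 / (b - a)" "(norm m)\<^sup>2 = (norm (f b - f a))\<^sup>2 / (b - a)\<^sup>2"
    using False ab by (simp_all add: m_def power2_norm_eq_inner[symmetric] power_divide)
  moreover have "(b - a) * ((norm (f b - f a))\<^sup>2 / (b - a)\<^sup>2) = (norm (f b - f a))\<^sup>2 / (b - a)"
    using False ab by (simp add: power2_eq_square)
  ultimately have "(norm (f b - f a))\<^sup>2 / (b - a) \<le> ?E" by simp
  moreover have "0 < b - a" using False ab by simp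
  ultimately show ?thesis by (simp add: pos_divide_le_eq mult.commute)
qed simp

text \<open>Unit speed makes \<open>h\<close> the curvature vector, so \<open>energy\<close> is the
  bending energy. Tangent and density are carried as data instead of being chosen anew for each
  curve.\<close>

definition ucurve :: "real \<Rightarrow> (real \<Rightarrow> complex) \<Rightarrow> (real \<Rightarrow> complex) \<Rightarrow> (real \<Rightarrow> complex) \<Rightarrow> bool" where
  "ucurve L c T h \<longleftrightarrow> 0 < L \<and> sobolev2 L c T h \<and> (\<forall>t. norm (T t) = 1)"

definition energy :: "real \<Rightarrow> (real \<Rightarrow> complex) \<Rightarrow> real" where
  "energy L h = integral {0..L} (\<lambda>t. (norm (h t))\<^sup>2)"

lemma ucurveD:
  assumes "ucurve L c T h"
  shows "0 < L" "c (t + L) = c t" "T (t + L) = T t" "(c has_vector_derivative T t) (at t)" "norm (T t) = 1"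
    "h \<in> L2_circle L" "has_density L T h" "has_density L c T" "continuous_on UNIV c" "continuous_on UNIV T"
    "sobolev2 L c T h"
proof -
  have s: "0 < L" "\<And>t. c (t + L) = c t" "\<And>t. T (t + L) = T t" "\<And>t. (c has_vector_derivative T t) (at t)" "\<And>t. norm (T t) = 1"
    "h \<in> L2_circle L" "has_density L T h" "sobolev2 L c T h"
    using assms by (auto simp: ucurve_def sobolev2_def)
  then show "0 < L" "c (t + L) = c t" "T (t + L) = T t" "(c has_vector_derivative T t) (at t)" "norm (T t) = 1"
    "h \<in> L2_circle L" "has_density L T h" "sobolev2 L c T h" by blast+
  show d: "has_density L c T" by (rule antiderivative_has_density[OF s(4)])
  show "continuous_on UNIV c" by (rule has_density_continuous_UNIV[OF s(1) d s(2)])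
  show "continuous_on UNIV T" by (rule has_density_continuous_UNIV[OF s(1,7,3)])
qed

text \<open>Data on one period whose end values match give a closed curve. Differentiability across
  the seam comes for free: the extended tangent is continuous and periodic, and the extension of
  \<open>c\<close> differs by a constant from an antiderivative of it.\<close>

lemma ucurve_build:
  assumes L: "0 < L" and T: "continuous_on {0..L} T" "T 0 = T L" "\<And>t. t \<in> {0..L} \<Longrightarrow> norm (T t) = 1"
    and c: "has_density L c T" "c 0 = c L"
    and h: "h \<in> borel_measurable borel" "(\<lambda>t. (norm (h t))\<^sup>2) integrable_on {0..L}" "has_density L T h"
  shows "ucurve L (per L c) (per L T) (per L h)" "energy L (per L h) = energy L h"
proof -
  have cT: "continuous_on UNIV (per L T)" by (rule per_continuous[OF L T(1,2)])
  have pT: "per L T (t + L) = per L T t" for t by (rule per_periodic[OF L])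
  have eT: "per L T t = T t" if "t \<in> {0..L}" for t by (rule per_eq[OF L T(2) that])
  obtain F where F: "\<And>t. (F has_vector_derivative per L T t) (at t)" using continuous_antiderivative[OF cT] by blast
  have dF: "has_density L F (per L T)" by (rule antiderivative_has_density[OF F])
  have Fc: "F b - F a = c b - c a" if ab: "0 \<le> a" "a \<le> b" "b \<le> L" for a b
    using has_integral_unique[OF has_densityD[OF dF ab] per_has_integral[OF L ab(1,3) has_densityD[OF c(1) ab]]] .
  have "integral {0..L} (per L T) = 0"
    using integral_unique[OF has_densityD[OF dF, of 0 L]] Fc[of 0 L] L c(2) by simp
  then have pF: "F (t + L) = F t" for t by (intro periodic_antiderivative[OF L cT pT _ F])
  have cF: "per L c t = F t + (c 0 - F 0)" for t
  proof -
    obtain k s where t: "t = s + of_int k * L" "0 \<le> s" "s < L" using periodic_reduce[OF L] .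
    have "per L c t = per L c s" unfolding t(1)
      by (rule periodic_int[where f = "per L c"]) (rule per_periodic[OF L])
    also have "\<dots> = c s" using per_eq_Ico[OF L t(2,3)] .
    also have "\<dots> = F s + (c 0 - F 0)" using Fc[of 0 s] t by (simp add: algebra_simps)
    also have "F s = F t" unfolding t(1) by (rule periodic_int[where f = F, symmetric]) (rule pF)
    finally show ?thesis .
  qed
  have dc: "(per L c has_vector_derivative per L T t) (at t)" for t
    unfolding cF[abs_def] using has_vector_derivative_add[OF F[of t] has_vector_derivative_const[of "c 0 - F 0"]] by simp
  have dT: "has_density L (per L T) (per L h)"
    unfolding has_density_def
  proof (intro allI impI)
    fix a b assume ab: "0 \<le> a" "a \<le> b" "b \<le> L"
    show "(per L h has_integral per L T b - per L T a) {a..b}"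
      using per_has_integral[OF L ab(1,3) has_densityD[OF h(3) ab]] eT[of a] eT[of b] ab by simp
  qed
  have nT: "norm (per L T t) = 1" for t
  proof -
    obtain k s where t: "t = s + of_int k * L" "0 \<le> s" "s < L" using periodic_reduce[OF L] .
    have "per L T t = per L T s" unfolding t(1)
      by (rule periodic_int[where f = "per L T"]) (rule pT)
    then show ?thesis using eT[of s] T(3)[of s] t by simp
  qed
  show "ucurve L (per L c) (per L T) (per L h)"
    unfolding ucurve_def sobolev2_def using L per_periodic[OF L] dc per_L2[OF L h(1,2)] dT nT by blast
  show "energy L (per L h) = energy L h"
    unfolding energy_def
    by (rule integral_spike[of "{L}"]) (auto simp: per_eq_ne[OF L])
qed

lemma bending_energy_eq:
  assumes L: "0 < L" "arc_length \<gamma> 1 = L" and s: "sobolev2 L (arc_length_param \<gamma>) T h"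
  shows "bending_energy \<gamma> = energy L h"
proof -
  let ?c = "arc_length_param \<gamma>"
  have w: "weak_deriv2_L2 L ?c h" by (rule sobolev2_imp_weak[OF L(1) s])
  define h' where "h' = (SOME h. weak_deriv2_L2 L ?c h)"
  have w': "weak_deriv2_L2 L ?c h'" unfolding h'_def by (rule someI[of "weak_deriv2_L2 L ?c", OF w])
  have v: "\<And>t. (?c has_vector_derivative T t) (at t)" "\<And>t. ?c (t + L) = ?c t" using s by (auto simp: sobolev2_def)
  have cc: "continuous_on UNIV ?c" by (rule has_density_continuous_UNIV[OF L(1) antiderivative_has_density[OF v(1)] v(2)])
  obtain T' where s': "sobolev2 L ?c T' h'" using weak_imp_sobolev2[OF L(1) cc w'] by blast
  have hL: "h \<in> L2_circle L" using s by (simp add: sobolev2_def)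
  have "bending_energy \<gamma> = (LBINT t:{0..L}. (norm (h' t))\<^sup>2)"
    unfolding bending_energy_def Let_def L(2) h'_def ..
  also have "\<dots> = (LBINT t:{0..L}. (norm (h t))\<^sup>2)" by (rule sobolev2_energy_unique(2)[OF L(1) s' s])
  also have "\<dots> = energy L h" unfolding energy_def by (rule L2_circleD(5)[OF hL])
  finally show ?thesis .
qed

section \<open>Passing between curves on the circle and unit speed curves\<close>

lemma arc_length_antiderivative:
  assumes v: "\<And>t. (\<gamma> has_vector_derivative v t) (at t)" "continuous_on UNIV v"
  shows "arc_length \<gamma> 0 = 0" "(arc_length \<gamma> has_real_derivative norm (v t)) (at t)"
proof -
  have nv: "continuous_on UNIV (\<lambda>t. norm (v t))" by (intro continuous_intros v)
  obtain F where F: "\<And>t. (F has_vector_derivative norm (v t)) (at t)" using continuous_antiderivative[OF nv] by blast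
  have vd: "vector_derivative \<gamma> (at t) = v t" for t by (rule vector_derivative_at[OF v(1)])
  have al: "arc_length \<gamma> t = F t - F 0" for t
    unfolding arc_length_def vd zero_ereal_def
    by (rule interval_integral_FTC_finite) (auto intro!: continuous_on_subset[OF nv] has_vector_derivative_at_within[OF F])
  show "arc_length \<gamma> 0 = 0" by (simp add: al)
  show "(arc_length \<gamma> has_real_derivative norm (v t)) (at t)"
    using has_vector_derivative_diff[OF F[of t] has_vector_derivative_const[of "F 0"]]
    by (simp add: al[abs_def] has_real_derivative_iff_has_vector_derivative)
qed

text \<open>The arc length of \<open>\<eta>\<close> is \<open>L * t\<close>, so its arc length
  parametrization is \<open>c\<close> itself, and the density only has to be rescaled.\<close>

lemma ucurve_regular:
  assumes u: "ucurve L c T h"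
  defines "\<eta> \<equiv> \<lambda>t. c (L * t)"
  shows "regular_curve \<eta>" "bending_energy \<eta> = energy L h" "vector_derivative \<eta> (at t) = L *\<^sub>R T (L * t)"
    "range \<eta> = range c" "continuous_on UNIV (\<lambda>t. L *\<^sub>R T (L * t))" "(\<eta> has_vector_derivative L *\<^sub>R T (L * t)) (at t)"
proof -
  note u' = ucurveD[OF u]
  show d: "(\<eta> has_vector_derivative L *\<^sub>R T (L * t)) (at t)" for t
  proof -
    have "((\<lambda>t. L * t) has_vector_derivative L) (at t)"
      by (auto intro!: derivative_eq_intros simp flip: has_real_derivative_iff_has_vector_derivative)
    from vector_diff_chain_at[OF this u'(4)[of "L * t"]] show ?thesis by (simp add: o_def \<eta>_def)
  qed
  show cv: "continuous_on UNIV (\<lambda>t. L *\<^sub>R T (L * t))"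
    by (intro continuous_intros continuous_on_compose2[OF u'(10)]) auto
  show vd: "vector_derivative \<eta> (at t) = L *\<^sub>R T (L * t)" for t by (rule vector_derivative_at[OF d])
  have p\<eta>: "\<eta> (t + 1) = \<eta> t" "L *\<^sub>R T (L * (t + 1)) = L *\<^sub>R T (L * t)" for t
    using u'(2,3)[of "L * t"] by (simp_all add: \<eta>_def algebra_simps)
  have c\<eta>: "continuous_on UNIV \<eta>"
    unfolding \<eta>_def by (intro continuous_on_compose2[OF u'(9)] continuous_intros) auto
  note [measurable] = L2_circleD(1)[OF u'(6)]
  have h2: "((\<lambda>t. (norm (h t))\<^sup>2) has_integral energy L h) {0..L}"
    using L2_circleD(3)[OF u'(6)] set_lebesgue_integral_eq_integral(1) unfolding energy_def by blast
  have "((\<lambda>x. (norm (h (L * x)))\<^sup>2) has_integral (1 / L) *\<^sub>R energy L h) {0..1}"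
    by (rule has_integral_stretch_Icc[of "\<lambda>t. (norm (h t))\<^sup>2"]) (use h2 u'(1) in auto)
  from has_integral_mult_right[OF this, of "(L\<^sup>2)\<^sup>2"]
  have "(\<lambda>x. (norm (L\<^sup>2 *\<^sub>R h (L * x)))\<^sup>2) integrable_on {0..1}"
    by (auto simp: power_mult_distrib integrable_on_def)
  moreover have "h (L * (t + 1)) = h (L * t)" for t
    using L2_circleD(2)[OF u'(6), of "L * t"] by (simp add: distrib_left)
  ultimately have hL: "(\<lambda>t. L\<^sup>2 *\<^sub>R h (L * t)) \<in> L2_circle 1"
    by (intro L2_circleI) auto
  have hd: "has_density 1 (\<lambda>t. L *\<^sub>R T (L * t)) (\<lambda>t. L\<^sup>2 *\<^sub>R h (L * t))"
    unfolding has_density_def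
  proof (intro allI impI)
    fix a b :: real assume ab: "0 \<le> a" "a \<le> b" "b \<le> 1"
    have "(h has_integral T (L * b) - T (L * a)) {L * a..L * b}"
      by (rule has_densityD[OF u'(7)]) (use ab u'(1) in auto)
    from has_integral_cmul[OF has_integral_stretch_Icc[OF this u'(1)], of "L\<^sup>2"]
    show "((\<lambda>t. L\<^sup>2 *\<^sub>R h (L * t)) has_integral L *\<^sub>R T (L * b) - L *\<^sub>R T (L * a)) {a..b}"
      using u'(1) by (simp add: power2_eq_square scaleR_diff_right)
  qed
  have "sobolev2 1 \<eta> (\<lambda>t. L *\<^sub>R T (L * t)) (\<lambda>t. L\<^sup>2 *\<^sub>R h (L * t))"
    unfolding sobolev2_def using p\<eta> d hL hd by blast
  then have "weak_deriv2_L2 1 \<eta> (\<lambda>t. L\<^sup>2 *\<^sub>R h (L * t))" by (rule sobolev2_imp_weak[rotated]) simp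
  then show "regular_curve \<eta>"
    unfolding regular_curve_def vd using c\<eta> u'(1,5) by auto
  have "((\<lambda>t. arc_length \<eta> t - L * t) has_derivative (\<lambda>h. 0)) (at t within UNIV)" for t
  proof -
    have "((\<lambda>t. arc_length \<eta> t - L * t) has_real_derivative norm (L *\<^sub>R T (L * t)) - L) (at t)"
      by (auto intro!: derivative_eq_intros arc_length_antiderivative(2)[OF d cv])
    then show ?thesis using u'(1,5) by (simp add: has_field_derivative_def lambda_zero)
  qed
  from has_derivative_zero_constant[OF convex_UNIV this]
  obtain k where k: "\<And>t. arc_length \<eta> t - L * t = k" by auto
  have "k = 0" using k[of 0] arc_length_antiderivative(1)[OF d cv] by simp
  then have al: "arc_length \<eta> t = L * t" for t using k[of t] by simp
  have "inv (arc_length \<eta>) = (\<lambda>s. s / L)"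
    by (rule inv_equality) (use u'(1) al in auto)
  then have alp: "arc_length_param \<eta> = c"
    using u'(1) by (auto simp: arc_length_param_def \<eta>_def)
  show "bending_energy \<eta> = energy L h"
    by (rule bending_energy_eq[OF u'(1) _ u'(11)[folded alp]]) (simp add: al)
  have "surj (\<lambda>t. L * t)" using u'(1) by (intro surjI[of _ "\<lambda>s. s / L"]) auto
  then show "range \<eta> = range c" unfolding \<eta>_def by (metis image_image)
qed

text \<open>The speed is bounded below by some \<open>m > 0\<close> on a period, so the inverse
  \<open>\<sigma>\<close> of the arc length is Lipschitz. The unit tangent is \<open>n\<close>
  composed with \<open>\<sigma>\<close>; rather than differentiating this composition, its dyadic
  energies are bounded by the integral of the norm of \<open>k\<close> squared, and
  \<open>riesz_criterion\<close> delivers the density.\<close>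

lemma regular_ucurve:
  assumes "regular_curve \<gamma>"
  shows "\<exists>L T h. ucurve L (arc_length_param \<gamma>) T h \<and> bending_energy \<gamma> = energy L h
     \<and> strict_mono (arc_length \<gamma>) \<and> arc_length \<gamma> 0 = 0 \<and> (\<forall>t. arc_length \<gamma> (t + 1) = arc_length \<gamma> t + L)
     \<and> surj (arc_length \<gamma>) \<and> (\<forall>t. \<gamma> t = arc_length_param \<gamma> (arc_length \<gamma> t))
     \<and> (\<forall>t. \<exists>k>0. vector_derivative \<gamma> (at t) = k *\<^sub>R T (arc_length \<gamma> t))"
proof -
  obtain k where cg: "continuous_on UNIV \<gamma>" and w: "weak_deriv2_L2 1 \<gamma> k" and pos: "\<And>t. norm (vector_derivative \<gamma> (at t)) > 0"
    using assms by (auto simp: regular_curve_def)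
  obtain v where s: "sobolev2 1 \<gamma> v k" using weak_imp_sobolev2[OF _ cg w] by auto
  then have per: "\<And>t. \<gamma> (t + 1) = \<gamma> t" "\<And>t. v (t + 1) = v t" and dv: "\<And>t. (\<gamma> has_vector_derivative v t) (at t)"
    and kL: "k \<in> L2_circle 1" and kd: "has_density 1 v k" by (auto simp: sobolev2_def)
  have cv: "continuous_on UNIV v" by (rule has_density_continuous_UNIV[OF _ kd per(2)]) simp
  have vd: "vector_derivative \<gamma> (at t) = v t" for t by (rule vector_derivative_at[OF dv])
  have vpos: "0 < norm (v t)" for t using pos[of t] by (simp add: vd)
  have "continuous_on {0..1} (\<lambda>t. norm (v t))" by (intro continuous_intros continuous_on_subset[OF cv]) auto
  moreover have "compact {0..1::real}" "{0..1::real} \<noteq> {}" by auto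
  ultimately obtain t0 where t0: "\<forall>t\<in>{0..1}. norm (v t0) \<le> norm (v t)"
    using continuous_attains_inf by blast
  define m where "m = norm (v t0)"
  have m0: "0 < m" using vpos[of t0] by (simp add: m_def)
  have mv: "m \<le> norm (v t)" for t
  proof -
    obtain i r where t: "t = r + of_int i * 1" "0 \<le> r" "r < (1::real)" using periodic_reduce[OF zero_less_one, of t] .
    have "v t = v r" unfolding t(1) by (rule periodic_int[where f = v]) (rule per)
    then show ?thesis using t0 t by (simp add: m_def)
  qed
  let ?l = "arc_length \<gamma>"
  note l0 = arc_length_antiderivative(1)[OF dv cv] and ld = arc_length_antiderivative(2)[OF dv cv]
  have linc: "m * (b - a) \<le> ?l b - ?l a" if "a \<le> b" for a b
  proof (cases "a = b")
    case False
    then have "a < b" using that by simp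
    from MVT2[OF this ld]
    obtain z where "a < z" "z < b" "?l b - ?l a = (b - a) * norm (v z)" by blast
    then show ?thesis using mv[of z] that by (simp add: mult.commute mult_right_mono)
  qed simp
  have sm: "strict_mono ?l"
  proof (rule strict_monoI)
    fix a b :: real assume "a < b"
    then have "0 < m * (b - a)" using m0 by simp
    then show "?l a < ?l b" using linc[of a b] \<open>a < b\<close> by linarith
  qed
  have cl: "isCont ?l t" for t using ld DERIV_isCont by blast
  have surj: "surj ?l"
  unfolding surj_def
  proof
    fix y
    define b where "b = \<bar>y\<bar> / m"
    have b: "0 \<le> b" "m * b = \<bar>y\<bar>" using m0 by (auto simp: b_def)
    have "?l (- b) \<le> y" "y \<le> ?l b" using linc[of "- b" 0] linc[of 0 b] b l0 by auto
    then have "\<exists>x. - b \<le> x \<and> x \<le> b \<and> ?l x = y" using IVT[of ?l "- b" y b] cl b by auto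
    then show "\<exists>x. y = ?l x" by blast
  qed
  define L where "L = ?l 1"
  have Lpos: "0 < L" using linc[of 0 1] m0 l0 by (simp add: L_def)
  have shift: "?l (t + 1) = ?l t + L" for t
  proof -
    have "((\<lambda>t. ?l (t + 1) - ?l t) has_derivative (\<lambda>h. 0)) (at t within UNIV)" for t
    proof -
      have "((\<lambda>t. ?l (t + 1)) has_real_derivative norm (v (t + 1))) (at t)"
        using DERIV_shift[THEN iffD1, OF ld[of "t + 1"]] .
      from DERIV_diff[OF this ld[of t]] show ?thesis by (simp add: has_field_derivative_def per lambda_zero)
    qed
    from has_derivative_zero_constant[OF convex_UNIV this]
    obtain c where "\<And>t. ?l (t + 1) - ?l t = c" by auto
    from this[of t] this[of 0] show ?thesis using l0 by (simp add: L_def algebra_simps)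
  qed
  define \<sigma> where "\<sigma> = inv ?l"
  have inj: "inj ?l" using sm by (rule strict_mono_imp_inj_on)
  have ls: "?l (\<sigma> s) = s" for s unfolding \<sigma>_def by (rule surj_f_inv_f[OF surj])
  have sl: "\<sigma> (?l t) = t" for t unfolding \<sigma>_def by (rule inv_f_f[OF inj])
  have smono: "\<sigma> s \<le> \<sigma> t" if "s \<le> t" for s t
    using that ls strict_mono_less[OF sm] by (metis linorder_not_less)
  have slip: "m * (\<sigma> t - \<sigma> s) \<le> t - s" if "s \<le> t" for s t using linc[OF smono[OF that]] by (simp add: ls)
  have cs: "isCont \<sigma> s" for s
  proof -
    have "(1 / m)-lipschitz_on UNIV \<sigma>"
    proof (rule lipschitz_onI)
      fix s t
      have "m * \<bar>\<sigma> s - \<sigma> t\<bar> \<le> \<bar>s - t\<bar>"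
        using slip[of s t] slip[of t s] smono[of s t] smono[of t s] by (cases "s \<le> t") auto
      then show "dist (\<sigma> s) (\<sigma> t) \<le> 1 / m * dist s t" using m0 by (simp add: dist_real_def field_simps)
    qed (use m0 in simp)
    then show ?thesis using lipschitz_on_continuous_on continuous_on_eq_continuous_at[of UNIV \<sigma>] by blast
  qed
  have sd: "(\<sigma> has_real_derivative inverse (norm (v (\<sigma> s)))) (at s)" for s
    by (rule DERIV_inverse_function[where f = ?l and g = \<sigma> and a = "s - 1" and b = "s + 1", OF ld]) (use vpos[of "\<sigma> s"] ls cs in auto)
  have sper: "\<sigma> (s + L) = \<sigma> s + 1" for s using shift[of "\<sigma> s"] ls sl by metis
  define c where "c = arc_length_param \<gamma>"
  have c_eq: "c s = \<gamma> (\<sigma> s)" for s by (simp add: c_def arc_length_param_def \<sigma>_def)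
  define n where "n = (\<lambda>t. v t /\<^sub>R norm (v t))"
  define T where "T = (\<lambda>s. n (\<sigma> s))"
  have dc: "(c has_vector_derivative T s) (at s)" for s
  proof -
    have "(\<sigma> has_vector_derivative inverse (norm (v (\<sigma> s)))) (at s)"
      using sd by (simp add: has_real_derivative_iff_has_vector_derivative)
    from vector_diff_chain_at[OF this dv[of "\<sigma> s"]] show ?thesis
      by (simp add: o_def c_eq[abs_def] T_def n_def)
  qed
  have nT: "norm (T s) = 1" for s using vpos[of "\<sigma> s"] by (simp add: T_def n_def)
  have Tper: "T (s + L) = T s" and cper: "c (s + L) = c s" for s by (simp_all add: T_def n_def c_eq sper per)
  have cn: "continuous_on UNIV n" unfolding n_def using vpos by (intro continuous_intros cv) auto
  have cT: "continuous_on UNIV T" unfolding T_def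
    by (rule continuous_on_compose2[OF cn]) (use cs continuous_on_eq_continuous_at in auto)
  \<comment> \<open>Normalisation is Lipschitz away from zero: one term comes from the change of
    direction, one from the change of length, each with constant \<open>1 / m\<close>.\<close>
  have nlip: "norm (n y - n x) \<le> 2 / m * norm (v y - v x)" for x y
  proof -
    have "n y - n x = (v y - v x) /\<^sub>R norm (v y) + (inverse (norm (v y)) - inverse (norm (v x))) *\<^sub>R v x"
      by (simp add: n_def algebra_simps)
    also have "norm \<dots> \<le> norm (v y - v x) / norm (v y) + \<bar>inverse (norm (v y)) - inverse (norm (v x))\<bar> * norm (v x)"
      by (rule norm_triangle_le) (simp add: divide_inverse mult.commute)
    also have "\<bar>inverse (norm (v y)) - inverse (norm (v x))\<bar> * norm (v x) = \<bar>norm (v x) - norm (v y)\<bar> / norm (v y)"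
    proof -
      have "(inverse (norm (v y)) - inverse (norm (v x))) * norm (v x) = (norm (v x) - norm (v y)) / norm (v y)"
        using vpos[of x] vpos[of y] by (simp add: field_simps)
      then show ?thesis by (metis abs_divide abs_mult abs_norm_cancel)
    qed
    also have "\<bar>norm (v x) - norm (v y)\<bar> / norm (v y) \<le> norm (v y - v x) / norm (v y)"
      using norm_triangle_ineq3[of "v x" "v y"] by (intro divide_right_mono) (auto simp: norm_minus_commute)
    also have "norm (v y - v x) / norm (v y) + norm (v y - v x) / norm (v y) \<le> norm (v y - v x) / m + norm (v y - v x) / m"
      using mv[of y] m0 vpos[of y] by (intro add_mono divide_left_mono mult_pos_pos) auto
    finally show ?thesis by (simp add: field_simps)
  qed
  have k2: "(\<lambda>t. (norm (k t))\<^sup>2) integrable_on {0..1}"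
    using L2_circleD(3)[OF kL] set_lebesgue_integral_eq_integral(1) by blast
  define K where "K = (\<lambda>x. integral {0..x} (\<lambda>t. (norm (k t))\<^sup>2))"
  have s0: "\<sigma> 0 = 0" using sl[of 0] l0 by simp
  have sL: "\<sigma> L = 1" using sper[of 0] s0 by simp
  \<comment> \<open>The constant is the square of \<open>2 / m\<close> from \<open>nlip\<close>
    times \<open>1 / m\<close> from the Lipschitz bound for \<open>\<sigma>\<close>.\<close>
  have Tinc: "(norm (T b - T a))\<^sup>2 \<le> (4 / m ^ 3) * (b - a) * (K (\<sigma> b) - K (\<sigma> a))" if ab: "0 \<le> a" "a \<le> b" "b \<le> L" for a b
  proof -
    have st: "0 \<le> \<sigma> a" "\<sigma> a \<le> \<sigma> b" "\<sigma> b \<le> 1" using smono[of 0 a] smono[of a b] smono[of b L] ab s0 sL by auto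
    have i: "(\<lambda>t. (norm (k t))\<^sup>2) integrable_on {0..\<sigma> b}" "(\<lambda>t. (norm (k t))\<^sup>2) integrable_on {\<sigma> a..\<sigma> b}"
      by (rule integrable_subinterval_real[OF k2]; use st in auto)+
    have Kd: "K (\<sigma> b) - K (\<sigma> a) = integral {\<sigma> a..\<sigma> b} (\<lambda>t. (norm (k t))\<^sup>2)"
      using Henstock_Kurzweil_Integration.integral_combine[OF st(1,2) i(1)] by (simp add: K_def)
    have K0: "0 \<le> K (\<sigma> b) - K (\<sigma> a)" unfolding Kd by (rule integral_nonneg[OF i(2)]) simp
    have "(norm (T b - T a))\<^sup>2 \<le> (2 / m * norm (v (\<sigma> b) - v (\<sigma> a)))\<^sup>2"
      unfolding T_def by (rule power_mono[OF nlip]) simp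
    also have "\<dots> = (4 / m\<^sup>2) * (norm (v (\<sigma> b) - v (\<sigma> a)))\<^sup>2" by (simp add: power_mult_distrib power_divide)
    also have "\<dots> \<le> (4 / m\<^sup>2) * ((\<sigma> b - \<sigma> a) * (K (\<sigma> b) - K (\<sigma> a)))"
      unfolding Kd by (intro mult_left_mono has_density_cauchy_schwarz[OF kd k2 st]) auto
    also have "\<dots> \<le> (4 / m\<^sup>2) * (((b - a) / m) * (K (\<sigma> b) - K (\<sigma> a)))"
      using slip[OF ab(2)] m0 K0 by (intro mult_left_mono mult_right_mono) (auto simp: pos_le_divide_eq mult.commute)
    also have "(4 / m\<^sup>2) * ((x / m) * y) = (4 / m ^ 3) * x * y" for x y
      by (simp add: power2_eq_square power3_eq_cube)
    finally show ?thesis .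
  qed
  have den: "denergy L T i \<le> (4 / m ^ 3) * K 1" for i
  proof -
    let ?d = "mesh L i"
    have dpos: "0 < ?d" by (rule mesh_pos[OF Lpos])
    have "denergy L T i \<le> (\<Sum>j<2 ^ i. (4 / m ^ 3) * (K (\<sigma> (real (Suc j) * ?d)) - K (\<sigma> (real j * ?d))))"
      unfolding denergy_def[OF Lpos]
    proof (rule sum_mono)
      fix j assume "j \<in> {..<(2::nat) ^ i}"
      then have "Suc j \<le> 2 ^ i" by simp
      then have "real (Suc j) \<le> real (2 ^ i)" by (rule of_nat_mono)
      then have "real (Suc j) * ?d \<le> real (2 ^ i) * ?d" using dpos by (intro mult_right_mono) auto
      then have le: "real (Suc j) * ?d \<le> L" unfolding mesh_total[OF Lpos] .
      have "(norm (T (real (Suc j) * ?d) - T (real j * ?d)))\<^sup>2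
        \<le> (4 / m ^ 3) * (real (Suc j) * ?d - real j * ?d) * (K (\<sigma> (real (Suc j) * ?d)) - K (\<sigma> (real j * ?d)))"
        by (rule Tinc[OF _ _ le]) (use dpos in \<open>auto simp: mult_right_mono\<close>)
      then have "(norm (T (real (Suc j) * ?d) - T (real j * ?d)))\<^sup>2
        \<le> ((4 / m ^ 3) * (K (\<sigma> (real (Suc j) * ?d)) - K (\<sigma> (real j * ?d)))) * ?d"
        by (simp add: algebra_simps)
      then show "(norm (T (real (Suc j) * ?d) - T (real j * ?d)))\<^sup>2 / ?d
        \<le> (4 / m ^ 3) * (K (\<sigma> (real (Suc j) * ?d)) - K (\<sigma> (real j * ?d)))"
        unfolding pos_divide_le_eq[OF dpos] .
    qed
    also have "\<dots> = (4 / m ^ 3) * (\<Sum>j<2 ^ i. K (\<sigma> (real (Suc j) * ?d)) - K (\<sigma> (real j * ?d)))"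
      by (rule sum_distrib_left[symmetric])
    also have "(\<Sum>j<2 ^ i. K (\<sigma> (real (Suc j) * ?d)) - K (\<sigma> (real j * ?d))) = K (\<sigma> (real (2 ^ i) * ?d)) - K (\<sigma> (real 0 * ?d))"
      by (rule sum_lessThan_telescope[of "\<lambda>j. K (\<sigma> (real j * ?d))"])
    also have "\<dots> = K 1" unfolding mesh_total[OF Lpos] using s0 sL by (simp add: K_def)
    finally show ?thesis .
  qed
  obtain h where h: "h \<in> borel_measurable borel" "(\<lambda>t. (norm (h t))\<^sup>2) integrable_on {0..L}" "has_density L T h"
    using riesz_criterion[OF Lpos continuous_on_subset[OF cT subset_UNIV] den] by blast
  have T0: "T 0 = T L" using Tper[of 0] by simp
  have dT: "has_density L T (per L h)"
    unfolding has_density_def using per_has_integral[OF Lpos] has_densityD[OF h(3)] by blast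
  have u: "ucurve L c T (per L h)"
    unfolding ucurve_def sobolev2_def using Lpos cper Tper dc per_L2[OF Lpos h(1,2)] dT nT by blast
  have be: "bending_energy \<gamma> = energy L (per L h)"
    by (rule bending_energy_eq[OF Lpos]) (use ucurveD(11)[OF u] in \<open>simp_all add: c_def L_def\<close>)
  have "\<gamma> t = c (?l t)" for t by (simp add: c_eq sl)
  moreover have "\<exists>k>0. vector_derivative \<gamma> (at t) = k *\<^sub>R T (?l t)" for t
    by (rule exI[of _ "norm (v t)"]) (use vpos[of t] in \<open>auto simp: vd T_def n_def sl\<close>)
  ultimately show ?thesis
    using u be sm l0 shift surj unfolding c_def[symmetric] by blast
qed

section \<open>Minimal curves\<close>

lemma has_integral_flip:
  fixes g :: "real \<Rightarrow> 'a::banach"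
  assumes g: "(g has_integral I) {0..p}" and ab: "0 \<le> a" "a \<le> b" "b \<le> p"
  shows "((\<lambda>s. if a \<le> s \<and> s \<le> b then g (a + b - s) else g s) has_integral I) {0..p}" (is "(?g has_integral I) _")
proof -
  have gi: "g integrable_on {0..p}" using g by (auto simp: integrable_on_def)
  have i: "(g has_integral integral {0..a} g) {0..a}" "(g has_integral integral {a..b} g) {a..b}" "(g has_integral integral {b..p} g) {b..p}"
    by (rule integrable_integral, rule integrable_subinterval_real[OF gi], use ab in auto)+
  have "(g has_integral (integral {0..a} g + integral {a..b} g) + integral {b..p} g) {0..p}"
    by (rule has_integral_combine[OF _ ab(3) has_integral_combine[OF ab(1,2) i(1,2)] i(3)]) (use ab in auto)
  then have I: "I = (integral {0..a} g + integral {a..b} g) + integral {b..p} g" by (rule has_integral_unique[OF g])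
  have 1: "(?g has_integral integral {0..a} g) {0..a}"
    by (rule has_integral_spike_finite[OF _ _ i(1), of "{a}"]) (use ab in auto)
  have 3: "(?g has_integral integral {b..p} g) {b..p}"
    by (rule has_integral_spike_finite[OF _ _ i(3), of "{b}"]) (use ab in auto)
  have "((\<lambda>s. g (a + b - s)) has_integral integral {a..b} g) {a..b}"
    by (rule has_integral_reflect_Icc) (use i(2) in simp)
  then have 2: "(?g has_integral integral {a..b} g) {a..b}" by (rule has_integral_eq[rotated]) auto
  show ?thesis unfolding I
    by (rule has_integral_combine[OF _ ab(3) has_integral_combine[OF ab(1,2) 1 2] 3]) (use ab in auto)
qed

lemma has_integral_telescope:
  fixes h :: "real \<Rightarrow> 'a::banach"
  assumes "x \<le> y" "y \<le> z" "(h has_integral (F y - F x)) {x..y}" "(h has_integral (F z - F y)) {y..z}"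
  shows "(h has_integral (F z - F x)) {x..z}"
  using has_integral_combine[OF assms] by simp

text \<open>The sign \<open>\<epsilon> = 1\<close> serves the curve, \<open>\<epsilon> = -1\<close>
  its tangent, which changes sign under reversal. Matching values are demanded only at an end of the
  arc that is interior to the interval.\<close>

lemma has_density_flip:
  assumes f: "has_density p f h" and ab: "0 \<le> a" "a \<le> b" "b \<le> p"
    and glue: "0 < a \<Longrightarrow> \<epsilon> *\<^sub>R f b = f a" "b < p \<Longrightarrow> \<epsilon> *\<^sub>R f a = f b"
  shows "has_density p (\<lambda>s. if a \<le> s \<and> s \<le> b then \<epsilon> *\<^sub>R f (a + b - s) else f s)
     (\<lambda>s. if a \<le> s \<and> s \<le> b then (- \<epsilon>) *\<^sub>R h (a + b - s) else h s)" (is "has_density p ?F ?H")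
proof -
  define F H where F: "F = ?F" and H: "H = ?H"
  have 1: "(H has_integral F t - F 0) {0..t}" if t: "0 \<le> t" "t \<le> a" for t
  proof (cases "0 < a")
    case True
    have e: "F t = f t" "F 0 = f 0" using t ab glue(1)[OF True] True by (auto simp: F order.antisym)
    show ?thesis unfolding e H
      by (rule has_integral_spike_finite[OF _ _ has_densityD[OF f, of 0 t], of "{a}"]) (use t ab in auto)
  next
    case False
    then have "t = 0" using t by simp
    then show ?thesis using has_integral_refl(2)[of H 0] by simp
  qed
  have 2: "(H has_integral F t - F a) {a..t}" if t: "a \<le> t" "t \<le> b" for t
  proof -
    have "((\<lambda>s. h (a + b - s)) has_integral f b - f (a + b - t)) {a..t}"
      by (rule has_integral_reflect_Icc) (use has_densityD[OF f, of "a + b - t" b] t ab in simp)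
    from has_integral_cmul[OF this, of "- \<epsilon>"]
    have "((\<lambda>s. (- \<epsilon>) *\<^sub>R h (a + b - s)) has_integral F t - F a) {a..t}"
      using t ab by (simp add: algebra_simps F)
    then show ?thesis unfolding H by (rule has_integral_eq[rotated]) (use t in auto)
  qed
  have 3: "(H has_integral F t - F b) {b..t}" if t: "b \<le> t" "t \<le> p" for t
  proof (cases "b < p")
    case True
    have e: "F t = f t" "F b = f b" using t ab glue(2)[OF True] by (auto simp: F order.antisym)
    show ?thesis unfolding e H
      by (rule has_integral_spike_finite[OF _ _ has_densityD[OF f, of b t], of "{b}"]) (use t ab in auto)
  next
    case False
    then have "t = b" using t ab by auto
    then show ?thesis using has_integral_refl(2)[of H b] by simp
  qed
  have all: "(H has_integral F t - F 0) {0..t}" if t: "0 \<le> t" "t \<le> p" for t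
  proof -
    consider "t \<le> a" | "a \<le> t" "t \<le> b" | "b \<le> t" by linarith
    then show ?thesis
    proof cases
      assume "t \<le> a"
      then show ?thesis using 1 t by blast
    next
      assume c: "a \<le> t" "t \<le> b"
      show ?thesis by (rule has_integral_telescope[OF ab(1) c(1) 1[OF ab(1) order_refl] 2[OF c]])
    next
      assume c: "b \<le> t"
      have "(H has_integral F b - F 0) {0..b}"
        by (rule has_integral_telescope[OF ab(1,2) 1[OF ab(1) order_refl] 2[OF ab(2) order_refl]])
      from has_integral_telescope[OF order_trans[OF ab(1,2)] c this 3[OF c t(2)]] show ?thesis .
    qed
  qed
  have "has_density p F H"
  proof (rule has_densityI)
    show "H integrable_on {0..p}" using all[of p] ab unfolding integrable_on_def by fastforce
    fix t assume "t \<in> {0..p}"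
    then have "integral {0..t} H = F t - F 0" by (intro integral_unique all) auto
    then show "F t = F 0 + integral {0..t} H" by simp
  qed
  then show ?thesis unfolding F H .
qed

lemma has_density_shift:
  assumes f: "has_density p f h" and ab: "0 \<le> a" "a \<le> b" "b \<le> p"
  shows "has_density (b - a) (\<lambda>s. f (s + a)) (\<lambda>s. h (s + a))"
  unfolding has_density_def
proof (intro allI impI)
  fix x y assume xy: "0 \<le> x" "x \<le> y" "y \<le> b - a"
  have "(h has_integral f (y + a) - f (x + a)) {x + a..y + a}"
    by (rule has_densityD[OF f]) (use xy ab in auto)
  from has_integral_shift_real_ivl[OF this, of a] show "((\<lambda>s. h (s + a)) has_integral f (y + a) - f (x + a)) {x..y}" by simp
qed

section \<open>Admissible and minimal curves at unit speed\<close>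

definition uadm :: "complex set \<Rightarrow> real \<Rightarrow> (real \<Rightarrow> complex) \<Rightarrow> (real \<Rightarrow> complex) \<Rightarrow> (real \<Rightarrow> complex) \<Rightarrow> bool" where
  "uadm \<Omega> L c T h \<longleftrightarrow> ucurve L c T h \<and> range c \<subseteq> closure \<Omega> \<and> (\<forall>s t. c s = c t \<longrightarrow> T s = T t \<or> T s = - T t)"

text \<open>The length of the competitors is free, so that a closed piece of the curve may compete
  with the curve itself.\<close>

definition umin :: "complex set \<Rightarrow> real \<Rightarrow> (real \<Rightarrow> complex) \<Rightarrow> (real \<Rightarrow> complex) \<Rightarrow> (real \<Rightarrow> complex) \<Rightarrow> bool" where
  "umin \<Omega> L c T h \<longleftrightarrow> uadm \<Omega> L c T h \<and> (\<forall>L' c' T' h'. uadm \<Omega> L' c' T' h' \<longrightarrow> energy L h \<le> energy L' h')"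

lemma uadm_admissible:
  assumes "uadm \<Omega> L c T h"
  shows "(\<lambda>t. c (L * t)) \<in> admissible \<Omega>" "bending_energy (\<lambda>t. c (L * t)) = energy L h"
proof -
  have u: "ucurve L c T h" and r: "range c \<subseteq> closure \<Omega>" and p: "\<And>s t. c s = c t \<Longrightarrow> T s = T t \<or> T s = - T t"
    using assms by (auto simp: uadm_def)
  note R = ucurve_regular[OF u]
  show "bending_energy (\<lambda>t. c (L * t)) = energy L h" by (rule R(2))
  have "\<exists>k::real. L *\<^sub>R T (L * t) = k *\<^sub>R L *\<^sub>R T (L * s)" if "c (L * t) = c (L * s)" for s t
    using p[OF that]
  proof
    assume "T (L * t) = - T (L * s)"
    then show ?thesis by (intro exI[of _ "-1"]) simp
  qed (intro exI[of _ 1], simp)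
  then show "(\<lambda>t. c (L * t)) \<in> admissible \<Omega>"
    unfolding admissible_def using R(1,3,4) r by auto
qed

lemma unit_parallel:
  fixes x y :: complex
  assumes "a *\<^sub>R x = k *\<^sub>R (b *\<^sub>R y)" "norm x = 1" "norm y = 1" "0 < a"
  shows "x = y \<or> x = - y"
proof -
  have x: "x = (k * b / a) *\<^sub>R y"
  proof -
    have "x = (1 / a) *\<^sub>R (a *\<^sub>R x)" using assms(4) by simp
    then show ?thesis unfolding assms(1) by simp
  qed
  then have "\<bar>k * b / a\<bar> = 1" using assms(2,3) by (metis mult.right_neutral norm_scaleR)
  then have "k * b / a = 1 \<or> k * b / a = - 1" by linarith
  then show ?thesis using x by (metis scaleR_one scaleR_minus_left)
qed

text \<open>Periodicity carries the tangency condition from one period of \<open>\<gamma>\<close> to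
  all real parameters, and unit length turns parallel into equal or opposite. The arc length
  restricts to a bijection between the fibres.\<close>

lemma admissible_uadm:
  assumes "\<gamma> \<in> admissible \<Omega>"
  shows "\<exists>L T h. uadm \<Omega> L (arc_length_param \<gamma>) T h \<and> bending_energy \<gamma> = energy L h
     \<and> (\<forall>x. card {t \<in> {0..<1}. \<gamma> t = x} = card {s \<in> {0..<L}. arc_length_param \<gamma> s = x})"
proof -
  have reg: "regular_curve \<gamma>" and r: "range \<gamma> \<subseteq> closure \<Omega>"
    and par: "\<And>s t. t \<in> {0..<1} \<Longrightarrow> s \<in> {0..<1} \<Longrightarrow> t \<noteq> s \<Longrightarrow> \<gamma> t = \<gamma> s \<Longrightarrow> \<exists>c::real. vector_derivative \<gamma> (at t) = c *\<^sub>R vector_derivative \<gamma> (at s)"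
    using assms by (auto simp: admissible_def)
  let ?c = "arc_length_param \<gamma>" and ?l = "arc_length \<gamma>"
  obtain L T h where u: "ucurve L ?c T h" and be: "bending_energy \<gamma> = energy L h" and sm: "strict_mono ?l" and l0: "?l 0 = 0"
    and sh: "\<And>t. ?l (t + 1) = ?l t + L" and sj: "surj ?l" and gc: "\<And>t. \<gamma> t = ?c (?l t)"
    and dv: "\<And>t. \<exists>k>0. vector_derivative \<gamma> (at t) = k *\<^sub>R T (?l t)"
    using regular_ucurve[OF reg] by blast
  note u' = ucurveD[OF u]
  have red: "\<exists>x\<in>{0..<1}. ?c s = \<gamma> x \<and> T s = T (?l x)" for s
  proof -
    obtain y where y: "s = ?l y" using sj by (metis surjD)
    obtain k x where x: "y = x + of_int k * 1" "0 \<le> x" "x < (1::real)" using periodic_reduce[OF zero_less_one, of y] .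
    have "?c (?l y) = ?c (?l x)" unfolding x(1)
      by (rule periodic_int[where f = "\<lambda>t. ?c (?l t)"]) (simp add: sh u'(2))
    moreover have "T (?l y) = T (?l x)" unfolding x(1)
      by (rule periodic_int[where f = "\<lambda>t. T (?l t)"]) (simp add: sh u'(3))
    ultimately show ?thesis using x(2,3) gc[of x] y by (intro bexI[of _ x]) auto
  qed
  have "T s = T t \<or> T s = - T t" if e: "?c s = ?c t" for s t
  proof -
    obtain x where x: "x \<in> {0..<1}" "?c s = \<gamma> x" "T s = T (?l x)" using red by blast
    obtain y where y: "y \<in> {0..<1}" "?c t = \<gamma> y" "T t = T (?l y)" using red by blast
    show ?thesis
    proof (cases "x = y")
      case False
      then obtain k :: real where k: "vector_derivative \<gamma> (at x) = k *\<^sub>R vector_derivative \<gamma> (at y)"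
        using par[OF x(1) y(1)] e x(2) y(2) by auto
      obtain a b where ab: "0 < a" "vector_derivative \<gamma> (at x) = a *\<^sub>R T (?l x)" "vector_derivative \<gamma> (at y) = b *\<^sub>R T (?l y)"
        using dv by blast
      show ?thesis unfolding x(3) y(3)
        by (rule unit_parallel[of a _ k b]) (use k ab u'(5) in auto)
    qed (use x y in auto)
  qed
  moreover have "range ?c \<subseteq> closure \<Omega>" using red r by fastforce
  ultimately have "uadm \<Omega> L ?c T h" using u by (simp add: uadm_def)
  moreover have "card {t \<in> {0..<1}. \<gamma> t = x} = card {s \<in> {0..<L}. ?c s = x}" for x
  proof (rule bij_betw_same_card[of ?l], rule bij_betw_imageI)
    show "inj_on ?l {t \<in> {0..<1}. \<gamma> t = x}" by (rule strict_mono_imp_inj_on[OF sm])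
    have l1: "?l 1 = L" using sh[of 0] l0 by simp
    show "?l ` {t \<in> {0..<1}. \<gamma> t = x} = {s \<in> {0..<L}. ?c s = x}"
    proof (intro equalityI subsetI)
      fix s assume "s \<in> ?l ` {t \<in> {0..<1}. \<gamma> t = x}"
      then obtain t where t: "0 \<le> t" "t < 1" "\<gamma> t = x" "s = ?l t" by auto
      then show "s \<in> {s \<in> {0..<L}. ?c s = x}"
        using strict_mono_less_eq[OF sm, of 0 t] strict_mono_less[OF sm, of t 1] l0 l1 gc[of t] by simp
    next
      fix s assume s: "s \<in> {s \<in> {0..<L}. ?c s = x}"
      obtain t where t: "s = ?l t" using sj by (metis surjD)
      then show "s \<in> ?l ` {t \<in> {0..<1}. \<gamma> t = x}"
        using s strict_mono_less_eq[OF sm, of 0 t] strict_mono_less[OF sm, of t 1] l0 l1 gc[of t] by (intro image_eqI[of _ _ t]) auto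
    qed
  qed
  ultimately show ?thesis using be by blast
qed

lemma minimal_umin:
  assumes "minimal_curve \<Omega> \<gamma>"
  shows "\<exists>L c T h. umin \<Omega> L c T h \<and> (\<forall>x. card {t \<in> {0..<1}. \<gamma> t = x} = card {s \<in> {0..<L}. c s = x})"
proof -
  have g: "\<gamma> \<in> admissible \<Omega>" and m: "\<And>\<eta>. \<eta> \<in> admissible \<Omega> \<Longrightarrow> bending_energy \<gamma> \<le> bending_energy \<eta>"
    using assms by (auto simp: minimal_curve_def)
  obtain L T h where *: "uadm \<Omega> L (arc_length_param \<gamma>) T h" "bending_energy \<gamma> = energy L h"
    "\<forall>x. card {t \<in> {0..<1}. \<gamma> t = x} = card {s \<in> {0..<L}. arc_length_param \<gamma> s = x}"
    using admissible_uadm[OF g] by blast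
  have "energy L h \<le> energy L' h'" if "uadm \<Omega> L' c' T' h'" for L' c' T' h'
    using m[OF uadm_admissible(1)[OF that]] uadm_admissible(2)[OF that] *(2) by simp
  then show ?thesis using * unfolding umin_def by blast
qed

lemma ucurve_energy_integrable:
  assumes "ucurve L c T h"
  shows "(\<lambda>t. (norm (h t))\<^sup>2) integrable_on {0..L}"
  using L2_circleD(3)[OF ucurveD(6)[OF assms]] set_lebesgue_integral_eq_integral(1) by blast

lemma ucurve_lipschitz:
  assumes "ucurve L c T h"
  shows "1-lipschitz_on {0..L} c"
proof -
  have *: "norm (c b - c a) \<le> b - a" if ab: "0 \<le> a" "a \<le> b" "b \<le> L" for a b
    using has_integral_bound[of 1 T "c b - c a" a b] has_densityD[OF ucurveD(8)[OF assms] ab] ucurveD(5)[OF assms] ab by auto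
  show ?thesis
  proof (rule lipschitz_onI)
    fix s t assume "s \<in> {0..L}" "t \<in> {0..L}"
    then show "dist (c s) (c t) \<le> 1 * dist s t"
      using *[of s t] *[of t s] by (cases "s \<le> t") (auto simp: dist_norm norm_minus_commute)
  qed simp
qed

lemma ucurve_loop: "ucurve L c T h \<Longrightarrow> is_loop L c"
  using ucurveD(1,2,9)[of L c T h] unfolding is_loop_def
  by (metis add_0 continuous_on_subset less_imp_le subset_UNIV)

text \<open>A double point passed twice in the same direction would allow cutting the curve in two closed
  pieces, one of which has less energy.\<close>

lemma umin_opposite:
  assumes m: "umin \<Omega> L c T h" and st: "0 \<le> s" "s < t" "t \<le> L" "\<not> (s = 0 \<and> t = L)" and e: "c s = c t"
  shows "T t = - T s"
proof (rule ccontr)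
  assume n: "T t \<noteq> - T s"
  have u: "ucurve L c T h" and r: "range c \<subseteq> closure \<Omega>" and p: "\<And>s t. c s = c t \<Longrightarrow> T s = T t \<or> T s = - T t"
    and mn: "\<And>L' c' T' h'. uadm \<Omega> L' c' T' h' \<Longrightarrow> energy L h \<le> energy L' h'"
    using m by (auto simp: umin_def uadm_def)
  note u' = ucurveD[OF u]
  have Tst: "T s = T t" using p[OF e] n by auto
  define M where "M = t - s"
  have M: "0 < M" using st by (simp add: M_def)
  note st' = st(1) less_imp_le[OF st(2)] st(3)
  note i2 = ucurve_energy_integrable[OF u]
  have ist: "(\<lambda>t. (norm (h t))\<^sup>2) integrable_on {s..t}" "(\<lambda>t. (norm (h t))\<^sup>2) integrable_on {0..t}" "(\<lambda>t. (norm (h t))\<^sup>2) integrable_on {0..s}" "(\<lambda>t. (norm (h t))\<^sup>2) integrable_on {t..L}"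
    by (rule integrable_subinterval_real[OF i2]; use st in auto)+
  have "((\<lambda>x. (norm (h (x + s)))\<^sup>2) has_integral integral {s..t} (\<lambda>t. (norm (h t))\<^sup>2)) {s - s..t - s}"
    by (rule has_integral_shift_real_ivl[of "\<lambda>t. (norm (h t))\<^sup>2"]) (rule integrable_integral[OF ist(1)])
  then have hs: "((\<lambda>x. (norm (h (x + s)))\<^sup>2) has_integral integral {s..t} (\<lambda>t. (norm (h t))\<^sup>2)) {0..M}" by (simp add: M_def)
  note [measurable] = L2_circleD(1)[OF u'(6)]
  have b1: "continuous_on {0..M} (\<lambda>x. T (x + s))" by (intro continuous_on_compose2[OF u'(10)] continuous_intros) auto
  have b2: "has_density M (\<lambda>x. c (x + s)) (\<lambda>x. T (x + s))" "has_density M (\<lambda>x. T (x + s)) (\<lambda>x. h (x + s))"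
    unfolding M_def by (rule has_density_shift[OF u'(8) st'], rule has_density_shift[OF u'(7) st'])
  have b3: "(\<lambda>x. (norm (h (x + s)))\<^sup>2) integrable_on {0..M}" using hs by (auto simp: integrable_on_def)
  have b4: "T (0 + s) = T (M + s)" "c (0 + s) = c (M + s)" using Tst e by (auto simp: M_def)
  have b5: "(\<lambda>x. h (x + s)) \<in> borel_measurable borel" by measurable
  \<comment> \<open>With equal tangents at \<open>s\<close> and \<open>t\<close>, the arc between
    them closes up in C^1 and becomes a competitor.\<close>
  note B = ucurve_build[OF M b1 b4(1) u'(5) b2(1) b4(2) b5 b3 b2(2)]
  have "uadm \<Omega> M (per M (\<lambda>x. c (x + s))) (per M (\<lambda>x. T (x + s))) (per M (\<lambda>x. h (x + s)))"
    unfolding uadm_def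
  proof (intro conjI B(1) allI impI)
    show "range (per M (\<lambda>x. c (x + s))) \<subseteq> closure \<Omega>" using r by (auto simp: per_def)
    show "per M (\<lambda>x. T (x + s)) x = per M (\<lambda>x. T (x + s)) y \<or> per M (\<lambda>x. T (x + s)) x = - per M (\<lambda>x. T (x + s)) y"
      if "per M (\<lambda>x. c (x + s)) x = per M (\<lambda>x. c (x + s)) y" for x y
      using p that unfolding per_def by blast
  qed
  from mn[OF this] have le: "energy L h \<le> integral {s..t} (\<lambda>t. (norm (h t))\<^sup>2)"
    unfolding B(2) using integral_unique[OF hs] by (simp add: energy_def)
  have "energy L h = integral {0..s} (\<lambda>t. (norm (h t))\<^sup>2) + integral {s..t} (\<lambda>t. (norm (h t))\<^sup>2) + integral {t..L} (\<lambda>t. (norm (h t))\<^sup>2)"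
    using Henstock_Kurzweil_Integration.integral_combine[OF st(1) st'(2) ist(2)]
      Henstock_Kurzweil_Integration.integral_combine[OF _ st(3) i2] st unfolding energy_def by simp
  moreover have "0 \<le> integral {0..s} (\<lambda>t. (norm (h t))\<^sup>2)" "0 \<le> integral {t..L} (\<lambda>t. (norm (h t))\<^sup>2)"
    by (rule integral_nonneg, rule ist, simp)+
  \<comment> \<open>All the energy sits between \<open>s\<close> and \<open>t\<close>, so the rest
    of the curve is straight with the constant tangent \<open>T 0\<close>. It leads from
    \<open>c t\<close> through \<open>c L = c 0\<close> back to \<open>c s = c t\<close>, so its
    length is zero, against the choice of \<open>s\<close> and \<open>t\<close>.\<close>
  ultimately have z: "integral {0..s} (\<lambda>t. (norm (h t))\<^sup>2) = 0" "integral {t..L} (\<lambda>t. (norm (h t))\<^sup>2) = 0" using le by auto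
  have cst: "T x = T y" if "0 \<le> x" "x \<le> y" "y \<le> L" "integral {x..y} (\<lambda>t. (norm (h t))\<^sup>2) = 0" for x y
    using has_density_cauchy_schwarz[OF u'(7) i2 that(1-3)] that(4) by simp
  have lin: "c y - c x = (y - x) *\<^sub>R w" if xy: "0 \<le> x" "x \<le> y" "y \<le> L" and w: "\<And>v. v \<in> {x..y} \<Longrightarrow> T v = w" for x y w
  proof -
    have "((\<lambda>v. w) has_integral (c y - c x)) {x..y}"
      by (rule has_integral_eq[OF _ has_densityD[OF u'(8) xy]]) (rule w)
    from has_integral_unique[OF this has_integral_const_real] show ?thesis using xy by simp
  qed
  have T0L: "T L = T 0" using u'(3)[of 0] by simp
  have 1: "T v = T 0" if v: "v \<in> {0..s}" for v
  proof -
    have "integral {0..v} (\<lambda>t. (norm (h t))\<^sup>2) \<le> integral {0..s} (\<lambda>t. (norm (h t))\<^sup>2)"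
      by (rule integral_subset_le[OF _ integrable_subinterval_real[OF ist(3)] ist(3)]) (use v in auto)
    moreover have "0 \<le> integral {0..v} (\<lambda>t. (norm (h t))\<^sup>2)"
      by (rule integral_nonneg[OF integrable_subinterval_real[OF ist(3)]]) (use v in auto)
    ultimately show ?thesis using cst[of 0 v] z v st by auto
  qed
  have 2: "T v = T 0" if v: "v \<in> {t..L}" for v
  proof -
    have "integral {v..L} (\<lambda>t. (norm (h t))\<^sup>2) \<le> integral {t..L} (\<lambda>t. (norm (h t))\<^sup>2)"
      by (rule integral_subset_le[OF _ integrable_subinterval_real[OF ist(4)] ist(4)]) (use v in auto)
    moreover have "0 \<le> integral {v..L} (\<lambda>t. (norm (h t))\<^sup>2)"
      by (rule integral_nonneg[OF integrable_subinterval_real[OF ist(4)]]) (use v in auto)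
    ultimately show ?thesis using cst[of v L] z v st T0L by auto
  qed
  have "c s - c 0 = (s - 0) *\<^sub>R T 0" by (rule lin[OF order_refl st(1) _ 1]) (use st in auto)
  moreover have "c L - c t = (L - t) *\<^sub>R T 0" by (rule lin[OF _ st(3) order_refl 2]) (use st in auto)
  moreover have "c L = c 0" using u'(2)[of 0] by simp
  ultimately have "(s + (L - t)) *\<^sub>R T 0 = 0" using e by (simp add: algebra_simps)
  moreover have "T 0 \<noteq> 0" using u'(5)[of 0] by auto
  ultimately have "s + (L - t) = 0" by simp
  then show False using st by auto
qed

text \<open>Opposite tangents at the ends are exactly what keeps \<open>T'\<close> continuous.
  Reflecting \<open>h\<close> inside the arc does not change the energy, so minimality is
  preserved.\<close>

lemma umin_flip1:
  assumes m: "umin \<Omega> L c T h" and ab: "0 \<le> a" "a < b" "b \<le> L" and e: "c a = c b"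
  defines "T' \<equiv> \<lambda>s. if a \<le> s \<and> s \<le> b then - T (a + b - s) else T s"
  shows "\<exists>h'. umin \<Omega> L (per L (flip1 a b c)) (per L T') h'"
    "\<And>s. s \<in> {0..L} \<Longrightarrow> per L (flip1 a b c) s = flip1 a b c s"
    "\<And>s. s \<in> {0..<L} \<Longrightarrow> per L T' s = T' s"
proof -
  have u: "ucurve L c T h" and r: "range c \<subseteq> closure \<Omega>" and p: "\<And>s t. c s = c t \<Longrightarrow> T s = T t \<or> T s = - T t"
    and mn: "\<And>L' c' T' h'. uadm \<Omega> L' c' T' h' \<Longrightarrow> energy L h \<le> energy L' h'"
    using m by (auto simp: umin_def uadm_def)
  note u' = ucurveD[OF u]
  note L = u'(1) and ab' = ab(1) less_imp_le[OF ab(2)] ab(3)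
  have opp: "T b = - T a" if "0 < a \<or> b < L" by (rule umin_opposite[OF m ab _ e]) (use that in auto)
  have T0L: "T L = T 0" using u'(3)[of 0] by simp
  define h' where "h' = (\<lambda>s. if a \<le> s \<and> s \<le> b then h (a + b - s) else h s)"
  have lp: "is_loop L (flip1 a b c)" by (rule flip1_loop[OF ab' e ucurve_loop[OF u]])
  have d1: "has_density L (flip1 a b c) T'"
    using has_density_flip[OF u'(8) ab', of 1] e by (simp add: T'_def flip1_def cong: if_cong)
  have d2: "has_density L T' h'"
    using has_density_flip[OF u'(7) ab', of "- 1"] opp by (simp add: T'_def h'_def cong: if_cong)
  note [measurable] = L2_circleD(1)[OF u'(6)]
  have hm: "h' \<in> borel_measurable borel" unfolding h'_def by measurable
  have "((\<lambda>s. if a \<le> s \<and> s \<le> b then (norm (h (a + b - s)))\<^sup>2 else (norm (h s))\<^sup>2) has_integral energy L h) {0..L}"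
    unfolding energy_def by (rule has_integral_flip[OF integrable_integral[OF ucurve_energy_integrable[OF u]] ab'])
  moreover have "(\<lambda>s. if a \<le> s \<and> s \<le> b then (norm (h (a + b - s)))\<^sup>2 else (norm (h s))\<^sup>2) = (\<lambda>s. (norm (h' s))\<^sup>2)"
    by (auto simp: h'_def)
  ultimately have h2: "((\<lambda>s. (norm (h' s))\<^sup>2) has_integral energy L h) {0..L}" by simp
  have T'0: "T' 0 = T' L"
    using ab opp T0L by (cases "a = 0"; cases "b = L") (auto simp: T'_def)
  have f1: "flip1 a b c 0 = flip1 a b c L" using lp by (simp add: is_loop_def)
  have f2: "(\<lambda>t. (norm (h' t))\<^sup>2) integrable_on {0..L}" using h2 by (auto simp: integrable_on_def)
  have f3: "norm (T' t) = 1" for t using u'(5) by (auto simp: T'_def)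
  note B = ucurve_build[OF L has_density_continuous[OF d2 less_imp_le[OF L]] T'0 f3 d1 f1 hm f2 d2]
  have en: "energy L (per L h') = energy L h" unfolding B(2) using integral_unique[OF h2] by (simp add: energy_def)
  define \<rho> where "\<rho> = (\<lambda>s. if a \<le> s \<and> s \<le> b then a + b - s else s)"
  have \<rho>: "flip1 a b c s = c (\<rho> s)" "T' s = T (\<rho> s) \<or> T' s = - T (\<rho> s)" for s
    by (auto simp: flip1_def \<rho>_def T'_def)
  have "uadm \<Omega> L (per L (flip1 a b c)) (per L T') (per L h')"
    unfolding uadm_def
  proof (intro conjI B(1) allI impI)
    show "range (per L (flip1 a b c)) \<subseteq> closure \<Omega>" using r by (auto simp: per_def \<rho>(1))
    fix s t assume H: "per L (flip1 a b c) s = per L (flip1 a b c) t"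
    define s' t' where "s' = s - L * of_int \<lfloor>s / L\<rfloor>" and "t' = t - L * of_int \<lfloor>t / L\<rfloor>"
    have "c (\<rho> s') = c (\<rho> t')" using H by (simp add: per_def \<rho>(1) s'_def t'_def)
    from p[OF this] \<rho>(2)[of s'] \<rho>(2)[of t']
    have "T' s' = T' t' \<or> T' s' = - T' t'" by (metis minus_minus)
    then show "per L T' s = per L T' t \<or> per L T' s = - per L T' t" by (simp add: per_def s'_def t'_def)
  qed
  then have "umin \<Omega> L (per L (flip1 a b c)) (per L T') (per L h')" using mn en by (simp add: umin_def)
  then show "\<exists>h'. umin \<Omega> L (per L (flip1 a b c)) (per L T') h'" by blast
  show "per L (flip1 a b c) s = flip1 a b c s" if "s \<in> {0..L}" for s
    by (rule per_eq[OF L _ that]) (use lp in \<open>simp add: is_loop_def\<close>)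
  show "per L T' s = T' s" if "s \<in> {0..<L}" for s using per_eq_Ico[OF L] that by auto
qed

text \<open>Flip the chord \<open>(a, b)\<close>. This reverses the passage at \<open>s\<close> but
  not the one at \<open>d\<close>, and the curve is still minimal, so the tangents of that double
  point would have to be opposite both before and after the flip. If \<open>s = b\<close> there is a
  triple point, and three unit vectors cannot be pairwise opposite.\<close>

lemma umin_unlinked:
  assumes m: "umin \<Omega> L c T h"
  shows "unlinked L c"
  unfolding unlinked_def
proof (intro allI impI notI)
  fix a b s d assume H: "0 \<le> a \<and> a < s \<and> s \<le> b \<and> b < d \<and> d < L" "c a = c b \<and> c s = c d"
  have u: "ucurve L c T h" using m by (auto simp: umin_def uadm_def)
  have nz: "T x \<noteq> - T x" for x
  proof
    assume "T x = - T x"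
    then have "2 *\<^sub>R T x = 0" by (metis add_eq_0_iff scaleR_2)
    then show False using ucurveD(5)[OF u, of x] by simp
  qed
  have ds: "T d = - T s" by (rule umin_opposite[OF m]) (use H in auto)
  show False
  proof (cases "s = b")
    case True
    have "T b = - T a" by (rule umin_opposite[OF m]) (use H in auto)
    moreover have "T d = - T a" by (rule umin_opposite[OF m]) (use H True in auto)
    ultimately show False using ds True nz[of a] by simp
  next
    case False
    let ?T = "\<lambda>s. if a \<le> s \<and> s \<le> b then - T (a + b - s) else T s"
    have ab: "0 \<le> a" "a < b" "b \<le> L" "c a = c b" using H by auto
    note F = umin_flip1[OF m ab]
    obtain h' where m': "umin \<Omega> L (per L (flip1 a b c)) (per L ?T) h'" using F(1) by blast
    let ?s = "a + b - s"
    have "per L (flip1 a b c) ?s = c s" "per L (flip1 a b c) d = c d"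
      using F(2)[of ?s] F(2)[of d] H False by (auto simp: flip1_def)
    then have "per L ?T d = - per L ?T ?s"
      by (intro umin_opposite[OF m']) (use H False in auto)
    moreover have "per L ?T d = T d" "per L ?T ?s = - T s"
      using F(3)[of d] F(3)[of ?s] H False by auto
    ultimately show False using ds nz[of s] by simp
  qed
qed

lemma flip1_card:
  assumes ab: "0 \<le> a" "a \<le> b" "b \<le> L" "q a = q b"
  shows "card {s \<in> {0..<L}. flip1 a b q s = x} = card {s \<in> {0..<L}. q s = x}"
proof -
  \<comment> \<open>The strict inequalities fix both ends of the chord. Reflecting them as well
    would send \<open>a\<close> to \<open>b\<close>, which leaves the half-open period when
    \<open>b = L\<close>.\<close>
  define \<rho> where "\<rho> = (\<lambda>s. if a < s \<and> s < b then a + b - s else s)"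
  have inv: "\<rho> (\<rho> s) = s" for s by (auto simp: \<rho>_def)
  have rng: "\<rho> s \<in> {0..<L} \<longleftrightarrow> s \<in> {0..<L}" for s using ab by (auto simp: \<rho>_def)
  have fq: "flip1 a b q s = q (\<rho> s)" for s
    using flip1_outside[OF ab(4,2), of s] flip1_inside[of a s b q] by (auto simp: \<rho>_def)
  have "{s \<in> {0..<L}. flip1 a b q s = x} = \<rho> ` {s \<in> {0..<L}. q s = x}"
  proof (intro equalityI subsetI)
    fix s assume "s \<in> {s \<in> {0..<L}. flip1 a b q s = x}"
    then show "s \<in> \<rho> ` {s \<in> {0..<L}. q s = x}"
      using inv[of s] rng[of s] fq[of s] by (intro image_eqI[of _ _ "\<rho> s"]) auto
  next
    fix s assume "s \<in> \<rho> ` {s \<in> {0..<L}. q s = x}"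
    then show "s \<in> {s \<in> {0..<L}. flip1 a b q s = x}" using inv rng fq by auto
  qed
  moreover have "inj_on \<rho> A" for A by (metis inj_onI inv)
  ultimately show ?thesis by (simp add: card_image)
qed

text \<open>A flipped function is not periodic any more; \<open>c'\<close> is the periodic curve
  with the same values on one closed period.\<close>

lemma umin_flips:
  assumes "flips L c q" "umin \<Omega> L c T h"
  shows "\<exists>c' T' h'. umin \<Omega> L c' T' h' \<and> (\<forall>s\<in>{0..L}. c' s = q s)
     \<and> (\<forall>x. card {s \<in> {0..<L}. c' s = x} = card {s \<in> {0..<L}. c s = x})"
  using assms
proof (induction rule: flips.induct)
  case (refl q)
  then show ?case by blast
next
  case (step c q a b)
  obtain c' T' h' where IH: "umin \<Omega> L c' T' h'" "\<And>s. s \<in> {0..L} \<Longrightarrow> c' s = q s"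
    "\<And>x. card {s \<in> {0..<L}. c' s = x} = card {s \<in> {0..<L}. c s = x}" using step.IH[OF step.prems] by blast
  show ?case
  proof (cases "a = b")
    case True
    then have "flip1 a b q = q" by (auto simp: flip1_def fun_eq_iff)
    then show ?thesis using IH by metis
  next
    case False
    then have ab: "0 \<le> a" "a < b" "b \<le> L" "c' a = c' b" using step.hyps IH(2) by auto
    note F = umin_flip1[OF IH(1) ab]
    have "\<forall>s\<in>{0..L}. per L (flip1 a b c') s = flip1 a b q s"
      using F(2) IH(2) ab by (auto simp: flip1_def)
    moreover have "card {s \<in> {0..<L}. per L (flip1 a b c') s = x} = card {s \<in> {0..<L}. c s = x}" for x
    proof -
      have "{s \<in> {0..<L}. per L (flip1 a b c') s = x} = {s \<in> {0..<L}. flip1 a b c' s = x}" using F(2) by auto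
      then show ?thesis using flip1_card[OF ab(1) less_imp_le[OF ab(2)] ab(3,4)] IH(3) by simp
    qed
    ultimately show ?thesis using F(1) by blast
  qed
qed

section \<open>Index outside a simply connected Lipschitz domain\<close>

text \<open>Near \<open>x\<close> the exterior is the region strictly above the graph. Two of its
  points are joined by moving each vertically to a fixed height \<open>k\<close> above the graph and
  then along the horizontal line at that height.\<close>

lemma lipschitz_boundary_local:
  assumes \<Omega>: "open \<Omega>" "lipschitz_boundary \<Omega>" and x: "x \<in> frontier \<Omega>"
  shows "x \<in> closure (- closure \<Omega>)"
    "\<exists>\<rho>>0. \<forall>y1\<in>(- closure \<Omega>) \<inter> ball x \<rho>. \<forall>y2\<in>(- closure \<Omega>) \<inter> ball x \<rho>.
       \<exists>S. connected S \<and> y1 \<in> S \<and> y2 \<in> S \<and> S \<subseteq> - closure \<Omega>"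
proof -
  obtain r u C f where r: "0 < r" and u: "norm u = 1" and f: "C-lipschitz_on UNIV (f :: real \<Rightarrow> real)"
    and sub: "\<And>z. z \<in> ball x r \<Longrightarrow> z \<in> \<Omega> \<longleftrightarrow> Im ((z - x) / u) < f (Re ((z - x) / u))"
    using \<Omega>(2) x unfolding lipschitz_boundary_def by blast
  have C: "0 \<le> C" using f by (rule lipschitz_on_nonneg)
  have u0: "u \<noteq> 0" using u by auto
  define \<phi> where "\<phi> = (\<lambda>w. x + u * w)"
  have \<phi>w: "(\<phi> w - x) / u = w" for w using u0 by (simp add: \<phi>_def)
  have w\<phi>: "\<phi> ((y - x) / u) = y" for y using u0 by (simp add: \<phi>_def)
  have d\<phi>: "dist (\<phi> v) (\<phi> w) = norm (v - w)" for v w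
    using u by (simp add: \<phi>_def dist_norm right_diff_distrib[symmetric] norm_mult)
  have b\<phi>: "\<phi> w \<in> ball x r \<longleftrightarrow> norm w < r" for w
    using u by (simp add: \<phi>_def dist_norm norm_mult)
  have sub\<phi>: "\<phi> w \<in> \<Omega> \<longleftrightarrow> Im w < f (Re w)" if "norm w < r" for w
    using sub[OF b\<phi>[THEN iffD2, OF that]] by (simp add: \<phi>w)
  have cf: "continuous_on S f" for S using lipschitz_on_continuous_on[OF f] continuous_on_subset by blast
  have ext: "\<phi> w \<in> - closure \<Omega>" if w: "norm w < r" "f (Re w) < Im w" for w
  proof -
    let ?G = "{y. f (Re ((y - x) / u)) < Im ((y - x) / u)} \<inter> ball x r"
    have "open ?G"
      by (intro open_Int open_Collect_less continuous_on_compose2[OF cf[of UNIV]] continuous_intros) (use u0 in auto)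
    moreover have "?G \<inter> \<Omega> = {}" using sub by fastforce
    ultimately have "?G \<inter> closure \<Omega> = {}" by (simp add: open_Int_closure_eq_empty)
    moreover have "\<phi> w \<in> ?G" using w by (simp add: b\<phi> \<phi>w del: mem_ball)
    ultimately show ?thesis by blast
  qed
  \<comment> \<open>A point of the graph is a limit of points slightly below it.\<close>
  have bnd: "\<phi> w \<in> closure \<Omega>" if w: "norm w < r" "Im w = f (Re w)" for w
    unfolding closure_approachable
  proof (intro allI impI)
    fix e :: real assume e: "0 < e"
    define t where "t = min (e / 2) ((r - norm w) / 2)"
    have t: "0 < t" "t < e" "norm w + t < r" using e w by (auto simp: t_def min_def field_simps)
    define v where "v = w - t *\<^sub>R \<i>"
    have "norm v \<le> norm w + norm (t *\<^sub>R \<i>)" unfolding v_def by (rule norm_triangle_ineq4)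
    then have "norm v < r" using t by simp
    then have "\<phi> v \<in> \<Omega>" using sub\<phi>[of v] w t by (simp add: v_def)
    moreover have "dist (\<phi> v) (\<phi> w) < e" using t by (simp add: d\<phi> v_def)
    ultimately show "\<exists>y\<in>\<Omega>. dist y (\<phi> w) < e" by blast
  qed
  have xO: "x \<notin> \<Omega>" "x \<in> closure \<Omega>" using x \<Omega>(1) by (auto simp: frontier_def interior_open)
  have \<phi>0: "\<phi> 0 = x" by (simp add: \<phi>_def)
  have f0: "f 0 = 0"
  proof -
    have "\<not> 0 < f 0" using sub\<phi>[of 0] xO(1) r \<phi>0 by simp
    moreover have "\<not> f 0 < 0" using ext[of 0] xO(2) r \<phi>0 by auto
    ultimately show ?thesis by simp
  qed
  have fC: "\<bar>f s\<bar> \<le> C * \<bar>s\<bar>" for s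
    using lipschitz_onD[OF f, of s 0] f0 by (simp add: dist_real_def)
  show "x \<in> closure (- closure \<Omega>)"
    unfolding closure_approachable
  proof (intro allI impI)
    fix e :: real assume e: "0 < e"
    define t where "t = min (e / 2) (r / 2)"
    have t: "0 < t" "t < e" "t < r" using e r by (auto simp: t_def min_def)
    have "\<phi> (t *\<^sub>R \<i>) \<in> - closure \<Omega>" by (rule ext) (use t f0 in auto)
    moreover have "dist (\<phi> (t *\<^sub>R \<i>)) x < e" using d\<phi>[of "t *\<^sub>R \<i>" 0] t by (simp add: \<phi>0)
    ultimately show "\<exists>y\<in>- closure \<Omega>. dist y x < e" by blast
  qed
  \<comment> \<open>Over base coordinates smaller than \<open>\<rho>\<close> the graph stays below
    \<open>C * \<rho>\<close>, hence below the height \<open>k = (C + 1) * \<rho>\<close>. All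
    points used have norm less than \<open>(C + 2) * \<rho>\<close>, so the denominator
    \<open>C + 3\<close> keeps them within radius \<open>r\<close>.\<close>
  define \<rho> where "\<rho> = r / (C + 3)"
  have \<rho>: "0 < \<rho>" using r C by (simp add: \<rho>_def)
  have \<rho>r: "(C + 2) * \<rho> < r"
  proof -
    have "(C + 3) * \<rho> = r" using C by (simp add: \<rho>_def)
    then show ?thesis using \<rho> by (simp add: algebra_simps)
  qed
  have \<rho>r': "\<rho> < r"
  proof -
    have "1 * \<rho> \<le> (C + 2) * \<rho>" using \<rho> C by (intro mult_right_mono) auto
    then show ?thesis using \<rho>r by simp
  qed
  define k where "k = (C + 1) * \<rho>"
  have top: "\<phi> (Complex s k) \<in> - closure \<Omega>" if s: "\<bar>s\<bar> < \<rho>" for s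
  proof (rule ext)
    have "norm (Complex s k) \<le> \<bar>s\<bar> + \<bar>k\<bar>" using cmod_le[of "Complex s k"] by simp
    also have "\<dots> < \<rho> + (C + 1) * \<rho>" using s C \<rho> by (simp add: k_def)
    also have "\<dots> = (C + 2) * \<rho>" by (simp add: algebra_simps)
    finally show "norm (Complex s k) < r" using \<rho>r by simp
    have "f s \<le> C * \<bar>s\<bar>" using fC[of s] by simp
    also have "\<dots> \<le> C * \<rho>" using s C by (intro mult_left_mono) auto
    also have "\<dots> < k" using \<rho> by (simp add: k_def algebra_simps)
    finally show "f (Re (Complex s k)) < Im (Complex s k)" by simp
  qed
  have lift: "\<exists>s S. \<bar>s\<bar> < \<rho> \<and> connected S \<and> y \<in> S \<and> \<phi> (Complex s k) \<in> S \<and> S \<subseteq> - closure \<Omega>"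
    if y: "y \<in> - closure \<Omega>" "y \<in> ball x \<rho>" for y
  proof -
    define w where "w = (y - x) / u"
    have yw: "y = \<phi> w" by (simp add: w_def w\<phi>)
    have nw: "norm w < \<rho>" using y(2) d\<phi>[of 0 w] by (simp add: yw \<phi>0)
    have Rw: "\<bar>Re w\<bar> < \<rho>" "\<bar>Im w\<bar> < \<rho>" using nw abs_Re_le_cmod[of w] abs_Im_le_cmod[of w] by auto
    have "\<not> Im w < f (Re w)" using sub\<phi>[of w] y(1) nw \<rho>r' closure_subset[of \<Omega>] by (auto simp: yw)
    moreover have "Im w \<noteq> f (Re w)" using bnd[of w] y(1) nw \<rho>r' by (auto simp: yw)
    ultimately have Iw: "f (Re w) < Im w" by simp
    define S where "S = (\<lambda>t. \<phi> (Complex (Re w) t)) ` closed_segment (Im w) k"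
    have "connected S" unfolding S_def \<phi>_def Complex_eq
      by (intro connected_continuous_image continuous_intros) auto
    moreover have "y \<in> S" unfolding S_def yw by (rule image_eqI[of _ _ "Im w"]) auto
    moreover have "\<phi> (Complex (Re w) k) \<in> S" unfolding S_def by (rule image_eqI[of _ _ k]) auto
    moreover have "S \<subseteq> - closure \<Omega>"
    proof
      fix v assume "v \<in> S"
      then obtain t where t: "t \<in> closed_segment (Im w) k" "v = \<phi> (Complex (Re w) t)" by (auto simp: S_def)
      have "f (Re w) < k"
      proof -
        have "f (Re w) \<le> C * \<bar>Re w\<bar>" using fC[of "Re w"] by simp
        also have "\<dots> \<le> C * \<rho>" using Rw C by (intro mult_left_mono) auto
        also have "\<dots> < k" using \<rho> by (simp add: k_def algebra_simps)
        finally show ?thesis .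
      qed
      have tb: "min (Im w) k \<le> t" "t \<le> max (Im w) k" using t(1) by (auto simp: closed_segment_eq_real_ivl split: if_splits)
      have k\<rho>: "\<rho> \<le> k" using \<rho> C by (simp add: k_def algebra_simps)
      have "\<bar>t\<bar> \<le> k" using tb Rw k\<rho> by auto
      then have "norm (Complex (Re w) t) < \<rho> + k" using cmod_le[of "Complex (Re w) t"] Rw by simp
      also have "\<rho> + k = (C + 2) * \<rho>" by (simp add: k_def algebra_simps)
      finally have "norm (Complex (Re w) t) < r" using \<rho>r by simp
      moreover have "f (Re w) < t" using tb Iw \<open>f (Re w) < k\<close> by auto
      ultimately show "v \<in> - closure \<Omega>" unfolding t(2) by (intro ext) auto
    qed
    ultimately show ?thesis using Rw by blast
  qed
  show "\<exists>\<rho>>0. \<forall>y1\<in>(- closure \<Omega>) \<inter> ball x \<rho>. \<forall>y2\<in>(- closure \<Omega>) \<inter> ball x \<rho>.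
       \<exists>S. connected S \<and> y1 \<in> S \<and> y2 \<in> S \<and> S \<subseteq> - closure \<Omega>"
  proof (intro exI[of _ \<rho>] conjI \<rho> ballI)
    fix y1 y2 assume y: "y1 \<in> (- closure \<Omega>) \<inter> ball x \<rho>" "y2 \<in> (- closure \<Omega>) \<inter> ball x \<rho>"
    obtain s1 S1 where 1: "\<bar>s1\<bar> < \<rho>" "connected S1" "y1 \<in> S1" "\<phi> (Complex s1 k) \<in> S1" "S1 \<subseteq> - closure \<Omega>" using lift[of y1] y by blast
    obtain s2 S2 where 2: "\<bar>s2\<bar> < \<rho>" "connected S2" "y2 \<in> S2" "\<phi> (Complex s2 k) \<in> S2" "S2 \<subseteq> - closure \<Omega>" using lift[of y2] y by blast
    define S where "S = (\<lambda>s. \<phi> (Complex s k)) ` {- \<rho><..<\<rho>}"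
    have S: "connected S" unfolding S_def \<phi>_def Complex_eq
      by (intro connected_continuous_image continuous_intros connected_Ioo)
    have "\<phi> (Complex s1 k) \<in> S" "\<phi> (Complex s2 k) \<in> S" unfolding S_def using 1(1) 2(1) by (auto intro!: imageI)
    then have ne: "S1 \<inter> S \<noteq> {}" "(S1 \<union> S) \<inter> S2 \<noteq> {}" using 1(4) 2(4) by blast+
    have "connected ((S1 \<union> S) \<union> S2)" by (rule connected_Un[OF connected_Un[OF 1(2) S ne(1)] 2(2) ne(2)])
    moreover have "S \<subseteq> - closure \<Omega>" unfolding S_def using top by (auto simp: abs_less_iff)
    ultimately show "\<exists>S. connected S \<and> y1 \<in> S \<and> y2 \<in> S \<and> S \<subseteq> - closure \<Omega>" using 1 2 by (intro exI[of _ "(S1 \<union> S) \<union> S2"]) auto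
  qed
qed

text \<open>Simple connectedness speaks of components of the complement of \<open>\<Omega>\<close>,
  not of its closure. Let \<open>D\<close> be such a component, containing \<open>z\<close>. The
  closure of the exterior component of \<open>z\<close> is open and closed relative to
  \<open>D\<close>, so it contains the unbounded set \<open>D\<close>.\<close>

lemma component_exterior_unbounded:
  assumes \<Omega>: "open \<Omega>" "lipschitz_boundary \<Omega>" "simply_connected \<Omega>" and z: "z \<in> - closure \<Omega>"
  shows "\<not> bounded (connected_component_set (- closure \<Omega>) z)"
proof
  let ?U = "- closure \<Omega>" and ?V = "connected_component_set (- closure \<Omega>) z"
  assume bV: "bounded ?V"
  have oV: "open ?V" by (rule open_connected_component) auto
  have VU: "?V \<subseteq> ?U" by (rule connected_component_subset)
  have zV: "z \<in> ?V" using z by (simp add: connected_component_refl)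
  have memV: "q \<in> ?V" if "connected S" "v \<in> S" "q \<in> S" "S \<subseteq> ?U" "v \<in> ?V" for S v q
  proof -
    have "connected_component ?U v q" using that unfolding connected_component_def by blast
    then show ?thesis using that(5) connected_component_trans[of ?U z v q] by simp
  qed
  have closed_in: "q \<in> ?V" if q: "q \<in> closure ?V" "q \<in> ?U" for q
  proof -
    have "connected (insert q ?V)"
      by (rule connected_intermediate_closure[OF connected_connected_component])
         (use q(1) closure_subset[of ?V] in blast)+
    then show ?thesis by (rule memV[of _ z]) (use zV VU q in auto)
  qed
  define D where "D = connected_component_set (- \<Omega>) z"
  have zO: "z \<in> - \<Omega>" using z closure_subset by blast
  have "D \<in> components (- \<Omega>)" unfolding D_def components_def using zO by blast
  then have uD: "\<not> bounded D"
    using \<Omega>(3) unfolding simply_connected_eq_unbounded_complement_components[OF \<Omega>(1)] by blast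
  have cD: "connected D" "z \<in> D" "D \<subseteq> - \<Omega>"
    unfolding D_def using zO connected_component_subset by (auto simp: connected_component_refl)
  \<comment> \<open>At a frontier point \<open>y\<close> the component has a point nearby, so it
    contains every exterior point near \<open>y\<close>, because these can be joined in the
    exterior. Nearby frontier points are limits of exterior points.\<close>
  have op: "\<exists>e>0. ball y e \<inter> D \<subseteq> closure ?V" if y: "y \<in> D" "y \<in> closure ?V" for y
  proof (cases "y \<in> ?U")
    case True
    then have "y \<in> ?V" using closed_in y by blast
    then obtain e where "0 < e" "ball y e \<subseteq> ?V" using oV open_contains_ball by blast
    then show ?thesis using closure_subset by blast
  next
    case False
    then have yF: "y \<in> frontier \<Omega>" using y cD(3) \<Omega>(1) by (auto simp: frontier_def interior_open)
    obtain \<rho> where \<rho>: "0 < \<rho>" "\<And>y1 y2. y1 \<in> ?U \<inter> ball y \<rho> \<Longrightarrow> y2 \<in> ?U \<inter> ball y \<rho> \<Longrightarrow> \<exists>S. connected S \<and> y1 \<in> S \<and> y2 \<in> S \<and> S \<subseteq> ?U"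
      using lipschitz_boundary_local(2)[OF \<Omega>(1,2) yF] by blast
    obtain v where v: "v \<in> ?V" "dist v y < \<rho>" using y(2) \<rho>(1) unfolding closure_approachable by blast
    have inV: "q \<in> ?V" if q: "q \<in> ?U" "q \<in> ball y \<rho>" for q
    proof -
      obtain S where "connected S" "v \<in> S" "q \<in> S" "S \<subseteq> ?U"
        using \<rho>(2)[of v q] v VU q by (auto simp: dist_commute)
      then show ?thesis using memV v by blast
    qed
    have "q \<in> closure ?V" if q: "q \<in> ball y \<rho>" "q \<in> D" for q
    proof (cases "q \<in> ?U")
      case True
      then show ?thesis using inV q closure_subset by blast
    next
      case False
      then have "q \<in> frontier \<Omega>" using q cD(3) \<Omega>(1) by (auto simp: frontier_def interior_open)
      then have qc: "q \<in> closure ?U" by (rule lipschitz_boundary_local(1)[OF \<Omega>(1,2)])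
      have "q \<in> closure (ball y \<rho> \<inter> ?U)"
        using open_Int_closure_subset[of "ball y \<rho>" ?U] q qc by auto
      moreover have "ball y \<rho> \<inter> ?U \<subseteq> ?V" using inV by blast
      ultimately show ?thesis using closure_mono by blast
    qed
    then show ?thesis using \<rho>(1) by blast
  qed
  have "openin (top_of_set D) (D \<inter> closure ?V)"
    unfolding openin_contains_ball
  proof (intro conjI ballI)
    fix y assume "y \<in> D \<inter> closure ?V"
    then obtain e where "0 < e" "ball y e \<inter> D \<subseteq> closure ?V" using op by blast
    then show "\<exists>e>0. ball y e \<inter> D \<subseteq> D \<inter> closure ?V" by blast
  qed simp
  moreover have "closedin (top_of_set D) (D \<inter> closure ?V)" by (simp add: closedin_closed_Int)
  moreover have "D \<inter> closure ?V \<noteq> {}" using cD(2) zV closure_subset by blast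
  ultimately have "D \<inter> closure ?V = D" using cD(1) unfolding connected_clopen by blast
  then have "D \<subseteq> closure ?V" by blast
  then show False using uD bV bounded_closure bounded_subset by blast
qed

lemma winding_number_exterior:
  assumes \<Omega>: "open \<Omega>" "lipschitz_boundary \<Omega>" "simply_connected \<Omega>"
    and g: "path g" "pathfinish g = pathstart g" "path_image g \<subseteq> closure \<Omega>" and z: "z \<notin> \<Omega>" "z \<notin> path_image g"
  shows "winding_number g z = 0"
proof -
  have ext: "winding_number g y = 0" if y: "y \<in> - closure \<Omega>" for y
  proof -
    let ?V = "connected_component_set (- closure \<Omega>) y"
    obtain B where B: "\<And>w. B \<le> norm w \<Longrightarrow> winding_number g w = 0"
      using winding_number_zero_at_infinity[OF g(1,2)] by blast
    obtain w where w: "w \<in> ?V" "B < norm w"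
      using component_exterior_unbounded[OF \<Omega> y] unfolding bounded_iff by (meson linorder_not_le)
    have "?V \<inter> path_image g = {}" using g(3) connected_component_subset[of "- closure \<Omega>" y] by blast
    then have "winding_number g constant_on ?V"
      by (intro winding_number_constant g connected_connected_component)
    moreover have "y \<in> ?V" using y by (simp add: connected_component_refl)
    ultimately show ?thesis using w B[of w] unfolding constant_on_def by force
  qed
  show ?thesis
  proof (cases "z \<in> closure \<Omega>")
    case False
    then show ?thesis using ext by blast
  next
    case True
    then have zF: "z \<in> frontier \<Omega>" using z \<Omega>(1) by (auto simp: frontier_def interior_open)
    have "open (- path_image g)" using closed_path_image[OF g(1)] by auto
    then obtain e where e: "0 < e" "ball z e \<subseteq> - path_image g" using z(2) open_contains_ball by (metis ComplI)
    obtain y where y: "y \<in> - closure \<Omega>" "dist y z < e"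
      using lipschitz_boundary_local(1)[OF \<Omega>(1,2) zF] e(1) unfolding closure_approachable by blast
    have "winding_number g constant_on ball z e"
      by (rule winding_number_constant[OF g(1,2)]) (use e in auto)
    moreover have "y \<in> ball z e" "z \<in> ball z e" using y e by (auto simp: dist_commute)
    ultimately show ?thesis using ext[OF y(1)] unfolding constant_on_def by metis
  qed
qed

section \<open>Limits of minimal curves\<close>

lemma umin_ucurve: "umin \<Omega> L c T h \<Longrightarrow> ucurve L c T h"
  by (simp add: umin_def uadm_def)

lemma ucurve_range: "ucurve L c T h \<Longrightarrow> range c = c ` {0..<L}"
proof
  assume u: "ucurve L c T h"
  show "range c \<subseteq> c ` {0..<L}"
  proof
    fix x assume "x \<in> range c"
    then obtain t where t: "x = c t" by blast
    obtain k s where s: "t = s + of_int k * L" "0 \<le> s" "s < L" using periodic_reduce[OF ucurveD(1)[OF u]] .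
    have "c t = c s" unfolding s(1) by (rule periodic_int[where f = c]) (rule ucurveD(2)[OF u])
    then show "x \<in> c ` {0..<L}" using s t by auto
  qed
qed auto

text \<open>Three passages through one point would have pairwise opposite tangents.\<close>

lemma umin_fibre:
  assumes m: "umin \<Omega> L c T h"
  shows "finite {s \<in> {0..<L}. c s = x}" "card {s \<in> {0..<L}. c s = x} \<le> 2"
proof -
  have nz: "T y \<noteq> - T y" for y
  proof
    assume "T y = - T y"
    then have "2 *\<^sub>R T y = 0" by (metis add_eq_0_iff scaleR_2)
    then show False using ucurveD(5)[OF umin_ucurve[OF m], of y] by simp
  qed
  have three: False if "0 \<le> a" "a < b" "b < d" "d < L" "c a = c b" "c b = c d" for a b d
    using umin_opposite[OF m, of a b] umin_opposite[OF m, of b d] umin_opposite[OF m, of a d] that nz[of a] by auto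
  have "finite {s \<in> {0..<L}. c s = x} \<and> card {s \<in> {0..<L}. c s = x} \<le> 2" (is "finite ?F \<and> _")
  proof (rule ccontr)
    assume n: "\<not> ?thesis"
    obtain A where A: "A \<subseteq> ?F" "finite A" "card A = 3"
    proof (cases "finite ?F")
      case True
      then have "3 \<le> card ?F" using n by auto
      then show ?thesis using obtain_subset_with_card_n[of 3 ?F] that True finite_subset by metis
    next
      case False
      then show ?thesis using infinite_arbitrarily_large[OF False, of 3] that by blast
    qed
    obtain a b d where abd: "A = {a, b, d}" "a \<noteq> b" "a \<noteq> d" "b \<noteq> d" using A(3) by (auto simp: card_3_iff)
    have in3: "a \<in> ?F" "b \<in> ?F" "d \<in> ?F" using A(1) abd by auto
    have S: False if "u \<in> ?F" "v \<in> ?F" "w \<in> ?F" "u < v" "v < w" for u v w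
      using three[of u v w] that by auto
    consider "a < b" "b < d" | "a < d" "d < b" | "b < a" "a < d" | "b < d" "d < a" | "d < a" "a < b" | "d < b" "b < a"
      using abd(2-4) by linarith
    then show False by cases (use S in3 in blast)+
  qed
  then show "finite ?F" "card ?F \<le> 2" by auto
qed

lemma chord_quotient_tendsto:
  fixes c :: "real \<Rightarrow> complex"
  assumes "(c has_vector_derivative v) (at s)" "S \<longlonglongrightarrow> s" "\<And>n. S n \<noteq> s"
  shows "(\<lambda>n. (c (S n) - c s) /\<^sub>R (S n - s)) \<longlonglongrightarrow> v"
proof -
  have "((\<lambda>y. (c y - c s) /\<^sub>R (y - s)) \<longlongrightarrow> v) (at s)"
  proof -
    have "((\<lambda>y. (1 / norm (y - s)) *\<^sub>R (c y - (c s + (y - s) *\<^sub>R v))) \<longlongrightarrow> 0) (at s)"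
      using assms(1) unfolding has_vector_derivative_def has_derivative_within by simp
    \<comment> \<open>The factor \<open>sgn\<close> replaces the division by a norm with one by
      \<open>y - s\<close>, so that sequences may approach \<open>s\<close> from both sides.\<close>
    then have "((\<lambda>y. sgn (y - s) *\<^sub>R ((1 / norm (y - s)) *\<^sub>R (c y - (c s + (y - s) *\<^sub>R v)))) \<longlongrightarrow> 0) (at s)"
      by (rule Lim_null_comparison[rotated, OF tendsto_norm_zero])
         (auto simp: abs_sgn_eq intro!: always_eventually)
    then have "((\<lambda>y. sgn (y - s) *\<^sub>R ((1 / norm (y - s)) *\<^sub>R (c y - (c s + (y - s) *\<^sub>R v))) + v) \<longlongrightarrow> 0 + v) (at s)"
      by (intro tendsto_intros)
    moreover have "sgn (y - s) *\<^sub>R ((1 / norm (y - s)) *\<^sub>R (c y - (c s + (y - s) *\<^sub>R v))) + v = (c y - c s) /\<^sub>R (y - s)" if "y \<noteq> s" for y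
    proof -
      have i: "sgn (y - s) * (1 / norm (y - s)) = inverse (y - s)"
        using that by (cases "y > s") (auto simp: sgn_if field_simps)
      have "sgn (y - s) *\<^sub>R ((1 / norm (y - s)) *\<^sub>R (c y - (c s + (y - s) *\<^sub>R v))) = inverse (y - s) *\<^sub>R (c y - (c s + (y - s) *\<^sub>R v))"
        by (simp only: scaleR_scaleR i)
      moreover have "inverse (y - s) *\<^sub>R (c y - (c s + (y - s) *\<^sub>R v)) + v = (c y - c s) /\<^sub>R (y - s)"
        using that by (simp add: scaleR_diff_right scaleR_add_right)
      ultimately show ?thesis by metis
    qed
    then have "eventually (\<lambda>y. sgn (y - s) *\<^sub>R ((1 / norm (y - s)) *\<^sub>R (c y - (c s + (y - s) *\<^sub>R v))) + v = (c y - c s) /\<^sub>R (y - s)) (at s)"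
      unfolding eventually_at_filter by (intro always_eventually allI impI)
    ultimately show ?thesis using Lim_transform_eventually by fastforce
  qed
  moreover have "filterlim S (at s) sequentially" using assms(2,3) by (simp add: filterlim_at)
  ultimately show ?thesis using filterlim_compose by blast
qed

text \<open>All branches through \<open>x\<close> have the same tangent line, so nearby points of the curve lie in a thin double
  cone around it.\<close>

lemma tangent_cone_isolated:
  assumes m: "umin \<Omega> L c T h" and x: "c \<sigma> = x"
  shows "\<exists>r>0. \<forall>y\<in>range c. norm (y - x) < r \<longrightarrow> inner (y - x) (T \<sigma>) = 0 \<longrightarrow> y = x"
proof (rule ccontr)
  note u = umin_ucurve[OF m]
  assume n: "\<not> ?thesis"
  have "\<exists>y\<in>range c. norm (y - x) < r \<and> inner (y - x) (T \<sigma>) = 0 \<and> y \<noteq> x" if "0 < r" for r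
  proof (rule ccontr)
    assume "\<not> ?thesis"
    then have "\<forall>y\<in>range c. norm (y - x) < r \<longrightarrow> inner (y - x) (T \<sigma>) = 0 \<longrightarrow> y = x" by blast
    then show False using n that by blast
  qed
  moreover have "0 < inverse (real (Suc n))" for n by simp
  ultimately have ex: "\<exists>y\<in>range c. norm (y - x) < inverse (real (Suc n)) \<and> inner (y - x) (T \<sigma>) = 0 \<and> y \<noteq> x" for n by blast
  have "\<exists>s\<in>{0..L}. norm (c s - x) < inverse (real (Suc n)) \<and> inner (c s - x) (T \<sigma>) = 0 \<and> c s \<noteq> x" for n
  proof -
    obtain y where y: "y \<in> c ` {0..<L}" "norm (y - x) < inverse (real (Suc n))" "inner (y - x) (T \<sigma>) = 0" "y \<noteq> x"
      using ex[of n] unfolding ucurve_range[OF u] by blast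
    then show ?thesis by auto
  qed
  then obtain S where S: "\<And>n. S n \<in> {0..L}" "\<And>n. norm (c (S n) - x) < inverse (real (Suc n))"
    "\<And>n. inner (c (S n) - x) (T \<sigma>) = 0" "\<And>n. c (S n) \<noteq> x" by metis
  obtain s k where s: "s \<in> {0..L}" "strict_mono (k :: nat \<Rightarrow> nat)" "(S \<circ> k) \<longlonglongrightarrow> s"
    using S(1) compact_Icc[of 0 L, unfolded compact_def] by metis
  have "(\<lambda>n. c (S n) - x) \<longlonglongrightarrow> 0"
    by (rule Lim_null_comparison[OF _ LIMSEQ_inverse_real_of_nat]) (use S(2) less_imp_le in \<open>auto intro!: always_eventually\<close>)
  then have "(\<lambda>n. c (S (k n)) - x) \<longlonglongrightarrow> 0" using LIMSEQ_subseq_LIMSEQ[OF _ s(2)] by (auto simp: o_def)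
  moreover have "(\<lambda>n. c (S (k n)) - x) \<longlonglongrightarrow> c s - x"
    using s(3) ucurveD(9)[OF u] by (intro tendsto_intros isCont_tendsto_compose[of s c]) (auto simp: o_def continuous_on_eq_continuous_at)
  ultimately have cs: "c s = x" using LIMSEQ_unique by fastforce
  \<comment> \<open>The chords are orthogonal to \<open>T \<sigma>\<close>, hence so is their limit
    direction \<open>T s\<close>; but \<open>T s\<close> is \<open>T \<sigma>\<close> up to
    sign.\<close>
  have "(\<lambda>n. (c (S (k n)) - c s) /\<^sub>R (S (k n) - s)) \<longlonglongrightarrow> T s"
    by (rule chord_quotient_tendsto[OF ucurveD(4)[OF u]]) (use s(3) S(4) cs in \<open>auto simp: o_def\<close>)
  then have "(\<lambda>n. inner ((c (S (k n)) - c s) /\<^sub>R (S (k n) - s)) (T \<sigma>)) \<longlonglongrightarrow> inner (T s) (T \<sigma>)" by (intro tendsto_intros)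
  then have "(\<lambda>n. 0) \<longlonglongrightarrow> inner (T s) (T \<sigma>)" using S(3) by (simp add: cs)
  then have "inner (T s) (T \<sigma>) = 0" using LIMSEQ_unique tendsto_const by blast
  moreover have "T s = T \<sigma> \<or> T s = - T \<sigma>" using m cs x by (auto simp: umin_def uadm_def)
  ultimately show False using ucurveD(5)[OF u, of \<sigma>] by (auto simp: power2_norm_eq_inner[symmetric])
qed

text \<open>Of a limit curve only the inclusion of images is known at first, and this recovers its
  tangents from it. The points of \<open>C\<close> near \<open>C t\<close> are values of
  \<open>c\<close> at parameters that accumulate at some \<open>s\<close> in the fibre, so both
  curves have common chords. Their parameter increments are unrelated, so the chords are compared as
  squares of unit vectors, which forget the sign.\<close>

lemma tangent_of_subset:
  assumes m: "umin \<Omega> L c T h" and C: "(C has_vector_derivative w) (at t)" "range C \<subseteq> range c" "norm w = 1" and e: "C t = c \<sigma>"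
  shows "w = T \<sigma> \<or> w = - T \<sigma>"
proof -
  note u = umin_ucurve[OF m]
  define R where "R = (\<lambda>n. t + inverse (real (Suc n)))"
  have R: "R \<longlonglongrightarrow> t" "\<And>n. R n \<noteq> t" 
    using tendsto_add[OF tendsto_const[of t] LIMSEQ_inverse_real_of_nat] by (auto simp: R_def)
  have lim: "(\<lambda>n. (C (R n) - C t) /\<^sub>R (R n - t)) \<longlonglongrightarrow> w" by (rule chord_quotient_tendsto[OF C(1) R])
  have "\<exists>s\<in>{0..L}. C (R n) = c s" for n
  proof -
    have "C (R n) \<in> c ` {0..<L}" using C(2) ucurve_range[OF u] by auto
    then show ?thesis by auto
  qed
  then obtain S where S: "\<And>n. S n \<in> {0..L}" "\<And>n. C (R n) = c (S n)" by metis
  obtain s k where s: "s \<in> {0..L}" "strict_mono (k :: nat \<Rightarrow> nat)" "(S \<circ> k) \<longlonglongrightarrow> s"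
    using S(1) compact_Icc[of 0 L, unfolded compact_def] by metis
  have Rk: "(\<lambda>n. R (k n)) \<longlonglongrightarrow> t" using LIMSEQ_subseq_LIMSEQ[OF R(1) s(2)] by (simp add: o_def)
  have limk: "(\<lambda>n. (C (R (k n)) - C t) /\<^sub>R (R (k n) - t)) \<longlonglongrightarrow> w"
    using LIMSEQ_subseq_LIMSEQ[OF lim s(2)] by (simp add: o_def)
  have "isCont C t" using C(1) has_vector_derivative_continuous by blast
  then have "(\<lambda>n. C (R (k n))) \<longlonglongrightarrow> C t" using isCont_tendsto_compose Rk by blast
  moreover have "(\<lambda>n. c (S (k n))) \<longlonglongrightarrow> c s"
    using s(3) ucurveD(9)[OF u] by (intro isCont_tendsto_compose[of s c]) (auto simp: o_def continuous_on_eq_continuous_at)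
  ultimately have cs: "c s = C t" using LIMSEQ_unique S(2) by fastforce
  \<comment> \<open>As \<open>w\<close> has norm 1, the chords of \<open>C\<close> are eventually
    nonzero; hence the parameters of \<open>c\<close> differ from \<open>s\<close> and its quotients
    make sense.\<close>
  have "eventually (\<lambda>n. 1 / 2 < norm ((C (R (k n)) - C t) /\<^sub>R (R (k n) - t))) sequentially"
    using order_tendstoD(1)[OF tendsto_norm[OF limk], of "1 / 2"] C(3) by simp
  then obtain N where N: "\<And>n. N \<le> n \<Longrightarrow> 1 / 2 < norm ((C (R (k n)) - C t) /\<^sub>R (R (k n) - t))"
    unfolding eventually_sequentially by blast
  define P where "P = (\<lambda>n. S (k (n + N)))"
  have Pne: "P n \<noteq> s" for n using N[of "n + N"] cs S(2) by (auto simp: P_def)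
  have "P \<longlonglongrightarrow> s" using LIMSEQ_ignore_initial_segment[OF s(3), of N] by (simp add: P_def o_def)
  from chord_quotient_tendsto[OF ucurveD(4)[OF u] this Pne]
  have q1: "(\<lambda>n. (c (P n) - c s) /\<^sub>R (P n - s)) \<longlonglongrightarrow> T s" .
  have q2: "(\<lambda>n. (C (R (k (n + N))) - C t) /\<^sub>R (R (k (n + N)) - t)) \<longlonglongrightarrow> w"
    using LIMSEQ_ignore_initial_segment[OF limk, of N] .
  text \<open>The two chords coincide, so their directions agree up to sign; compare the normalised chords.\<close>
  have "(\<lambda>n. sgn ((c (P n) - c s) /\<^sub>R (P n - s))) \<longlonglongrightarrow> sgn (T s)"
    using q1 ucurveD(5)[OF u, of s] by (intro tendsto_sgn) auto
  then have s1: "(\<lambda>n. (sgn ((c (P n) - c s) /\<^sub>R (P n - s)))\<^sup>2) \<longlonglongrightarrow> (sgn (T s))\<^sup>2" by (rule tendsto_power)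
  have "(\<lambda>n. sgn ((C (R (k (n + N))) - C t) /\<^sub>R (R (k (n + N)) - t))) \<longlonglongrightarrow> sgn w"
    using q2 C(3) by (intro tendsto_sgn) auto
  then have s2: "(\<lambda>n. (sgn ((C (R (k (n + N))) - C t) /\<^sub>R (R (k (n + N)) - t)))\<^sup>2) \<longlonglongrightarrow> (sgn w)\<^sup>2" by (rule tendsto_power)
  have sq: "(sgn (X /\<^sub>R r))\<^sup>2 = (sgn X)\<^sup>2" if "r \<noteq> 0" for X :: complex and r :: real
  proof -
    have "sgn (X /\<^sub>R r) = sgn (inverse r) *\<^sub>R sgn X" by (rule sgn_scaleR)
    moreover have "sgn (inverse r) = 1 \<or> sgn (inverse r) = - 1" using that by (auto simp: sgn_if)
    ultimately show ?thesis by auto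
  qed
  have "(sgn ((c (P n) - c s) /\<^sub>R (P n - s)))\<^sup>2 = (sgn ((C (R (k (n + N))) - C t) /\<^sub>R (R (k (n + N)) - t)))\<^sup>2" for n
    using sq[of "P n - s" "c (P n) - c s"] sq[of "R (k (n + N)) - t" "C (R (k (n + N))) - C t"] Pne[of n] R(2) S(2) cs
    by (simp add: P_def)
  then have "(sgn (T s))\<^sup>2 = (sgn w)\<^sup>2" using LIMSEQ_unique[OF s1] s2 by simp
  moreover have "sgn (T s) = T s" "sgn w = w" using ucurveD(5)[OF u, of s] C(3) by (auto simp: sgn_div_norm)
  ultimately have "w = T s \<or> w = - T s" by (metis power2_eq_iff)
  moreover have "T s = T \<sigma> \<or> T s = - T \<sigma>" using m cs e by (auto simp: umin_def uadm_def)
  ultimately show ?thesis by auto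
qed

text \<open>Cauchy-Schwarz on each dyadic cell. Unlike \<open>h\<close>, the dyadic energies pass to
  uniform limits of \<open>T\<close>.\<close>

lemma ucurve_denergy:
  assumes u: "ucurve L c T h"
  shows "denergy L T n \<le> energy L h"
proof -
  note L = ucurveD(1)[OF u] and i2 = ucurve_energy_integrable[OF u]
  let ?d = "mesh L n" and ?K = "\<lambda>x. integral {0..x} (\<lambda>t. (norm (h t))\<^sup>2)"
  have dpos: "0 < ?d" by (rule mesh_pos[OF L])
  have "denergy L T n \<le> (\<Sum>j<2 ^ n. ?K (real (Suc j) * ?d) - ?K (real j * ?d))"
    unfolding denergy_def[OF L]
  proof (rule sum_mono)
    fix j assume "j \<in> {..<(2::nat) ^ n}"
    then have "Suc j \<le> 2 ^ n" by simp
    then have "real (Suc j) \<le> real (2 ^ n)" by (rule of_nat_mono)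
    then have "real (Suc j) * ?d \<le> real (2 ^ n) * ?d" using dpos by (intro mult_right_mono) auto
    then have le: "real (Suc j) * ?d \<le> L" unfolding mesh_total[OF L] .
    have ab: "0 \<le> real j * ?d" "real j * ?d \<le> real (Suc j) * ?d" using dpos by (auto simp: mult_right_mono)
    have "(\<lambda>t. (norm (h t))\<^sup>2) integrable_on {0..real (Suc j) * ?d}"
      by (rule integrable_subinterval_real[OF i2]) (use le in auto)
    from Henstock_Kurzweil_Integration.integral_combine[OF ab this]
    have K: "?K (real (Suc j) * ?d) - ?K (real j * ?d) = integral {real j * ?d..real (Suc j) * ?d} (\<lambda>t. (norm (h t))\<^sup>2)" by simp
    have "real (Suc j) * ?d - real j * ?d = ?d" by (simp add: algebra_simps)
    with has_density_cauchy_schwarz[OF ucurveD(7)[OF u] i2 ab le]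
    have "(norm (T (real (Suc j) * ?d) - T (real j * ?d)))\<^sup>2 \<le> (?K (real (Suc j) * ?d) - ?K (real j * ?d)) * ?d"
      unfolding K by (simp only: mult.commute)
    then show "(norm (T (real (Suc j) * ?d) - T (real j * ?d)))\<^sup>2 / ?d \<le> ?K (real (Suc j) * ?d) - ?K (real j * ?d)"
      unfolding pos_divide_le_eq[OF dpos] .
  qed
  also have "\<dots> = ?K (real (2 ^ n) * ?d) - ?K (real 0 * ?d)"
    by (rule sum_lessThan_telescope[of "\<lambda>j. ?K (real j * ?d)"])
  also have "\<dots> = energy L h" unfolding mesh_total[OF L] by (simp add: energy_def)
  finally show ?thesis .
qed

lemma ucurve_holder:
  assumes u: "ucurve L c T h" and ab: "0 \<le> a" "a \<le> b" "b \<le> L"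
  shows "(norm (T b - T a))\<^sup>2 \<le> (b - a) * energy L h"
proof -
  note i2 = ucurve_energy_integrable[OF u]
  have i: "(\<lambda>t. (norm (h t))\<^sup>2) integrable_on {a..b}" by (rule integrable_subinterval_real[OF i2]) (use ab in auto)
  have "integral {a..b} (\<lambda>t. (norm (h t))\<^sup>2) \<le> energy L h"
    unfolding energy_def by (rule integral_subset_le[OF _ i i2]) (use ab in auto)
  then have "(b - a) * integral {a..b} (\<lambda>t. (norm (h t))\<^sup>2) \<le> (b - a) * energy L h" using ab by (intro mult_left_mono) auto
  then show ?thesis using has_density_cauchy_schwarz[OF ucurveD(7)[OF u] i2 ab] by linarith
qed

text \<open>Along the nearby curves the coordinate in tangent direction changes sign, and on the image of \<open>c\<close>
  it vanishes only at \<open>x\<close>.\<close>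

lemma nearby_curves_hit:
  assumes m: "umin \<Omega> L c T h" and x: "c \<sigma> = x"
    and C: "(C has_vector_derivative w) (at t)" "range C \<subseteq> range c" "norm w = 1" "C t = x"
    and conv: "\<And>e. 0 < e \<Longrightarrow> \<forall>\<^sub>F n in sequentially. \<forall>y. norm (cn n y - C y) < e"
    and cn: "\<And>n. continuous_on UNIV (cn n)" "\<And>n. range (cn n) \<subseteq> range c" and \<rho>: "0 < \<rho>"
  shows "\<forall>\<^sub>F n in sequentially. \<exists>y. t - \<rho> < y \<and> y < t + \<rho> \<and> cn n y = x"
proof -
  obtain r where r: "0 < r" "\<And>y. y \<in> range c \<Longrightarrow> norm (y - x) < r \<Longrightarrow> inner (y - x) (T \<sigma>) = 0 \<Longrightarrow> y = x"
    using tangent_cone_isolated[OF m x] by blast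
  have w: "w = T \<sigma> \<or> w = - T \<sigma>" by (rule tangent_of_subset[OF m C(1-3)]) (simp add: C(4) x)
  define \<phi> where "\<phi> = (\<lambda>y. inner (y - x) w)"
  have r': "y = x" if "y \<in> range c" "norm (y - x) < r" "\<phi> y = 0" for y
    using r(2)[OF that(1,2)] that(3) w by (auto simp: \<phi>_def)
  have c\<phi>: "continuous_on S \<phi>" for S unfolding \<phi>_def by (intro continuous_intros)
  have d\<phi>: "((\<lambda>s. \<phi> (C s)) has_real_derivative 1) (at t)"
  proof -
    have "((\<lambda>s. inner (C s - x) w) has_derivative (\<lambda>s. inner (s *\<^sub>R w) w)) (at t)"
      using C(1) unfolding has_vector_derivative_def by (auto intro!: derivative_eq_intros)
    moreover have "inner w w = 1" using C(3) by (simp add: power2_norm_eq_inner[symmetric])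
    moreover have "(*) (1::real) = (\<lambda>s. s)" by (rule ext) simp
    ultimately show ?thesis by (simp add: \<phi>_def has_field_derivative_def)
  qed
  have \<phi>0: "\<phi> (C t) = 0" by (simp add: \<phi>_def C(4))
  obtain d1 where d1: "0 < d1" "\<And>h. 0 < h \<Longrightarrow> h < d1 \<Longrightarrow> 0 < \<phi> (C (t + h))"
    using DERIV_pos_inc_right[OF d\<phi>] \<phi>0 by auto
  obtain d2 where d2: "0 < d2" "\<And>h. 0 < h \<Longrightarrow> h < d2 \<Longrightarrow> \<phi> (C (t - h)) < 0"
    using DERIV_pos_inc_left[OF d\<phi>] \<phi>0 by auto
  have "isCont C t" using C(1) has_vector_derivative_continuous by blast
  then obtain d3 where d3: "0 < d3" "\<And>y. dist y t < d3 \<Longrightarrow> dist (C y) x < r / 2"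
    using r(1) C(4) unfolding continuous_at_eps_delta by (metis half_gt_zero)
  define \<eta> where "\<eta> = min (min d1 d2) (min d3 \<rho>) / 2"
  have \<eta>: "0 < \<eta>" "\<eta> < d1" "\<eta> < d2" "\<eta> < d3" "\<eta> < \<rho>" using d1(1) d2(1) d3(1) \<rho> by (auto simp: \<eta>_def min_def)
  \<comment> \<open>Curves closer than \<open>e\<close> keep the sign of the tangential coordinate
    at both ends of the window and stay where \<open>x\<close> is the only zero on the
    image.\<close>
  define e where "e = min (r / 2) (min (\<phi> (C (t + \<eta>))) (- \<phi> (C (t - \<eta>))))"
  have e: "0 < e" "e \<le> r / 2" "e \<le> \<phi> (C (t + \<eta>))" "e \<le> - \<phi> (C (t - \<eta>))"
    using r(1) d1(2)[OF \<eta>(1,2)] d2(2)[OF \<eta>(1,3)] by (auto simp: e_def min_def)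
  show ?thesis
    using conv[OF e(1)]
  proof eventually_elim
    case (elim n)
    have diff: "\<bar>\<phi> (cn n y) - \<phi> (C y)\<bar> < e" for y
    proof -
      have "\<phi> (cn n y) - \<phi> (C y) = inner (cn n y - C y) w" by (simp add: \<phi>_def inner_diff_left)
      also have "\<bar>\<dots>\<bar> \<le> norm (cn n y - C y) * norm w" by (rule Cauchy_Schwarz_ineq2)
      finally show ?thesis using elim[rule_format, of y] C(3) by simp
    qed
    have "\<phi> (cn n (t - \<eta>)) \<le> 0" "0 \<le> \<phi> (cn n (t + \<eta>))" using diff[of "t - \<eta>"] diff[of "t + \<eta>"] e by auto
    moreover have "continuous_on {t - \<eta>..t + \<eta>} (\<lambda>y. \<phi> (cn n y))"
      by (rule continuous_on_compose2[OF c\<phi>[of UNIV] continuous_on_subset[OF cn(1)]]) auto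
    ultimately obtain y where y: "t - \<eta> \<le> y" "y \<le> t + \<eta>" "\<phi> (cn n y) = 0"
      using IVT'[of "\<lambda>y. \<phi> (cn n y)" "t - \<eta>" 0 "t + \<eta>"] \<eta>(1) by auto
    have "norm (cn n y - x) < r"
    proof -
      have "norm (cn n y - x) \<le> norm (cn n y - C y) + norm (C y - x)" using norm_triangle_ineq[of "cn n y - C y" "C y - x"] by simp
      moreover have "norm (C y - x) < r / 2" using d3(2)[of y] y \<eta>(4) by (simp add: dist_norm abs_less_iff)
      ultimately show ?thesis using elim[rule_format, of y] e(2) by linarith
    qed
    moreover have "cn n y \<in> range c" using cn(2)[of n] by blast
    ultimately have "cn n y = x" using r' y(3) by blast
    then show ?case using y \<eta>(5) by (intro exI[of _ y]) auto
  qed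
qed

text \<open>Finiteness of fibres matters here, because \<open>card\<close> is also 0 on infinite
  sets.\<close>

lemma fibre_empty_iff: "umin \<Omega> L c T h \<Longrightarrow> card {s \<in> {0..<L}. c s = x} = 0 \<longleftrightarrow> x \<notin> range c"
  using umin_fibre(1)[of \<Omega> L c T h x] ucurve_range[OF umin_ucurve, of \<Omega> L c T h] by (auto simp: card_eq_0_iff)

lemma range_eqI_card:
  assumes "umin \<Omega> L c T h" "umin \<Omega> L c' T' h'"
    "\<And>x. card {s \<in> {0..<L}. c s = x} = card {s \<in> {0..<L}. c' s = x}"
  shows "range c = range c'"
proof -
  have "x \<in> range c \<longleftrightarrow> x \<in> range c'" for x
    using fibre_empty_iff[OF assms(1), of x] fibre_empty_iff[OF assms(2), of x] assms(3)[of x] by argo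
  then show ?thesis by (rule set_eqI)
qed

lemma card_ge_2I: "finite A \<Longrightarrow> a \<in> A \<Longrightarrow> b \<in> A \<Longrightarrow> a \<noteq> b \<Longrightarrow> 2 \<le> card A"
  by (metis card_2_iff card_mono empty_subsetI insert_subset)

text \<open>All the curves have the same energy, hence a common Hoelder bound for the tangents, and
  Arzela-Ascoli gives a C^1 limit. Fixed dyadic energies converge as finite sums, so
  \<open>riesz_criterion\<close> bounds the energy of the limit. Its image lies in that of
  \<open>c\<close>, which makes it admissible by \<open>tangent_of_subset\<close>.\<close>

lemma umin_limit:
  fixes cn Tn hn :: "nat \<Rightarrow> real \<Rightarrow> complex"
  assumes m: "umin \<Omega> L c T h" and mn: "\<And>n. umin \<Omega> L (cn n) (Tn n) (hn n)"
    and card: "\<And>n x. card {s \<in> {0..<L}. cn n s = x} = card {s \<in> {0..<L}. c s = x}"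
  shows "\<exists>C U H k. umin \<Omega> L C U H \<and> strict_mono (k :: nat \<Rightarrow> nat)
     \<and> (\<forall>x. card {s \<in> {0..<L}. C s = x} = card {s \<in> {0..<L}. c s = x})
     \<and> (\<forall>e>0. \<forall>\<^sub>F n in sequentially. \<forall>y. norm (cn (k n) y - C y) < e)"
proof -
  note u = umin_ucurve[OF m] and un = umin_ucurve[OF mn]
  note L = ucurveD(1)[OF u]
  have rng: "range (cn n) = range c" for n by (rule range_eqI_card[OF mn m card])
  have Een: "energy L (hn n) = energy L h" for n using m mn[of n] unfolding umin_def by (meson order.antisym)
  define W where "W = energy L h"
  have comp: "compact (range c)" 
  proof -
    have "range c \<subseteq> c ` {0..L}" unfolding ucurve_range[OF u] by auto
    then have "range c = c ` {0..L}" by blast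
    then show ?thesis by (metis compact_Icc compact_continuous_image continuous_on_subset subset_UNIV ucurveD(9)[OF u])
  qed
  obtain B where B: "\<And>x. x \<in> range c \<Longrightarrow> norm x \<le> B" using compact_imp_bounded[OF comp, unfolded bounded_iff] by meson
  have W0: "0 \<le> W" unfolding W_def energy_def by (rule integral_nonneg[OF ucurve_energy_integrable[OF u]]) simp
  \<comment> \<open>Pairing position and tangent yields one subsequence for both.\<close>
  define F where "F = (\<lambda>n t. (cn n t, Tn n t))"
  have holder: "norm (Tn n y - Tn n x) \<le> sqrt (\<bar>y - x\<bar> * W)" if "x \<in> {0..L}" "y \<in> {0..L}" for n x y
  proof -
    have "(norm (Tn n y - Tn n x))\<^sup>2 \<le> \<bar>y - x\<bar> * W"
      using ucurve_holder[OF un[of n], of x y] ucurve_holder[OF un[of n], of y x] that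
      by (cases "x \<le> y") (auto simp: Een W_def norm_minus_commute)
    then show ?thesis by (rule real_le_rsqrt)
  qed
  have clip: "norm (cn n y - cn n x) \<le> \<bar>y - x\<bar>" if "x \<in> {0..L}" "y \<in> {0..L}" for n x y
    using lipschitz_onD[OF ucurve_lipschitz[OF un[of n]] that(2,1)] by (simp add: dist_norm)
  obtain g k where g: "continuous_on {0..L} g" "strict_mono (k :: nat \<Rightarrow> nat)"
    and unif: "\<And>e. 0 < e \<Longrightarrow> \<exists>N. \<forall>n x. n \<ge> N \<and> x \<in> {0..L} \<longrightarrow> norm (F (k n) x - g x) < e"
  proof (rule Arzela_Ascoli[of "{0..L}" F "B + 1"])
    show "norm (F n x) \<le> B + 1" if "x \<in> {0..L}" for n x
    proof -
      have "cn n x \<in> range c" using rng[of n] by blast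
      then have "norm (cn n x) \<le> B" by (rule B)
      moreover have "norm (Tn n x) = 1" by (rule ucurveD(5)[OF un])
      ultimately show ?thesis unfolding F_def using norm_Pair_le[of "cn n x" "Tn n x"] by linarith
    qed
    show "\<exists>d>0. \<forall>n y. y \<in> {0..L} \<and> norm (x - y) < d \<longrightarrow> norm (F n x - F n y) < e" if x: "x \<in> {0..L}" and e: "0 < e" for x e
    proof -
      define d where "d = min (e / 2) ((e / 2)\<^sup>2 / (W + 1))"
      have "0 < d" using e W0 by (auto simp: d_def)
      moreover have "d \<le> e / 2" "d \<le> (e / 2)\<^sup>2 / (W + 1)"
        unfolding d_def by (rule min.cobounded1, rule min.cobounded2)
      ultimately have d: "0 < d" "d \<le> e / 2" "d \<le> (e / 2)\<^sup>2 / (W + 1)" by blast+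
      then have d3: "d * (W + 1) \<le> (e / 2)\<^sup>2" using W0 by (simp add: pos_le_divide_eq)
      have "norm (F n x - F n y) < e" if y: "y \<in> {0..L}" "norm (x - y) < d" for n y
      proof -
        have "norm (cn n x - cn n y) < e / 2" using clip[OF y(1) x, of n] y(2) d(2) by simp
        moreover have "norm (Tn n x - Tn n y) \<le> e / 2"
        proof -
          have "\<bar>x - y\<bar> * W \<le> d * (W + 1)" using y(2) W0 d(1) by (intro mult_mono) auto
          then have "sqrt (\<bar>x - y\<bar> * W) \<le> sqrt ((e / 2)\<^sup>2)" using d3 by (intro real_sqrt_le_mono) linarith
          then show ?thesis using holder[OF y(1) x, of n] e by simp
        qed
        ultimately show ?thesis
          unfolding F_def using norm_Pair_le[of "cn n x - cn n y" "Tn n x - Tn n y"] by simp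
      qed
      then show ?thesis using d(1) by blast
    qed
  qed (simp, rule that)
  define C0 U0 where "C0 = (\<lambda>t. fst (g t))" and "U0 = (\<lambda>t. snd (g t))"
  have cU0: "continuous_on {0..L} U0" "continuous_on {0..L} C0" unfolding U0_def C0_def by (intro continuous_intros g)+
  have unifc: "\<exists>N. \<forall>n\<ge>N. \<forall>x\<in>{0..L}. norm (cn (k n) x - C0 x) < e \<and> norm (Tn (k n) x - U0 x) < e" if "0 < e" for e
  proof -
    obtain N where N: "\<And>n x. n \<ge> N \<Longrightarrow> x \<in> {0..L} \<Longrightarrow> norm (F (k n) x - g x) < e" using unif[OF \<open>0 < e\<close>] by blast
    have "norm (cn (k n) x - C0 x) < e \<and> norm (Tn (k n) x - U0 x) < e" if "n \<ge> N" "x \<in> {0..L}" for n x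
    proof -
      let ?v = "F (k n) x - g x"
      have "norm (fst ?v) \<le> norm ?v" "norm (snd ?v) \<le> norm ?v"
        using norm_fst_le[of "fst ?v" "snd ?v"] norm_snd_le[of "snd ?v" "fst ?v"] by (simp_all only: prod.collapse)
      moreover have "fst ?v = cn (k n) x - C0 x" "snd ?v = Tn (k n) x - U0 x" by (simp_all add: F_def C0_def U0_def)
      ultimately show ?thesis using N[OF that] by (simp del: fst_diff snd_diff)
    qed
    then show ?thesis by blast
  qed
  have limc: "(\<lambda>n. cn (k n) x) \<longlonglongrightarrow> C0 x" and limT: "(\<lambda>n. Tn (k n) x) \<longlonglongrightarrow> U0 x" if "x \<in> {0..L}" for x
    using unifc that unfolding LIMSEQ_iff by blast+
  have dens: "has_density L C0 U0"
  proof (rule has_densityI)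
    show "U0 integrable_on {0..L}" by (rule integrable_continuous_interval[OF cU0(1)])
    fix t assume t: "t \<in> {0..L}"
    have lim1: "(\<lambda>n. integral {0..t} (Tn (k n))) \<longlonglongrightarrow> integral {0..t} U0"
      unfolding LIMSEQ_iff
    proof (intro allI impI)
      fix e :: real assume e: "0 < e"
      obtain N where N: "\<And>n x. n \<ge> N \<Longrightarrow> x \<in> {0..L} \<Longrightarrow> norm (Tn (k n) x - U0 x) < e / (L + 1)"
        using unifc[of "e / (L + 1)"] e L by fastforce
      have "norm (integral {0..t} (Tn (k n)) - integral {0..t} U0) < e" if n: "n \<ge> N" for n
      proof -
        have i: "Tn (k n) integrable_on {0..t}" "U0 integrable_on {0..t}"
          using t by (auto intro!: integrable_continuous_interval continuous_on_subset[OF cU0(1)] continuous_on_subset[OF ucurveD(10)[OF un]])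
        have "norm (integral {0..t} (\<lambda>x. Tn (k n) x - U0 x)) \<le> e / (L + 1) * (t - 0)"
        proof (rule integral_bound)
          have "continuous_on {0..t} U0" using t by (intro continuous_on_subset[OF cU0(1)]) auto
          then show "continuous_on {0..t} (\<lambda>x. Tn (k n) x - U0 x)"
            by (intro continuous_on_diff continuous_on_subset[OF ucurveD(10)[OF un] subset_UNIV])
          show "norm (Tn (k n) x - U0 x) \<le> e / (L + 1)" if "x \<in> {0..t}" for x
            using N[OF n, of x] t that by auto
        qed (use t in simp)
        also have "\<dots> \<le> e / (L + 1) * L" using t e L by (intro mult_left_mono) auto
        also have "\<dots> < e" using e L by (simp add: field_simps)
        finally show ?thesis using i by (simp add: integral_diff)
      qed
      then show "\<exists>N. \<forall>n\<ge>N. norm (integral {0..t} (Tn (k n)) - integral {0..t} U0) < e" by blast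
    qed
    have "integral {0..t} (Tn (k n)) = cn (k n) t - cn (k n) 0" for n
      by (rule integral_unique[OF has_densityD[OF ucurveD(8)[OF un]]]) (use t in auto)
    then have "(\<lambda>n. cn (k n) t - cn (k n) 0) \<longlonglongrightarrow> integral {0..t} U0" using lim1 by simp
    moreover have "(\<lambda>n. cn (k n) t - cn (k n) 0) \<longlonglongrightarrow> C0 t - C0 0" using limc t L by (intro tendsto_intros) auto
    ultimately have "C0 t - C0 0 = integral {0..t} U0" using LIMSEQ_unique by blast
    then show "C0 t = C0 0 + integral {0..t} U0" by (simp add: algebra_simps)
  qed
  have in0L: "0 \<in> {0..L}" "L \<in> {0..L}" using L by auto
  have C0p: "C0 0 = C0 L"
  proof -
    have "cn (k n) 0 = cn (k n) L" for n using ucurveD(2)[OF un, of "k n" 0] by simp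
    then show ?thesis using LIMSEQ_unique[OF limc[OF in0L(1)]] limc[OF in0L(2)] by simp
  qed
  have U0p: "U0 0 = U0 L"
  proof -
    have "Tn (k n) 0 = Tn (k n) L" for n using ucurveD(3)[OF un, of "k n" 0] by simp
    then show ?thesis using LIMSEQ_unique[OF limT[OF in0L(1)]] limT[OF in0L(2)] by simp
  qed
  have nU0: "norm (U0 t) = 1" if "t \<in> {0..L}" for t
    using LIMSEQ_unique[OF tendsto_norm[OF limT[OF that]]] ucurveD(5)[OF un] by (simp add: LIMSEQ_const_iff)
  \<comment> \<open>For each fixed mesh the energy is a finite sum of continuous terms, so the bound
    survives the limit.\<close>
  have den: "denergy L U0 n \<le> W" for n
  proof -
    have pt: "real j * mesh L n \<in> {0..L}" if "j \<le> 2 ^ n" for j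
    proof -
      have "real j \<le> real (2 ^ n)" using that by (rule of_nat_mono)
      then have "real j * mesh L n \<le> real (2 ^ n) * mesh L n" using mesh_pos[OF L, of n] by (intro mult_right_mono) auto
      then show ?thesis unfolding mesh_total[OF L] using mesh_pos[OF L, of n] by auto
    qed
    have "(\<lambda>i. denergy L (Tn (k i)) n) \<longlonglongrightarrow> denergy L U0 n"
      unfolding denergy_def[OF L]
    proof (rule tendsto_sum)
      fix j assume "j \<in> {..<(2::nat) ^ n}"
      then have j: "j \<le> 2 ^ n" "Suc j \<le> 2 ^ n" by auto
      show "(\<lambda>i. (norm (Tn (k i) (real (Suc j) * mesh L n) - Tn (k i) (real j * mesh L n)))\<^sup>2 / mesh L n)
        \<longlonglongrightarrow> (norm (U0 (real (Suc j) * mesh L n) - U0 (real j * mesh L n)))\<^sup>2 / mesh L n"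
        using mesh_pos[OF L, of n] by (intro tendsto_intros limT pt j) auto
    qed
    then show ?thesis
      by (rule LIMSEQ_le_const2) (use ucurve_denergy[OF un] Een in \<open>auto simp: W_def\<close>)
  qed
  obtain H0 where H0: "H0 \<in> borel_measurable borel" "(\<lambda>t. (norm (H0 t))\<^sup>2) integrable_on {0..L}"
    "integral {0..L} (\<lambda>t. (norm (H0 t))\<^sup>2) \<le> W" "has_density L U0 H0"
    using riesz_criterion[OF L cU0(1) den] by blast
  note Bld = ucurve_build[OF L cU0(1) U0p nU0 dens C0p H0(1,2,4)]
  define C U H where "C = per L C0" and "U = per L U0" and "H = per L H0"
  have uC: "ucurve L C U H" using Bld(1) by (simp add: C_def U_def H_def)
  have eC: "energy L H \<le> W" using Bld(2) H0(3) by (simp add: H_def energy_def)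
  have C_eq: "C t = C0 t" if "t \<in> {0..L}" for t unfolding C_def by (rule per_eq[OF L C0p that])
  have U_eq: "U t = U0 t" if "t \<in> {0..L}" for t unfolding U_def by (rule per_eq[OF L U0p that])
  have rC: "range C \<subseteq> range c"
  proof
    fix x assume "x \<in> range C"
    then have "x \<in> C ` {0..<L}" unfolding ucurve_range[OF uC] .
    then obtain t where "t \<in> {0..<L}" "x = C t" by blast
    then have t: "t \<in> {0..L}" "x = C0 t" using C_eq[of t] by auto
    have "cn (k n) t \<in> range c" for n using rng by blast
    then show "x \<in> range c" unfolding t(2)
      using closed_sequentially[OF compact_imp_closed[OF comp] _ limc[OF t(1)]] by blast
  qed
  have mC: "umin \<Omega> L C U H"
    unfolding umin_def uadm_def
  proof (intro conjI uC allI impI)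
    show "range C \<subseteq> closure \<Omega>" using rC m by (auto simp: umin_def uadm_def)
    show "U s = U t \<or> U s = - U t" if st: "C s = C t" for s t
    proof -
      obtain \<sigma> where \<sigma>: "C s = c \<sigma>" using rC by blast
      have "U s = T \<sigma> \<or> U s = - T \<sigma>" by (rule tangent_of_subset[OF m ucurveD(4)[OF uC] rC ucurveD(5)[OF uC] \<sigma>])
      moreover have "U t = T \<sigma> \<or> U t = - T \<sigma>"
        by (rule tangent_of_subset[OF m ucurveD(4)[OF uC] rC ucurveD(5)[OF uC]]) (use st \<sigma> in simp)
      ultimately show ?thesis by auto
    qed
    show "energy L H \<le> energy L' h'" if "ucurve L' c' T' h' \<and> range c' \<subseteq> closure \<Omega> \<and> (\<forall>s t. c' s = c' t \<longrightarrow> T' s = T' t \<or> T' s = - T' t)" for L' c' T' h'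
      using eC m that unfolding umin_def uadm_def W_def by (meson order_trans)
  qed
  have conv: "\<forall>\<^sub>F n in sequentially. \<forall>y. norm (cn (k n) y - C y) < e" if e0: "0 < e" for e
  proof -
    obtain N where N: "\<And>n x. n \<ge> N \<Longrightarrow> x \<in> {0..L} \<Longrightarrow> norm (cn (k n) x - C0 x) < e" using unifc[OF e0] by blast
    have "norm (cn (k n) y - C y) < e" if n: "n \<ge> N" for n y
    proof -
      obtain i s where s: "y = s + of_int i * L" "0 \<le> s" "s < L" using periodic_reduce[OF L] .
      have "cn (k n) y = cn (k n) s" unfolding s(1) by (rule periodic_int[where f = "cn (k n)"]) (rule ucurveD(2)[OF un])
      moreover have "C y = C s" unfolding s(1) by (rule periodic_int[where f = C]) (rule ucurveD(2)[OF uC])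
      ultimately show ?thesis using N[OF n, of s] C_eq[of s] s by simp
    qed
    then show ?thesis unfolding eventually_sequentially by blast
  qed
  \<comment> \<open>Fibres have at most two points, so only the counts 0, 1 and 2 have to be
    compared.\<close>
  have cardC: "card {s \<in> {0..<L}. C s = x} = card {s \<in> {0..<L}. c s = x}" for x
  proof -
    let ?A = "{s \<in> {0..<L}. C s = x}" and ?B = "{s \<in> {0..<L}. c s = x}"
    note fA = umin_fibre[OF mC, of x] and fB = umin_fibre[OF m, of x] and fn = umin_fibre(1)[OF mn]
    have lim_in: "C t = x" if S: "\<And>n. S n \<in> {0..L}" "\<And>n. cn (k n) (S n) = x" and j: "strict_mono j" and St: "(\<lambda>n. S (j n)) \<longlonglongrightarrow> t" for S j t
    proof -
      have "(\<lambda>n. C (S (j n))) \<longlonglongrightarrow> C t"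
        using ucurveD(9)[OF uC] by (intro isCont_tendsto_compose[OF _ St]) (auto simp: continuous_on_eq_continuous_at)
      moreover have "(\<lambda>n. C (S (j n))) \<longlonglongrightarrow> x"
        unfolding LIMSEQ_iff
      proof (intro allI impI)
        fix e :: real assume "0 < e"
        then obtain N where N: "\<And>n y. n \<ge> N \<Longrightarrow> norm (cn (k n) y - C y) < e"
          using conv unfolding eventually_sequentially by blast
        have "norm (C (S (j n)) - x) < e" if "n \<ge> N" for n
          using N[of "j n" "S (j n)"] S(2)[of "j n"] seq_suble[OF j, of n] that by (simp add: norm_minus_commute)
        then show "\<exists>N. \<forall>n\<ge>N. norm (C (S (j n)) - x) < e" by blast
      qed
      ultimately show ?thesis using LIMSEQ_unique by blast
    qed
    consider "card ?B = 0" | "card ?B = 1" | "card ?B = 2" using fB(2) by linarith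
    then show ?thesis
    proof cases
      case 1
      then have "x \<notin> range C" using fibre_empty_iff[OF m] rC by blast
      then show ?thesis using fibre_empty_iff[OF mC] 1 by simp
    next
      case 2
      have cn1: "card {s \<in> {0..<L}. cn n s = x} = 1" for n using card 2 by simp
      have "\<exists>s\<in>{0..L}. cn (k n) s = x" for n
      proof -
        have "{s \<in> {0..<L}. cn (k n) s = x} \<noteq> {}" using cn1[of "k n"] by (metis card.empty zero_neq_one)
        then show ?thesis by fastforce
      qed
      then obtain S where S: "\<And>n. S n \<in> {0..L}" "\<And>n. cn (k n) (S n) = x" by metis
      obtain t j where j: "t \<in> {0..L}" "strict_mono (j :: nat \<Rightarrow> nat)" "(S \<circ> j) \<longlonglongrightarrow> t"
        using S(1) compact_Icc[of 0 L, unfolded compact_def] by metis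
      have "C t = x" by (rule lim_in[OF S j(2)]) (use j(3) in \<open>simp add: o_def\<close>)
      then have "x \<in> range C" by blast
      then have "card ?A \<noteq> 0" using fibre_empty_iff[OF mC, of x] by metis
      \<comment> \<open>Two passages of the limit through \<open>x\<close> would force the nearby
        curves to hit \<open>x\<close> near each of them, hence twice.\<close>
      moreover have "\<not> 2 \<le> card ?A"
      proof
        assume "2 \<le> card ?A"
        then have "\<not> card ?A \<le> Suc 0" by simp
        then obtain a b where ab: "a \<in> ?A" "b \<in> ?A" "a \<noteq> b" unfolding card_le_Suc0_iff_eq[OF fA(1)] by blast
        obtain s t where st: "s \<in> ?A" "t \<in> ?A" "s < t"
          by (rule linorder_cases[of a b]) (use ab that in blast)+
        have st': "0 \<le> s" "t < L" "C s = x" "C t = x" using st(1,2) by simp_all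
        \<comment> \<open>Half the distance of \<open>s\<close> and \<open>t\<close> on the circle,
          so that the windows around them are disjoint modulo \<open>L\<close>.\<close>
        define \<rho> where "\<rho> = min (t - s) (L - (t - s)) / 2"
        have "2 * \<rho> = min (t - s) (L - (t - s))" by (simp add: \<rho>_def)
        then have \<rho>: "0 < \<rho>" "2 * \<rho> \<le> t - s" "2 * \<rho> \<le> L - (t - s)" using st(3) st' by linarith+
        obtain \<sigma> where "C s = c \<sigma>" using rC by blast
        then have \<sigma>: "c \<sigma> = x" using st'(3) by simp
        have "\<forall>\<^sub>F n in sequentially. \<exists>y. z - \<rho> < y \<and> y < z + \<rho> \<and> cn (k n) y = x" if "C z = x" for z
        proof (rule nearby_curves_hit[where cn = "\<lambda>n. cn (k n)" and C = C, OF m \<sigma> ucurveD(4)[OF uC] rC ucurveD(5)[OF uC] that])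
          show "continuous_on UNIV (cn (k n))" for n by (rule ucurveD(9)[OF un])
          show "range (cn (k n)) \<subseteq> range c" for n unfolding rng by (rule subset_refl)
        qed (rule conv \<rho>(1), assumption?)+
        from eventually_conj[OF this[OF st'(3)] this[OF st'(4)]]
        have "\<forall>\<^sub>F n in sequentially. (\<exists>y. s - \<rho> < y \<and> y < s + \<rho> \<and> cn (k n) y = x) \<and> (\<exists>y. t - \<rho> < y \<and> y < t + \<rho> \<and> cn (k n) y = x)" .
        then obtain n y y' where y: "s - \<rho> < y" "y < s + \<rho>" "cn (k n) y = x" "t - \<rho> < y'" "y' < t + \<rho>" "cn (k n) y' = x"
          unfolding eventually_sequentially by blast
        obtain i z where z: "y = z + of_int i * L" "0 \<le> z" "z < L" using periodic_reduce[OF L] .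
        obtain i' z' where z': "y' = z' + of_int i' * L" "0 \<le> z'" "z' < L" using periodic_reduce[OF L] .
        have "cn (k n) z = x" using y(3) unfolding z(1) by (subst (asm) periodic_int[where f = "cn (k n)"]) (auto simp: ucurveD(2)[OF un])
        moreover have "cn (k n) z' = x" using y(6) unfolding z'(1) by (subst (asm) periodic_int[where f = "cn (k n)"]) (auto simp: ucurveD(2)[OF un])
        moreover have "z \<noteq> z'"
        proof
          assume "z = z'"
          then have d: "y' - y = of_int (i' - i) * L" using z(1) z'(1) by (simp add: algebra_simps)
          have "0 < y' - y" "y' - y < L" using y \<rho> by auto
          then have "0 < of_int (i' - i) * L" "of_int (i' - i) * L < 1 * L" unfolding d by auto
          then have "0 < real_of_int (i' - i)" "real_of_int (i' - i) < 1" using L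
            by (auto simp: zero_less_mult_iff mult_less_cancel_right)
          then show False by (simp only: of_int_0_less_iff of_int_less_1_iff)
        qed
        ultimately have "2 \<le> card {s \<in> {0..<L}. cn (k n) s = x}"
          by (intro card_ge_2I[OF fn, of z "k n" x z']) (use z z' in auto)
        then show False using cn1[of "k n"] by simp
      qed
      ultimately show ?thesis using 2 by linarith
    next
      case 3
      have "\<exists>s t. s \<in> {0..L} \<and> t \<in> {0..L} \<and> cn (k n) s = x \<and> cn (k n) t = x \<and> Tn (k n) t = - Tn (k n) s" for n
      proof -
        have "card {s \<in> {0..<L}. cn (k n) s = x} = 2" using card 3 by simp
        then obtain s t where "{s \<in> {0..<L}. cn (k n) s = x} = {s, t}" "s \<noteq> t" by (meson card_2_iff)
        then have st: "s \<in> {0..<L}" "t \<in> {0..<L}" "cn (k n) s = x" "cn (k n) t = x" "s \<noteq> t" by blast+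
        have "Tn (k n) t = - Tn (k n) s"
        proof (cases "s < t")
          case True
          then show ?thesis using st by (intro umin_opposite[OF mn]) auto
        next
          case False
          then have "Tn (k n) s = - Tn (k n) t" using st by (intro umin_opposite[OF mn]) auto
          then show ?thesis by simp
        qed
        then show ?thesis using st by (intro exI[of _ s] exI[of _ t]) auto
      qed
      then obtain S R where S: "\<And>n. S n \<in> {0..L}" "\<And>n. R n \<in> {0..L}" "\<And>n. cn (k n) (S n) = x" "\<And>n. cn (k n) (R n) = x"
        "\<And>n. Tn (k n) (R n) = - Tn (k n) (S n)" by metis
      obtain s j1 where j1: "s \<in> {0..L}" "strict_mono (j1 :: nat \<Rightarrow> nat)" "(S \<circ> j1) \<longlonglongrightarrow> s"
        using S(1) compact_Icc[of 0 L, unfolded compact_def] by metis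
      obtain t j2 where j2: "t \<in> {0..L}" "strict_mono (j2 :: nat \<Rightarrow> nat)" "((R \<circ> j1) \<circ> j2) \<longlonglongrightarrow> t"
        using S(2) compact_Icc[of 0 L, unfolded compact_def] by (metis comp_apply)
      define j where "j = j1 \<circ> j2"
      have j: "strict_mono j" unfolding j_def by (rule strict_mono_o[OF j1(2) j2(2)])
      have Sl: "(\<lambda>n. S (j n)) \<longlonglongrightarrow> s" using LIMSEQ_subseq_LIMSEQ[OF j1(3) j2(2)] by (simp add: j_def o_def)
      have Rl: "(\<lambda>n. R (j n)) \<longlonglongrightarrow> t" using j2(3) by (simp add: j_def o_def)
      have xs: "C s = x" "C t = x" using lim_in[OF S(1,3) j Sl] lim_in[OF S(2,4) j Rl] by auto
      have lT: "(\<lambda>n. Tn (k (j n)) (Q (j n))) \<longlonglongrightarrow> U q" if Q: "\<And>n. Q n \<in> {0..L}" "(\<lambda>n. Q (j n)) \<longlonglongrightarrow> q" for Q q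
      proof -
        have "(\<lambda>n. U (Q (j n))) \<longlonglongrightarrow> U q"
          using ucurveD(10)[OF uC] by (intro isCont_tendsto_compose[OF _ Q(2)]) (auto simp: continuous_on_eq_continuous_at)
        moreover have "(\<lambda>n. Tn (k (j n)) (Q (j n)) - U (Q (j n))) \<longlonglongrightarrow> 0"
          unfolding LIMSEQ_iff
        proof (intro allI impI)
          fix e :: real assume "0 < e"
          then obtain N where N: "\<And>n x. n \<ge> N \<Longrightarrow> x \<in> {0..L} \<Longrightarrow> norm (Tn (k n) x - U0 x) < e" using unifc by blast
          have "norm (Tn (k (j n)) (Q (j n)) - U (Q (j n)) - 0) < e" if "n \<ge> N" for n
            using N[of "j n" "Q (j n)"] Q(1) U_eq seq_suble[OF j, of n] that by simp
          then show "\<exists>N. \<forall>n\<ge>N. norm (Tn (k (j n)) (Q (j n)) - U (Q (j n)) - 0) < e" by blast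
        qed
        ultimately show ?thesis using tendsto_add by fastforce
      qed
      \<comment> \<open>The two passages might merge as parameters converge, but opposite tangents
        remain opposite in the C^1 limit and so tell \<open>s\<close> and \<open>t\<close>
        apart.\<close>
      have "U t = - U s"
        using LIMSEQ_unique[OF lT[OF S(2) Rl]] tendsto_minus[OF lT[OF S(1) Sl]] S(5) by simp
      then have ne: "U t \<noteq> U s" using ucurveD(5)[OF uC, of s] by (metis minus_unique norm_eq_zero right_minus scaleR_2 scaleR_eq_0_iff zero_neq_numeral zero_neq_one add_eq_0_iff)
      \<comment> \<open>Limits of parameters may be \<open>L\<close>, which stands for the same
        point of the circle as \<open>0\<close>.\<close>
      define z where "z = (\<lambda>q. if q = L then 0 else q)"
      have zC: "C (z q) = C q" "U (z q) = U q" for q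
        using ucurveD(2)[OF uC, of 0] ucurveD(3)[OF uC, of 0] by (auto simp: z_def)
      have "z q \<in> {0..<L}" if "q \<in> {0..L}" for q using that L by (auto simp: z_def)
      then have "z s \<in> ?A" "z t \<in> ?A" using j1(1) j2(1) xs zC(1) by auto
      moreover have "z s \<noteq> z t" using ne zC(2)[of s] zC(2)[of t] by metis
      ultimately have "2 \<le> card ?A" by (rule card_ge_2I[OF fA(1)])
      then show ?thesis using fA(2) 3 by simp
    qed
  qed
  show ?thesis using mC g(2) cardC conv by blast
qed

section \<open>The index of the limit curve\<close>

lemma ucurve_index:
  assumes u: "ucurve L c T h" and z: "z \<notin> range c"
  shows "curve_index (\<lambda>t. c (L * t)) z = wn c 0 L z"
    "winding_number (\<lambda>t. c (L * t)) z = wn c 0 L z"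
    "path (\<lambda>t. c (L * t))" "pathfinish (\<lambda>t. c (L * t)) = pathstart (\<lambda>t. c (L * t))"
proof -
  let ?\<eta> = "\<lambda>t. c (L * t)"
  note R = ucurve_regular[OF u]
  have "?\<eta> C1_differentiable_on {0..1}"
    unfolding C1_differentiable_on_def
    by (intro exI[of _ "\<lambda>t. L *\<^sub>R T (L * t)"] conjI ballI R(6) continuous_on_subset[OF R(5) subset_UNIV])
  then have vp: "valid_path ?\<eta>" unfolding valid_path_def by (rule C1_differentiable_imp_piecewise)
  then show "path ?\<eta>" by (rule valid_path_imp_path)
  show "pathfinish ?\<eta> = pathstart ?\<eta>" using ucurveD(2)[OF u, of 0] by (simp add: pathfinish_def pathstart_def)
  show wn: "winding_number ?\<eta> z = wn c 0 L z" by (simp add: wn_def)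
  have "z \<notin> path_image ?\<eta>" using z by (auto simp: path_image_def)
  from winding_number_valid_path[OF vp this]
  show "curve_index ?\<eta> z = wn c 0 L z" unfolding wn[symmetric] curve_index_def by simp
qed

text \<open>The sets \<open>Z n\<close> exhaust the complement of the image. Flips at scale a
  quarter of \<open>1 / (n + 1)\<close> settle the index on \<open>Z n\<close>. A given
  \<open>z\<close> lies in \<open>Z (k n)\<close> for large \<open>n\<close>, where the curve is
  also closer to the limit than \<open>z\<close> is, so the winding numbers agree.\<close>

lemma umin_index:
  assumes m: "umin \<Omega> L c T h"
  shows "\<exists>C U H. umin \<Omega> L C U H \<and> (\<forall>x. card {s \<in> {0..<L}. C s = x} = card {s \<in> {0..<L}. c s = x})
     \<and> (\<forall>z. z \<notin> range C \<longrightarrow> wn C 0 L z \<in> {0, 1})"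
proof -
  note u = umin_ucurve[OF m]
  note L = ucurveD(1)[OF u]
  define Z where "Z = (\<lambda>n. {z. \<forall>s\<in>{0..L}. inverse (real (Suc n)) \<le> norm (c s - z)})"
  have "\<exists>c' T' h'. umin \<Omega> L c' T' h' \<and> (\<forall>x. card {s \<in> {0..<L}. c' s = x} = card {s \<in> {0..<L}. c s = x})
     \<and> (\<forall>z\<in>Z n. wn c' 0 L z \<in> {0, 1})" for n
  proof -
    have "\<exists>q. flips L c q \<and> (\<forall>z\<in>Z n. wn q 0 L z \<in> {0, 1})"
      by (rule flips_wn[of "inverse (real (Suc n)) / 4", OF _ ucurve_loop[OF u] ucurve_lipschitz[OF u] umin_unlinked[OF m]])
         (auto simp: Z_def)
    then obtain q where q: "flips L c q" "\<And>z. z \<in> Z n \<Longrightarrow> wn q 0 L z \<in> {0, 1}" by blast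
    obtain c' T' h' where c': "umin \<Omega> L c' T' h'" "\<And>s. s \<in> {0..L} \<Longrightarrow> c' s = q s"
      "\<forall>x. card {s \<in> {0..<L}. c' s = x} = card {s \<in> {0..<L}. c s = x}" using umin_flips[OF q(1) m] by blast
    have "wn c' 0 L z = wn q 0 L z" for z by (rule wn_cong) (use c'(2) L in auto)
    then have "\<forall>z\<in>Z n. wn c' 0 L z \<in> {0, 1}" using q(2) by simp
    then show ?thesis using c'(1,3) by blast
  qed
  then have "\<forall>n. \<exists>c' T' h'. umin \<Omega> L c' T' h' \<and> (\<forall>x. card {s \<in> {0..<L}. c' s = x} = card {s \<in> {0..<L}. c s = x})
     \<and> (\<forall>z\<in>Z n. wn c' 0 L z \<in> {0, 1})" by (rule allI)
  then obtain cn Tn hn where cn: "\<And>n. umin \<Omega> L (cn n) (Tn n) (hn n)"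
    "\<And>n x. card {s \<in> {0..<L}. cn n s = x} = card {s \<in> {0..<L}. c s = x}" "\<And>n z. z \<in> Z n \<Longrightarrow> wn (cn n) 0 L z \<in> {0, 1}"
    unfolding choice_iff by blast
  obtain C U H k where C: "umin \<Omega> L C U H" "strict_mono (k :: nat \<Rightarrow> nat)"
    "\<forall>x. card {s \<in> {0..<L}. C s = x} = card {s \<in> {0..<L}. c s = x}"
    "\<forall>e>0. \<forall>\<^sub>F n in sequentially. \<forall>y. norm (cn (k n) y - C y) < e"
    using umin_limit[where cn = cn, OF m cn(1,2)] by (elim exE conjE) (rule that; assumption)
  have rC: "range C = range c" by (rule range_eqI_card[OF C(1) m C(3)[rule_format]])
  have "wn C 0 L z \<in> {0, 1}" if z: "z \<notin> range C" for z
  proof -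
    have cl: "closed (c ` {0..L})"
      by (intro compact_imp_closed compact_continuous_image continuous_on_subset[OF ucurveD(9)[OF u] subset_UNIV]) simp
    have "c ` {0..L} \<subseteq> range C" unfolding rC by (rule image_mono) simp
    then have "z \<notin> c ` {0..L}" using z by (rule contra_subsetD)
    from separate_point_closed[OF cl this]
    obtain d where d: "0 < d" "\<forall>x\<in>c ` {0..L}. d \<le> dist z x" by (elim exE conjE) (rule that; assumption)
    have dC: "d \<le> norm (C s - z)" for s
    proof -
      have "C s \<in> c ` {0..<L}" using rC ucurve_range[OF u] by blast
      moreover have "c ` {0..<L} \<subseteq> c ` {0..L}" by (rule image_mono) auto
      ultimately have "d \<le> dist z (C s)" using d(2) by (meson subsetD)
      then show ?thesis by (simp add: dist_norm norm_minus_commute)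
    qed
    have "\<forall>\<^sub>F n in sequentially. inverse (real (Suc n)) < d"
      by (rule order_tendstoD(2)[OF LIMSEQ_inverse_real_of_nat d(1)])
    from eventually_conj[OF this C(4)[rule_format, OF d(1)]]
    obtain n where n: "inverse (real (Suc n)) < d" "\<And>y. norm (cn (k n) y - C y) < d"
      unfolding eventually_sequentially by blast
    have "inverse (real (Suc (k n))) \<le> inverse (real (Suc n))"
      using seq_suble[OF C(2), of n] by (intro le_imp_inverse_le) auto
    moreover have "d \<le> norm (c s - z)" if "s \<in> {0..L}" for s
      using bspec[OF d(2) imageI[OF that]] by (simp add: dist_norm norm_minus_commute)
    ultimately have "inverse (real (Suc (k n))) \<le> norm (c s - z)" if "s \<in> {0..L}" for s
      using n(1) that by (meson less_imp_le order_trans)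
    then have "z \<in> Z (k n)" unfolding Z_def by blast
    then have "wn (cn (k n)) 0 L z \<in> {0, 1}" by (rule cn(3))
    moreover have "wn (cn (k n)) 0 L z = wn C 0 L z"
    proof (rule wn_nearby)
      show "norm (cn (k n) t - C t) < norm (C t - z)" for t using n(2)[of t] dC[of t] by linarith
    qed (use ucurve_loop[OF umin_ucurve[OF cn(1)[of "k n"]]] ucurve_loop[OF umin_ucurve[OF C(1)]] in \<open>auto simp: is_loop_def\<close>)
    ultimately show ?thesis by simp
  qed
  then show ?thesis using C(1,3) by blast
qed

theorem theorem4p4:
  fixes \<Omega> :: "complex set" and \<gamma> :: "real \<Rightarrow> complex"
  assumes "open \<Omega>" and "bounded \<Omega>" and "lipschitz_boundary \<Omega>"
    and "minimal_curve \<Omega> \<gamma>"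
  shows "\<exists>\<eta>. parametrization_of \<Omega> \<gamma> \<eta>
    \<and> curve_index \<eta> ` (UNIV - range \<eta>) \<subseteq> {0, 1}
    \<and> (simply_connected \<Omega> \<longrightarrow> {z \<in> UNIV - range \<eta>. curve_index \<eta> z = 1} \<subseteq> \<Omega>)"
proof -
  obtain L c T h where m: "umin \<Omega> L c T h"
    and \<gamma>: "\<And>x. card {t \<in> {0..<1}. \<gamma> t = x} = card {s \<in> {0..<L}. c s = x}"
    using minimal_umin[OF assms(4)] by blast
  obtain C U H where C: "umin \<Omega> L C U H" "\<And>x. card {s \<in> {0..<L}. C s = x} = card {s \<in> {0..<L}. c s = x}"
    "\<And>z. z \<notin> range C \<Longrightarrow> wn C 0 L z \<in> {0, 1}"
    using umin_index[OF m] by blast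
  note u = umin_ucurve[OF C(1)]
  note L = ucurveD(1)[OF u] and I = ucurve_index[OF u]
  let ?\<eta> = "\<lambda>t. C (L * t)"
  have r: "range ?\<eta> = range C" by (rule ucurve_regular(4)[OF u])
  have a: "uadm \<Omega> L C U H" using C(1) by (simp add: umin_def)
  have "card {t \<in> {0..<1}. ?\<eta> t = x} = card {s \<in> {0..<L}. C s = x}" for x
  proof (rule bij_betw_same_card)
    show "bij_betw (\<lambda>t. L * t) {t \<in> {0..<1}. ?\<eta> t = x} {s \<in> {0..<L}. C s = x}"
      by (rule bij_betw_byWitness[where f' = "\<lambda>s. s / L"]) (use L in \<open>auto simp: field_simps\<close>)
  qed
  moreover have "\<forall>t. norm (vector_derivative ?\<eta> (at t)) = L"
    using ucurve_regular(3)[OF u] ucurveD(5)[OF u] L by simp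
  ultimately have "parametrization_of \<Omega> \<gamma> ?\<eta>"
    unfolding parametrization_of_def using uadm_admissible(1)[OF a] \<gamma> C(2) by auto
  moreover have "curve_index ?\<eta> ` (UNIV - range ?\<eta>) \<subseteq> {0, 1}" using I(1) C(3) unfolding r by auto
  moreover have "z \<in> \<Omega>" if s: "simply_connected \<Omega>" and z: "z \<notin> range C" "curve_index ?\<eta> z = 1" for z
  proof (rule ccontr)
    assume n: "z \<notin> \<Omega>"
    have p: "path_image ?\<eta> \<subseteq> range C" by (auto simp: path_image_def)
    have "range C \<subseteq> closure \<Omega>" using a by (simp add: uadm_def)
    then have "winding_number ?\<eta> z = 0"
      using p z(1) by (intro winding_number_exterior[OF assms(1,3) s I(3,4)[OF z(1)] _ n]) auto
    then show False using I(1,2)[OF z(1)] z(2) by simp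
  qed
  ultimately show ?thesis unfolding r by (intro exI[of _ ?\<eta>]) (simp add: r subset_iff)
qed

end
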